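(* Let $E(x)=\sum_{p\le x}1/p-(\log_2 x+\beta)$. For every integer $N\ge 0$ and $x\ge 3$, \[ \mathcal R_2(x)=\frac12(\log_2 x+\beta)^2+\frac{P(2)-\zeta(2)}{2}+\sum_{1\le j\le N}\frac{\alpha_j}{\log^j x}+O_N\big((\log x)^{-N-1}\big), \] where \[ \alpha_j:=\frac{\log^j 2}{j}\left(\frac1j-\log_2 2-\beta\right)+\int_2^\infty\frac{E(t)\log^{j-1}t}{t}\,dt . \]
   Context: $p$ denotes primes; $\log_2 x=\log\log x$ (so $\log_2 2=\log\log 2$). $\mathcal R_2(x)=\sum_{n\le x,\ \Omega(n)=2}1/n$, where $\Omega(n)$ counts prime factors with multiplicity. $\beta=\gamma+\sum_p(1/p+\log(1-1/p))$ is the Mertens constant ($\gamma$ the Euler–Mascheroni constant). $P(s)=\sum_p p^{-s}$ is the prime zeta function and $\zeta$ the Riemann zeta function. *)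

theory Defs
  imports "HOL-Analysis.Analysis" "HOL-Computational_Algebra.Computational_Algebra"
begin

text \<open>The number of prime factors counted with multiplicity.  Note that
  \<open>bigomega 0 = 0\<close>, so \<open>0\<close> does not contribute to \<open>R2\<close> below.\<close>

definition bigomega :: "nat \<Rightarrow> nat" where
  "bigomega n = size (prime_factorization n)"

definition R2 :: "real \<Rightarrow> real" where
  "R2 x = (\<Sum>n | real n \<le> x \<and> bigomega n = 2. 1 / real n)"

definition loglog :: "real \<Rightarrow> real" where
  "loglog x = ln (ln x)"

definition mertens_const :: real where
  "mertens_const = euler_mascheroni +
     (\<Sum>\<^sub>\<infinity>p\<in>{p::nat. prime p}. 1 / real p + ln (1 - 1 / real p))"

text \<open>The Dirichlet series of the prime zeta function and of the Riemann zeta function, which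
  represent these functions for real \<open>s > 1\<close> only; they are used at \<open>s = 2\<close>.\<close>

definition prime_zeta :: "real \<Rightarrow> real" where
  "prime_zeta s = (\<Sum>\<^sub>\<infinity>p\<in>{p::nat. prime p}. real p powr (- s))"

definition zeta :: "real \<Rightarrow> real" where
  "zeta s = (\<Sum>\<^sub>\<infinity>n\<in>{n::nat. n \<ge> 1}. real n powr (- s))"

definition mertens_error :: "real \<Rightarrow> real" where
  "mertens_error x = (\<Sum>p::nat | prime p \<and> real p \<le> x. 1 / real p) - (loglog x + mertens_const)"

definition alpha_integrand :: "nat \<Rightarrow> real \<Rightarrow> real" where
  "alpha_integrand j t = mertens_error t * ln t ^ (j - 1) / t"

text \<open>For \<open>j \<ge> 1\<close>.  The Henstock--Kurzweil integral over \<open>{2..}\<close> is the improper integral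
  from \<open>2\<close> to infinity; it is \<open>0\<close> by convention if that does not converge.\<close>

definition alpha :: "nat \<Rightarrow> real" where
  "alpha j = ln 2 ^ j / real j * (1 / real j - loglog 2 - mertens_const)
     + integral {2..} (alpha_integrand j)"

end

theory Submission
  imports Defs "HOL-Complex_Analysis.Complex_Analysis" "HOL-Real_Asymp.Real_Asymp"
begin

text \<open>
  The expansion of \<open>R2\<close> follows from Dirichlet's hyperbola method at \<open>sqrt x\<close> and partial summation,
  once the error term \<open>E\<close> in Mertens' second theorem is known to be \<open>O((log x)^(-m))\<close> for every \<open>m\<close>.
  The constant \<open>- zeta(2)/2\<close> comes from the dilogarithm identity \<open>2 Li2(1/2) + (log 2)^2 = zeta(2)\<close>.

  The bound for \<open>E\<close> is proved in the variable \<open>u = log x\<close>.  Put \<open>S(x)\<close> for the sum of \<open>1/p\<close> over the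
  primes \<open>p \<le> x\<close> and \<open>Ein(u)\<close> for the integral of \<open>(1 - exp(-v))/v\<close> over \<open>[0, u]\<close>, which equals
  \<open>log u + gamma\<close> up to an exponentially small error.  Then \<open>D(u) = S(exp u) - Ein(u) - Q(0)\<close>, where
  \<open>Q(z)\<close> is the sum of \<open>p^(-1-z) + log(1 - p^(-1-z))\<close> over the primes, has Laplace transform
  \<open>(log(z zeta(1+z)/(1+z)) + Q(z) - Q(0)) / z\<close>.  The inequality \<open>3 + 4 cos t + cos 2t \<ge> 0\<close>
  makes this holomorphic and of at most polynomial growth for
  \<open>Re z > - c T^(-e)\<close>, \<open>|Im z| < T\<close>, with \<open>e > 0\<close> arbitrarily small.  Newman's contour argument with
  \<open>T\<close> a large power of \<open>X\<close> then shows that the integral of \<open>D\<close> over \<open>[X, Y]\<close> is \<open>O(X^(-A))\<close> for every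
  \<open>A\<close>, and since \<open>D(u) + u\<close> is increasing, \<open>D\<close> itself is that small.
\<close>

section \<open>The zeta function near the line Re s = 1\<close>

text \<open>Newman's bound saves only a factor \<open>1/T\<close> in the height \<open>T\<close> of
  the contour, so a saving of \<open>X^(-A)\<close> forces \<open>T\<close> to be a power of
  \<open>X\<close>. A zero-free strip of width \<open>T^(-e)\<close> then contributes
  \<open>exp (- X T^(-e))\<close>, which is small only if \<open>e < 1/A\<close>; hence
  \<open>e\<close> has to be free. With \<open>T = X^(2A)\<close> and \<open>e = 1/(4A)\<close> the
  width is of order \<open>X^(-1/2)\<close> and the exponential beats every power of
  \<open>X\<close>. This dictates the zeta estimates. The growth of \<open>z zeta(1+z)\<close> and
  of its derivative may exceed \<open>|z|\<close> only by \<open>|z|^(2d)\<close>, and the lower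
  bound from the cosine inequality may lose only \<open>|z|^(-d/2)\<close>, with \<open>d\<close> as
  small as desired; a step to the left of size \<open>|z|^(-10d)\<close> then preserves half of the
  lower bound. \<open>Ein\<close> rather than \<open>log u\<close> is subtracted because the contour
  argument needs a function bounded on all of \<open>[0, \<infinity>)\<close>, while
  \<open>log u\<close> is unbounded at \<open>0\<close>. Its transform cancels the logarithmic
  singularity at \<open>z = 0\<close> just as well, and Euler's constant enters through its
  asymptotics alone.\<close>

definition zeta_term :: "nat \<Rightarrow> complex \<Rightarrow> complex" where
  "zeta_term n z = z * of_nat n powr (-1 - z) - of_nat n powr (- z) + of_nat (Suc n) powr (- z)"

text \<open>Here \<open>z\<close> is the distance from the pole: \<open>zeta_entire z = z zeta(1 + z)\<close>, obtained by comparing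
  each \<open>z n^(-1-z)\<close> with its integral over \<open>[n, n + 1]\<close>.\<close>

definition zeta_entire :: "complex \<Rightarrow> complex" where
  "zeta_entire z = 1 + (\<Sum>n. zeta_term (Suc n) z)"

lemma real_segment_of_nat:
  assumes "w \<in> closed_segment (of_nat n :: complex) (of_nat (Suc n))"
  obtains u where "w = of_real u" "real n \<le> u" "u \<le> real (Suc n)"
proof -
  have "w \<in> closed_segment (of_real (real n)) (of_real (real (Suc n)))"
    using assms by simp
  then obtain u where "w = of_real u" "u \<in> closed_segment (real n) (real (Suc n))"
    unfolding closed_segment_of_real by blast
  thus ?thesis using that by (auto simp: closed_segment_eq_real_ivl)
qed

lemma powr_diff_bound:
  fixes z w :: complex
  assumes n: "n > 0" and w: "w \<in> closed_segment (of_nat n) (of_nat (Suc n))" and z: "Re z \<ge> -2"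
  shows "norm (w powr (-1 - z) - of_nat n powr (-1 - z)) \<le> norm (1 + z) * real n powr (-2 - Re z)"
proof -
  have "norm (w powr (-1 - z) - of_nat n powr (-1 - z))
          \<le> (norm (1 + z) * real n powr (-2 - Re z)) * norm (w - of_nat n)"
  proof (rule field_differentiable_bound[OF convex_closed_segment])
    fix v :: complex assume v: "v \<in> closed_segment (of_nat n) (of_nat (Suc n))"
    obtain u where u: "v = of_real u" "real n \<le> u" "u \<le> real (Suc n)"
      using real_segment_of_nat[OF v] .
    have u0: "u > 0" using u n by (simp add: less_le_trans[of 0 "real n"])
    have "v \<notin> \<real>\<^sub>\<le>\<^sub>0" using u u0 by (auto simp: complex_nonpos_Reals_iff)
    thus "((\<lambda>w. w powr (-1 - z)) has_field_derivative ((-1 - z) * v powr (-1 - z - 1)))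
            (at v within closed_segment (of_nat n) (of_nat (Suc n)))"
      by (intro has_field_derivative_at_within[OF has_field_derivative_powr]) auto
    have "norm (v powr (-1 - z - 1)) = u powr (-2 - Re z)"
      using u u0 by (simp add: norm_powr_real_powr)
    also have "\<dots> \<le> real n powr (-2 - Re z)"
      using u n z by (intro powr_mono2') auto
    finally have "norm ((-1 - z) * v powr (-1 - z - 1)) \<le> norm (-1 - z) * real n powr (-2 - Re z)"
      unfolding norm_mult by (intro mult_left_mono) auto
    also have "norm (-1 - z) = norm (1 + z)"
      using norm_minus_cancel[of "1 + z"] by (simp only: minus_add_distrib diff_conv_add_uminus)
    finally show "norm ((-1 - z) * v powr (-1 - z - 1)) \<le> norm (1 + z) * real n powr (-2 - Re z)" .
  qed (use w in auto)
  also have "\<dots> \<le> (norm (1 + z) * real n powr (-2 - Re z)) * 1"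
  proof (rule mult_left_mono)
    obtain u where u: "w = of_real u" "real n \<le> u" "u \<le> real (Suc n)"
      using real_segment_of_nat[OF w] .
    have "w - of_nat n = of_real (u - real n)" using u by simp
    hence "norm (w - of_nat n) = \<bar>u - real n\<bar>" by (simp only: norm_of_real)
    thus "norm (w - of_nat n) \<le> 1" using u by simp
  qed auto
  finally show ?thesis by simp
qed

lemma le_powr_interpolate:
  fixes x a b t :: real
  assumes "0 \<le> x" "x \<le> a" "x \<le> b" "0 < t" "t < 1"
  shows "x \<le> a powr (1 - t) * b powr t"
proof (cases "x = 0")
  case False
  hence "x = x powr (1 - t) * x powr t" using assms by (simp flip: powr_add)
  also have "\<dots> \<le> a powr (1 - t) * b powr t"
    using assms by (intro mult_mono powr_mono2) auto
  finally show ?thesis .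
qed simp

text \<open>With \<open>c = z n^(-1-z)\<close>, the function \<open>w * c + w powr (-z)\<close> has
  increment \<open>zeta_term n z\<close> over \<open>[n, n+1]\<close> and derivative
  \<open>z (n^(-1-z) - w^(-1-z))\<close>. Estimating the two powers separately gives the first
  bound; the mean value theorem applied to their difference gives the second, which gains
  \<open>1/n\<close> at the price of a factor \<open>norm (1 + z)\<close>.\<close>

lemma zeta_term_bounds:
  assumes n: "n > 0" and z: "Re z \<ge> -1"
  shows "norm (zeta_term n z) \<le> 2 * norm z * real n powr (-1 - Re z)"
    and "norm (zeta_term n z) \<le> norm z * norm (1 + z) * real n powr (-2 - Re z)"
proof -
  define c where "c = z * of_nat n powr (-1 - z)"
  have *: "norm (zeta_term n z) \<le> B"
    if B: "\<And>v. v \<in> closed_segment (of_nat n) (of_nat (Suc n)) \<Longrightarrow>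
               norm (z * (of_nat n powr (-1 - z) - v powr (-1 - z))) \<le> B" for B
  proof -
    have "norm ((of_nat (Suc n) * c + of_nat (Suc n) powr (-z)) - (of_nat n * c + of_nat n powr (-z)))
            \<le> B * norm (of_nat (Suc n) - of_nat n :: complex)"
    proof (rule field_differentiable_bound[where S = "closed_segment (of_nat n) (of_nat (Suc n))"])
      fix v :: complex assume v: "v \<in> closed_segment (of_nat n) (of_nat (Suc n))"
      obtain u where u: "v = of_real u" "real n \<le> u" "u \<le> real (Suc n)"
        using real_segment_of_nat[OF v] .
      have u0: "u > 0" using u n by (simp add: less_le_trans[of 0 "real n"])
      have "v \<notin> \<real>\<^sub>\<le>\<^sub>0" using u u0 by (auto simp: complex_nonpos_Reals_iff)
      hence "((\<lambda>w. w * c + w powr (-z)) has_field_derivative (c + (-z) * v powr (-z - 1))) (at v)"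
        by (auto intro!: derivative_eq_intros)
      moreover have "c + (-z) * v powr (-z - 1) = z * (of_nat n powr (-1 - z) - v powr (-1 - z))"
      proof -
        have e: "-z - 1 = -1 - z" by simp
        show ?thesis unfolding e c_def by (simp add: ring_distribs)
      qed
      ultimately show "((\<lambda>w. w * c + w powr (-z)) has_field_derivative 
            z * (of_nat n powr (-1 - z) - v powr (-1 - z)))
            (at v within closed_segment (of_nat n) (of_nat (Suc n)))"
        by (metis has_field_derivative_at_within)
      show "norm (z * (of_nat n powr (-1 - z) - v powr (-1 - z))) \<le> B"
        by (rule B[OF v])
    qed auto
    also have "(of_nat (Suc n) * c + of_nat (Suc n) powr (-z)) - (of_nat n * c + of_nat n powr (-z))
                 = zeta_term n z"
      by (simp add: zeta_term_def c_def algebra_simps)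
    finally show ?thesis by simp
  qed
  show "norm (zeta_term n z) \<le> 2 * norm z * real n powr (-1 - Re z)"
  proof (rule *)
    fix v :: complex assume v: "v \<in> closed_segment (of_nat n) (of_nat (Suc n))"
    obtain u where u: "v = of_real u" "real n \<le> u" "u \<le> real (Suc n)"
      using real_segment_of_nat[OF v] .
    have u0: "u > 0" using u n by (simp add: less_le_trans[of 0 "real n"])
    have "norm (v powr (-1 - z)) = u powr (-1 - Re z)"
      using u u0 by (simp add: norm_powr_real_powr)
    also have "\<dots> \<le> real n powr (-1 - Re z)"
      using u n z by (intro powr_mono2') auto
    finally have 1: "norm (v powr (-1 - z)) \<le> real n powr (-1 - Re z)" .
    have 2: "norm (of_nat n powr (-1 - z) :: complex) = real n powr (-1 - Re z)"
      by (simp add: norm_powr_real_powr)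
    have "norm (of_nat n powr (-1 - z) - v powr (-1 - z)) \<le> 2 * real n powr (-1 - Re z)"
      using norm_triangle_ineq4[of "of_nat n powr (-1 - z)" "v powr (-1 - z)"] 1 2 by simp
    hence "norm z * norm (of_nat n powr (-1 - z) - v powr (-1 - z)) \<le> norm z * (2 * real n powr (-1 - Re z))"
      by (intro mult_left_mono) auto
    thus "norm (z * (of_nat n powr (-1 - z) - v powr (-1 - z))) \<le> 2 * norm z * real n powr (-1 - Re z)"
      by (simp add: norm_mult)
  qed
  show "norm (zeta_term n z) \<le> norm z * norm (1 + z) * real n powr (-2 - Re z)"
  proof (rule *)
    fix v :: complex assume v: "v \<in> closed_segment (of_nat n) (of_nat (Suc n))"
    have "norm (of_nat n powr (-1 - z) - v powr (-1 - z)) \<le> norm (1 + z) * real n powr (-2 - Re z)"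
      using powr_diff_bound[OF n v] z by (simp add: norm_minus_commute)
    hence "norm z * norm (of_nat n powr (-1 - z) - v powr (-1 - z)) \<le> norm z * (norm (1 + z) * real n powr (-2 - Re z))"
      by (intro mult_left_mono) auto
    thus "norm (z * (of_nat n powr (-1 - z) - v powr (-1 - z))) \<le> norm z * norm (1 + z) * real n powr (-2 - Re z)"
      by (simp add: norm_mult mult.assoc)
  qed
qed

text \<open>Interpolating between the two bounds makes the exponent of \<open>norm (1 + z)\<close> as small as desired
  while the sum over \<open>n\<close> still converges slightly to the left of the line \<open>Re z = 0\<close>.\<close>

lemma zeta_term_bound:
  assumes n: "n > 0" and z: "Re z \<ge> -1" and t: "0 < t" "t < 1"
  shows "norm (zeta_term n z) \<le> 2 * norm z * norm (1 + z) powr t * real n powr (-1 - t - Re z)"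
proof -
  have "norm (zeta_term n z) \<le> (2 * norm z * real n powr (-1 - Re z)) powr (1 - t) *
          (norm z * norm (1 + z) * real n powr (-2 - Re z)) powr t"
    using zeta_term_bounds[OF n z] t by (intro le_powr_interpolate) auto
  also have "\<dots> = 2 powr (1 - t) * (norm z powr (1 - t) * norm z powr t) * norm (1 + z) powr t *
      (real n powr ((-1 - Re z) * (1 - t)) * real n powr ((-2 - Re z) * t))"
    by (simp add: powr_mult powr_powr mult_ac)
  also have "norm z powr (1 - t) * norm z powr t = norm z"
    by (cases "z = 0") (simp_all flip: powr_add)
  also have "real n powr ((-1 - Re z) * (1 - t)) * real n powr ((-2 - Re z) * t) = real n powr (-1 - t - Re z)"
    by (simp flip: powr_add add: algebra_simps)
  also have "2 powr (1 - t) * norm z * norm (1 + z) powr t * real n powr (-1 - t - Re z)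
     \<le> 2 powr 1 * norm z * norm (1 + z) powr t * real n powr (-1 - t - Re z)"
    using t by (intro mult_right_mono powr_mono) auto
  finally show ?thesis by simp
qed

lemma summable_Suc_powr: "e < -1 \<Longrightarrow> summable (\<lambda>n. real (Suc n) powr e)"
  using summable_real_powr_iff[of e] summable_Suc_iff[of "\<lambda>n. real n powr e"] by simp

lemma summable_zeta_term_norm:
  assumes "Re z > -1/2"
  shows "summable (\<lambda>n. norm (zeta_term (Suc n) z))"
proof (rule summable_comparison_test'[where N = 0])
  show "summable (\<lambda>n. norm z * norm (1 + z) * real (Suc n) powr (-2 - Re z))"
    using assms by (intro summable_mult summable_Suc_powr) auto
  show "norm (norm (zeta_term (Suc n) z)) \<le> norm z * norm (1 + z) * real (Suc n) powr (-2 - Re z)" for n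
    using zeta_term_bounds(2)[of "Suc n" z] assms by simp
qed

text \<open>Interpolation with \<open>t = 2 * d\<close>: one half of this exponent pays for
  \<open>Re z\<close> going down to \<open>-d\<close>, the other half leaves the convergent series
  with exponent \<open>-1 - d\<close>.\<close>

lemma zeta_entire_bound:
  assumes d: "0 < d" "d < 1/2"
  obtains K where "K > 0" "\<And>z. Re z \<ge> -d \<Longrightarrow> norm (zeta_entire z) \<le> K * (1 + norm z) powr (1 + 2 * d)"
proof -
  define k where "k = (\<Sum>n. real (Suc n) powr (-1 - d))"
  have sk: "summable (\<lambda>n. real (Suc n) powr (-1 - d))" using d by (intro summable_Suc_powr) auto
  have k0: "k \<ge> 0" unfolding k_def by (intro suminf_nonneg sk) auto
  show ?thesis
  proof (rule that[of "1 + 2 * k"])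
    show "1 + 2 * k > 0" using k0 by simp
    fix z :: complex assume z: "Re z \<ge> -d"
    define M where "M = 2 * norm z * norm (1 + z) powr (2*d)"
    have b: "norm (zeta_term (Suc n) z) \<le> M * real (Suc n) powr (-1 - d)" for n
    proof -
      have "norm (zeta_term (Suc n) z) \<le> M * real (Suc n) powr (-1 - 2*d - Re z)"
        unfolding M_def using zeta_term_bound[of "Suc n" z "2*d"] d z by simp
      also have "\<dots> \<le> M * real (Suc n) powr (-1 - d)"
        unfolding M_def using z by (intro mult_left_mono powr_mono) auto
      finally show ?thesis .
    qed
    have "norm (\<Sum>n. zeta_term (Suc n) z) \<le> (\<Sum>n. norm (zeta_term (Suc n) z))"
      using z d by (intro summable_norm summable_zeta_term_norm) auto
    also have "\<dots> \<le> (\<Sum>n. M * real (Suc n) powr (-1 - d))"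
      using z d by (intro suminf_le b summable_zeta_term_norm summable_mult sk) auto
    also have "\<dots> = M * k" unfolding k_def by (rule suminf_mult[OF sk])
    finally have 1: "norm (zeta_entire z) \<le> 1 + M * k"
      unfolding zeta_entire_def using norm_triangle_ineq[of 1 "\<Sum>n. zeta_term (Suc n) z"] by simp
    have "M \<le> 2 * (1 + norm z) * (1 + norm z) powr (2*d)"
      unfolding M_def using d norm_triangle_ineq[of 1 z]
      by (intro mult_mono powr_mono2) auto
    also have "\<dots> = 2 * (1 + norm z) powr (1 + 2*d)"
      by (simp add: powr_add)
    finally have 2: "M * k \<le> 2 * (1 + norm z) powr (1 + 2*d) * k"
      using k0 by (rule mult_right_mono)
    have "1 \<le> (1 + norm z) powr (1 + 2*d)" using d by (intro ge_one_powr_ge_zero) auto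
    with 1 2 show "norm (zeta_entire z) \<le> (1 + 2 * k) * (1 + norm z) powr (1 + 2 * d)"
      by (simp add: algebra_simps)
  qed
qed

lemma zeta_entire_holomorphic: "zeta_entire holomorphic_on {z. Re z > -1/2}"
proof -
  have op: "open {z. Re z > -1/2}" by (rule open_halfspace_Re_gt)
  have "(\<lambda>z. \<Sum>n. zeta_term (Suc n) z) holomorphic_on {z. Re z > -1/2}"
  proof (rule holomorphic_uniform_sequence[OF op])
    fix N
    show "(\<lambda>z. \<Sum>n<N. zeta_term (Suc n) z) holomorphic_on {z. Re z > -1/2}"
      unfolding zeta_term_def by (auto intro!: holomorphic_intros simp del: of_nat_Suc)
  next
    fix x assume "x \<in> {z. Re z > -1/2}"
    then obtain d where d: "d > 0" "cball x d \<subseteq> {z. Re z > -1/2}"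
      using op open_contains_cball by blast
    have "uniform_limit (cball x d) (\<lambda>N z. \<Sum>n<N. zeta_term (Suc n) z)
        (\<lambda>z. \<Sum>n. zeta_term (Suc n) z) sequentially"
    proof (rule Weierstrass_m_test)
      \<comment> \<open>For \<open>Re z > -1/2\<close> the exponent \<open>-2 - Re z\<close> of the
        second bound stays below \<open>-3/2\<close>, so one majorant serves the whole disc.\<close>
      show "summable (\<lambda>n. (norm x + d) * (1 + norm x + d) * real (Suc n) powr (-3/2))"
        by (intro summable_mult summable_Suc_powr) auto
      fix n z assume z: "z \<in> cball x d"
      hence Re: "Re z > -1/2" using d by auto
      have nz: "norm z \<le> norm x + d" 
        using z norm_triangle_ineq2[of z x] by (simp add: dist_norm norm_minus_commute)
      have nz1: "norm (1 + z) \<le> 1 + norm x + d" using nz norm_triangle_ineq[of 1 z] by simp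
      have "norm (zeta_term (Suc n) z) \<le> norm z * norm (1 + z) * real (Suc n) powr (-2 - Re z)"
        using Re by (intro zeta_term_bounds) auto
      also have "\<dots> \<le> (norm x + d) * (1 + norm x + d) * real (Suc n) powr (-3/2)"
        using nz nz1 d by (intro mult_mono powr_mono) (use Re in \<open>auto simp: field_simps\<close>)
      finally show "norm (zeta_term (Suc n) z) \<le> (norm x + d) * (1 + norm x + d) * real (Suc n) powr (-3/2)" .
    qed
    thus "\<exists>d>0. cball x d \<subseteq> {z. Re z > -1/2} \<and> uniform_limit (cball x d) (\<lambda>N z. \<Sum>n<N. zeta_term (Suc n) z)
        (\<lambda>z. \<Sum>n. zeta_term (Suc n) z) sequentially" using d by blast
  qed
  thus ?thesis unfolding zeta_entire_def[abs_def] by (intro holomorphic_intros)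
qed

lemma zeta_term_0 [simp]: "n > 0 \<Longrightarrow> zeta_term n 0 = 0"
  by (simp add: zeta_term_def del: of_nat_Suc)

lemma zeta_entire_0 [simp]: "zeta_entire 0 = 1"
  by (simp add: zeta_entire_def)

lemma summable_norm_dirichlet:
  assumes "Re z > 0"
  shows "summable (\<lambda>n. norm (of_nat (Suc n) powr (-1 - z) :: complex))"
proof -
  have "norm (of_nat (Suc n) powr (-1 - z) :: complex) = real (Suc n) powr (-1 - Re z)" for n
    by (subst norm_powr_real_powr) (auto simp del: of_nat_Suc)
  thus ?thesis using summable_Suc_powr[of "-1 - Re z"] assms by simp
qed

text \<open>The differences \<open>(n+1)^(-z) - n^(-z)\<close> telescope to
  \<open>N^(-z) - 1\<close>. For \<open>Re z > 0\<close> the power tends to \<open>0\<close>, and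
  the remaining \<open>-1\<close> cancels the leading \<open>1\<close> of
  \<open>zeta_entire\<close>.\<close>

lemma zeta_entire_eq:
  assumes "Re z > 0"
  shows "zeta_entire z = z * (\<Sum>n. of_nat (Suc n) powr (-1 - z))"
proof -
  have s: "(\<lambda>n. of_nat (Suc n) powr (-1 - z)) sums (\<Sum>n. of_nat (Suc n) powr (-1 - z))"
    by (rule summable_sums[OF summable_norm_cancel[OF summable_norm_dirichlet[OF assms]]])
  have "(\<Sum>n<N. zeta_term (Suc n) z) = z * (\<Sum>n<N. of_nat (Suc n) powr (-1 - z)) - 1
          + of_nat (Suc N) powr (- z)" for N
  proof (induction N)
    case (Suc N)
    show ?case unfolding sum.lessThan_Suc Suc.IH 
      by (simp add: zeta_term_def ring_distribs del: of_nat_Suc)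
  qed simp
  moreover have "(\<lambda>N. z * (\<Sum>n<N. of_nat (Suc n) powr (-1 - z)) - 1 + of_nat (Suc N) powr (- z))
      \<longlonglongrightarrow> z * (\<Sum>n. of_nat (Suc n) powr (-1 - z)) - 1 + 0"
  proof (intro tendsto_intros)
    show "(\<lambda>N. \<Sum>n<N. of_nat (Suc n) powr (-1 - z)) \<longlonglongrightarrow> (\<Sum>n. of_nat (Suc n) powr (-1 - z))"
      using s by (simp add: sums_def)
    have "norm (of_nat (Suc N) powr (- z) :: complex) = real (Suc N) powr (- Re z)" for N
      by (subst norm_powr_real_powr) (auto simp del: of_nat_Suc)
    moreover have "(\<lambda>N. real (Suc N) powr (- Re z)) \<longlonglongrightarrow> 0"
      using assms by (intro tendsto_neg_powr filterlim_compose[OF filterlim_real_sequentially filterlim_Suc]) auto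
    ultimately show "(\<lambda>N. of_nat (Suc N) powr (- z) :: complex) \<longlonglongrightarrow> 0"
      by (intro tendsto_norm_zero_cancel[of "\<lambda>N. of_nat (Suc N) powr (- z)"]) (simp only:)
  qed
  ultimately have "(\<lambda>n. zeta_term (Suc n) z) sums (z * (\<Sum>n. of_nat (Suc n) powr (-1 - z)) - 1)"
    by (simp add: sums_def)
  thus ?thesis by (simp add: zeta_entire_def sums_iff)
qed

section \<open>Sums over primes and the Euler product\<close>

definition prime_sum :: "complex \<Rightarrow> complex" where
  "prime_sum z = (\<Sum>\<^sub>\<infinity>p\<in>{p::nat. prime p}. of_nat p powr (-1 - z))"

text \<open>This is \<open>Q\<close> of the overview. As \<open>w + Ln (1 - w)\<close> is quadratic
  in \<open>w\<close>, it remains holomorphic to the left of \<open>Re z = 0\<close>, where the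
  series of \<open>prime_sum\<close> no longer converges absolutely. Its value at \<open>0\<close>
  is Mertens' constant without Euler's constant.\<close>

definition prime_corr :: "complex \<Rightarrow> complex" where
  "prime_corr z = (\<Sum>\<^sub>\<infinity>p\<in>{p::nat. prime p}. of_nat p powr (-1 - z) + Ln (1 - of_nat p powr (-1 - z)))"

lemma norm_nat_powr: "norm (of_nat n powr z :: complex) = real n powr Re z"
  by (simp add: norm_powr_real_powr)

lemma powr_summable_on:
  assumes "e < -1"
  shows "(\<lambda>n::nat. real n powr e) summable_on A"
proof -
  have "summable (\<lambda>n. real n powr e)" using assms summable_real_powr_iff by blast
  hence "(\<lambda>n::nat. real n powr e) summable_on UNIV"
    by (intro norm_summable_imp_summable_on) simp
  thus ?thesis by (rule summable_on_subset_banach) simp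
qed

lemma dirichlet_abs_summable_on:
  assumes "Re z > 0"
  shows "(\<lambda>n. norm (of_nat n powr (-1 - z) :: complex)) summable_on A"
  using powr_summable_on[of "-1 - Re z" A] assms by (simp add: norm_nat_powr)

lemma dirichlet_summable_on:
  assumes "Re z > 0"
  shows "(\<lambda>n. of_nat n powr (-1 - z) :: complex) summable_on A"
  using dirichlet_abs_summable_on[OF assms] by (rule abs_summable_summable)

text \<open>A bound below \<open>1\<close> that is uniform in \<open>p\<close> and \<open>z\<close>
  keeps \<open>1 - p^(-1-z)\<close> off the branch cut of \<open>Ln\<close> and bounds
  \<open>1 / (1 - norm w)\<close> by \<open>4\<close> in the quadratic remainder. The constant
  \<open>3/4\<close> leaves room: the largest value is \<open>2 powr (-3/4)\<close>, about
  \<open>0.59\<close>.\<close>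

lemma prime_powr_le:
  assumes "prime p" "Re z \<ge> -1/4"
  shows "norm (of_nat p powr (-1 - z) :: complex) \<le> real p powr (-3/4)"
    and "norm (of_nat p powr (-1 - z) :: complex) \<le> 3/4"
proof -
  have p: "real p \<ge> 2" using assms prime_ge_2_nat[of p] by simp
  show 1: "norm (of_nat p powr (-1 - z) :: complex) \<le> real p powr (-3/4)"
  proof -
    have "Re (-1 - z) \<le> -3/4" using assms(2) unfolding minus_complex.sel by (simp add: field_simps)
    thus ?thesis unfolding norm_nat_powr using p by (intro powr_mono) auto
  qed
  have "real p powr (-3/4) \<le> real p powr (-1/2)" using p by (intro powr_mono) auto
  also have "\<dots> \<le> 2 powr (-1/2)" using p by (intro powr_mono2') auto
  also have "\<dots> = 1 / sqrt 2" by (simp add: powr_minus powr_half_sqrt inverse_eq_divide)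
  also have "\<dots> \<le> 3/4"
  proof -
    have "4/3 \<le> sqrt 2" by (rule real_le_rsqrt) (simp add: power2_eq_square)
    thus ?thesis by (simp add: field_simps)
  qed
  finally show "norm (of_nat p powr (-1 - z) :: complex) \<le> 3/4" using 1 by simp
qed

lemma prime_corr_term_bound:
  assumes "prime p" "Re z \<ge> -1/4"
  shows "norm (of_nat p powr (-1 - z) + Ln (1 - of_nat p powr (-1 - z)) :: complex) \<le> 4 * real p powr (-3/2)"
proof -
  define w :: complex where "w = of_nat p powr (-1 - z)"
  have w: "norm w \<le> real p powr (-3/4)" "norm w \<le> 3/4" unfolding w_def by (rule prime_powr_le[OF assms])+
  have "norm (w + Ln (1 - w)) \<le> norm w ^ 2 / (1 - norm w)"
    using Ln_approx_linear[of "-w"] w by (simp add: add.commute)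
  also have "\<dots> \<le> (real p powr (-3/4)) ^ 2 / (1/4)"
    using w by (intro frac_le power_mono) auto
  also have "(real p powr (-3/4)) ^ 2 = real p powr (-3/2)"
    by (simp add: power2_eq_square flip: powr_add)
  finally show ?thesis by (simp add: w_def)
qed

lemma prime_corr_summable:
  assumes "Re z \<ge> -1/4"
  shows "(\<lambda>p. of_nat p powr (-1 - z) + Ln (1 - of_nat p powr (-1 - z)) :: complex) summable_on {p. prime p}"
proof (rule abs_summable_summable, rule Infinite_Sum.abs_summable_on_comparison_test')
  show "(\<lambda>p. 4 * real p powr (-3/2)) summable_on {p::nat. prime p}"
    by (intro summable_on_cmult_right powr_summable_on) auto
qed (use assms prime_corr_term_bound in auto)

lemma prime_corr_bounded:
  obtains C where "\<And>z. Re z \<ge> -1/4 \<Longrightarrow> norm (prime_corr z) \<le> C"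
proof (rule that)
  fix z :: complex assume z: "Re z \<ge> -1/4"
  show "norm (prime_corr z) \<le> (\<Sum>\<^sub>\<infinity>p\<in>{p::nat. prime p}. 4 * real p powr (-3/2))"
    unfolding prime_corr_def
    by (rule norm_infsum_le[OF has_sum_infsum has_sum_infsum])
       (use z prime_corr_term_bound prime_corr_summable in \<open>auto intro!: summable_on_cmult_right powr_summable_on\<close>)
qed

text \<open>The Weierstrass argument is run along the filter of finite subsets, so sums over primes
  can be handled without enumerating the primes.\<close>

lemma holomorphic_on_infsum:
  fixes f :: "'a \<Rightarrow> complex \<Rightarrow> complex"
  assumes U: "open U" and hol: "\<And>p. p \<in> A \<Longrightarrow> f p holomorphic_on U"
    and bound: "\<And>x. x \<in> U \<Longrightarrow> \<exists>d>0. \<exists>M. cball x d \<subseteq> U \<and> M summable_on A \<and>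
                   (\<forall>p\<in>A. \<forall>z\<in>cball x d. norm (f p z) \<le> M p)"
  shows "(\<lambda>z. \<Sum>\<^sub>\<infinity>p\<in>A. f p z) holomorphic_on U"
proof (rule analytic_imp_holomorphic, unfold analytic_on_def, rule)
  fix x assume "x \<in> U"
  then obtain d M where d: "d > 0" "cball x d \<subseteq> U" "M summable_on A"
    "\<And>p z. p \<in> A \<Longrightarrow> z \<in> cball x d \<Longrightarrow> norm (f p z) \<le> M p"
    using bound by meson
  have ul: "uniform_limit (cball x d) (\<lambda>X z. \<Sum>p\<in>X. f p z) (\<lambda>z. \<Sum>\<^sub>\<infinity>p\<in>A. f p z) (finite_subsets_at_top A)"
    by (rule Weierstrass_m_test_general[OF d(4,3)])
  have "\<forall>\<^sub>F X in finite_subsets_at_top A. continuous_on (cball x d) (\<lambda>z. \<Sum>p\<in>X. f p z)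
           \<and> (\<lambda>z. \<Sum>p\<in>X. f p z) holomorphic_on ball x d"
  proof (rule eventually_finite_subsets_at_top_weakI)
    fix X assume X: "finite X" "X \<subseteq> A"
    have "(\<lambda>z. \<Sum>p\<in>X. f p z) holomorphic_on U"
      using X by (intro holomorphic_on_sum hol) auto
    hence "(\<lambda>z. \<Sum>p\<in>X. f p z) holomorphic_on cball x d"
      using d holomorphic_on_subset by blast
    thus "continuous_on (cball x d) (\<lambda>z. \<Sum>p\<in>X. f p z) \<and> (\<lambda>z. \<Sum>p\<in>X. f p z) holomorphic_on ball x d"
      using holomorphic_on_imp_continuous_on holomorphic_on_subset ball_subset_cball by blast
  qed
  from holomorphic_uniform_limit[OF this ul] 
  have "(\<lambda>z. \<Sum>\<^sub>\<infinity>p\<in>A. f p z) holomorphic_on ball x d" by auto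
  thus "\<exists>e>0. (\<lambda>z. \<Sum>\<^sub>\<infinity>p\<in>A. f p z) holomorphic_on ball x e" using d by blast
qed

lemma prime_sum_holomorphic: "prime_sum holomorphic_on {z. Re z > 0}"
  unfolding prime_sum_def[abs_def]
proof (rule holomorphic_on_infsum)
  show op: "open {z. Re z > 0}" by (rule open_halfspace_Re_gt)
  show "(\<lambda>z. of_nat p powr (-1 - z)) holomorphic_on {z. Re z > 0}" if "p \<in> {p. prime p}" for p
    using that by (intro holomorphic_intros) auto
  fix x :: complex assume "x \<in> {z. Re z > 0}"
  hence x: "Re x > 0" by simp
  define d where "d = Re x / 2"
  have Re: "Re z \<ge> d" if "z \<in> cball x d" for z
    using that abs_Re_le_cmod[of "x - z"] by (auto simp: dist_norm d_def)
  have "cball x d \<subseteq> {z. Re z > 0}" using Re x by (force simp: d_def)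
  moreover have "\<forall>p\<in>{p. prime p}. \<forall>z\<in>cball x d. norm (of_nat p powr (-1 - z) :: complex) \<le> real p powr (-1 - d)"
  proof (intro ballI)
    fix p z assume "p \<in> {p::nat. prime p}" "z \<in> cball x d"
    thus "norm (of_nat p powr (-1 - z) :: complex) \<le> real p powr (-1 - d)"
      unfolding norm_nat_powr using Re[of z] prime_ge_1_nat[of p] by (intro powr_mono) auto
  qed
  ultimately show "\<exists>d>0. \<exists>M. cball x d \<subseteq> {z. Re z > 0} \<and> M summable_on {p::nat. prime p} \<and>
       (\<forall>p\<in>{p. prime p}. \<forall>z\<in>cball x d. norm (of_nat p powr (-1 - z) :: complex) \<le> M p)"
    using x by (intro exI[of _ d] exI[of _ "\<lambda>p. real p powr (-1 - d)"] conjI powr_summable_on) (auto simp: d_def)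
qed

lemma prime_corr_holomorphic: "prime_corr holomorphic_on {z. Re z > -1/4}"
  unfolding prime_corr_def[abs_def]
proof (rule holomorphic_on_infsum)
  show op: "open {z. Re z > -1/4}" by (rule open_halfspace_Re_gt)
  fix p assume "p \<in> {p::nat. prime p}"
  hence p: "prime p" by simp
  have "1 - of_nat p powr (-1 - z) \<notin> \<real>\<^sub>\<le>\<^sub>0" if "Re z > -1/4" for z
  proof -
    have "norm (of_nat p powr (-1 - z) :: complex) \<le> 3/4"
      using prime_powr_le(2)[OF p, of z] that by simp
    hence "Re (of_nat p powr (-1 - z)) < 1"
      using complex_Re_le_cmod[of "of_nat p powr (-1 - z)"] by linarith
    thus ?thesis by (auto simp: complex_nonpos_Reals_iff)
  qed
  thus "(\<lambda>z. of_nat p powr (-1 - z) + Ln (1 - of_nat p powr (-1 - z))) holomorphic_on {z. Re z > -1/4}"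
    using prime_gt_0_nat[OF p] by (intro holomorphic_intros) auto
next
  fix x :: complex assume "x \<in> {z. Re z > -1/4}"
  then obtain d where d: "d > 0" "cball x d \<subseteq> {z. Re z > -1/4}"
    using open_halfspace_Re_gt[of "-1/4"] open_contains_cball by blast
  show "\<exists>d>0. \<exists>M. cball x d \<subseteq> {z. Re z > -1/4} \<and> M summable_on {p::nat. prime p} \<and>
       (\<forall>p\<in>{p. prime p}. \<forall>z\<in>cball x d. norm (of_nat p powr (-1 - z) + Ln (1 - of_nat p powr (-1 - z)) :: complex) \<le> M p)"
  proof (intro exI[of _ d] exI[of _ "\<lambda>p. 4 * real p powr (-3/2)"] conjI ballI)
    show "(\<lambda>p. 4 * real p powr (-3/2)) summable_on {p::nat. prime p}"
      by (intro summable_on_cmult_right powr_summable_on) auto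
    fix p :: nat and z assume "p \<in> {p. prime p}" "z \<in> cball x d"
    thus "norm (of_nat p powr (-1 - z) + Ln (1 - of_nat p powr (-1 - z)) :: complex) \<le> 4 * real p powr (-3/2)"
      using d by (intro prime_corr_term_bound) auto
  qed (use d in auto)
qed

lemma infsum_complex_of_real:
  "complex_of_real (infsum f A) = (\<Sum>\<^sub>\<infinity>x\<in>A. complex_of_real (f x))"
proof (cases "f summable_on A")
  case True
  thus ?thesis
    by (metis has_sum_infsum has_sum_of_real infsumI)
next
  case False
  \<comment> \<open>Here the real sum has the default value \<open>0\<close>; the complex sum has
    the same default once it is known to diverge as well, since its real part would otherwise
    converge.\<close>
  moreover have "\<not> (\<lambda>x. complex_of_real (f x)) summable_on A"
    using summable_on_bounded_linear[OF bounded_linear_Re, of "\<lambda>x. complex_of_real (f x)" A] False by (auto simp: o_def)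
  ultimately show ?thesis by (simp add: infsum_not_exists)
qed

lemma prime_corr_of_real:
  assumes "x \<ge> -1/4"
  shows "prime_corr (of_real x) = of_real (\<Sum>\<^sub>\<infinity>p\<in>{p::nat. prime p}. real p powr (-1 - x) + ln (1 - real p powr (-1 - x)))"
  unfolding prime_corr_def infsum_complex_of_real
proof (rule infsum_cong)
  fix p assume "p \<in> {p::nat. prime p}"
  hence p: "prime p" by simp
  have 1: "of_nat p powr (-1 - complex_of_real x) = of_real (real p powr (-1 - x))"
    using powr_of_real[of "real p" "-1 - x"] by simp
  have "norm (of_nat p powr (-1 - complex_of_real x) :: complex) \<le> 3/4"
    using p assms by (intro prime_powr_le) auto
  hence "real p powr (-1 - x) < 1" unfolding 1 by simp
  hence "Ln (of_real (1 - real p powr (-1 - x))) = of_real (ln (1 - real p powr (-1 - x)))"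
    by (intro Ln_of_real) auto
  thus "of_nat p powr (-1 - complex_of_real x) + Ln (1 - of_nat p powr (-1 - complex_of_real x)) =
    of_real (real p powr (-1 - x) + ln (1 - real p powr (-1 - x)))" by (simp add: 1)
qed

lemma prime_sum_of_real:
  "prime_sum (of_real x) = of_real (\<Sum>\<^sub>\<infinity>p\<in>{p::nat. prime p}. real p powr (-1 - x))"
  unfolding prime_sum_def infsum_complex_of_real
proof (rule infsum_cong)
  fix p :: nat
  show "of_nat p powr (-1 - complex_of_real x) = of_real (real p powr (-1 - x))"
    using powr_of_real[of "real p" "-1 - x"] by simp
qed

text \<open>Sieving out one prime at a time: the multiples of \<open>p\<close> among the remaining \<open>n\<close> contribute
  \<open>p^(-1-z)\<close> times the current sum.\<close>

lemma euler_product_finite: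
  assumes z: "Re z > 0" and A: "finite A" "A \<subseteq> {p::nat. prime p}"
    and S: "((\<lambda>n. of_nat n powr (-1 - z)) has_sum S) {n::nat. n \<ge> 1}"
  shows "((\<lambda>n. of_nat n powr (-1 - z)) has_sum (S * (\<Prod>p\<in>A. 1 - of_nat p powr (-1 - z))))
           {n::nat. n \<ge> 1 \<and> (\<forall>p\<in>A. \<not> p dvd n)}"
  using A
proof (induction rule: finite_induct)
  case empty
  thus ?case using S by simp
next
  case (insert p A)
  define B where "B = {n::nat. n \<ge> 1 \<and> (\<forall>p\<in>A. \<not> p dvd n)}"
  define T where "T = S * (\<Prod>p\<in>A. 1 - of_nat p powr (-1 - z))"
  have p: "prime p" using insert by auto
  have 1: "((\<lambda>n. of_nat n powr (-1 - z)) has_sum T) B"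
    using insert unfolding B_def T_def by auto
  have "((\<lambda>n. of_nat p powr (-1 - z) * of_nat n powr (-1 - z)) has_sum (of_nat p powr (-1 - z) * T)) B"
    by (intro has_sum_cmult_right 1)
  also have "?this \<longleftrightarrow> (((\<lambda>n. of_nat n powr (-1 - z)) \<circ> (*) p) has_sum (of_nat p powr (-1 - z) * T)) B"
  proof (rule has_sum_cong)
    fix n show "of_nat p powr (-1 - z) * of_nat n powr (-1 - z) = ((\<lambda>n. of_nat n powr (-1 - z)) \<circ> (*) p) n"
      using powr_times_real[of "of_nat p" "of_nat n" "-1 - z"] by simp
  qed
  finally have 2: "((\<lambda>n. of_nat n powr (-1 - z)) has_sum (of_nat p powr (-1 - z) * T)) ((*) p ` B)"
    using p by (subst has_sum_reindex) (auto simp: inj_on_def)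
  have sub: "(*) p ` B \<subseteq> B"
  proof
    fix m assume "m \<in> (*) p ` B"
    then obtain n where n: "m = p * n" "n \<in> B" by blast
    have "\<not> q dvd p * n" if "q \<in> A" for q
    proof
      assume "q dvd p * n"
      moreover have "prime q" using that insert by auto
      ultimately have "q dvd p \<or> q dvd n" by (simp add: prime_dvd_mult_iff)
      moreover have "\<not> q dvd n" using that n by (auto simp: B_def)
      ultimately have "q = p" using \<open>prime q\<close> p primes_dvd_imp_eq by blast
      with that insert show False by auto
    qed
    thus "m \<in> B" using n prime_gt_0_nat[OF p] by (auto simp: B_def)
  qed
  have "B - (*) p ` B = {n. n \<ge> 1 \<and> (\<forall>q\<in>insert p A. \<not> q dvd n)}"
  proof (intro set_eqI iffI)
    fix m assume m: "m \<in> B - (*) p ` B"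
    have "\<not> p dvd m"
    proof
      assume "p dvd m"
      then obtain k where k: "m = p * k" by blast
      have "k \<in> B" using m k by (auto simp: B_def)
      thus False using m k by blast
    qed
    thus "m \<in> {n. n \<ge> 1 \<and> (\<forall>q\<in>insert p A. \<not> q dvd n)}" using m by (auto simp: B_def)
  qed (auto simp: B_def)
  moreover have "((\<lambda>n. of_nat n powr (-1 - z)) has_sum (T - of_nat p powr (-1 - z) * T)) (B - (*) p ` B)"
    by (rule has_sum_Diff[OF 1 2 sub])
  moreover have "T - of_nat p powr (-1 - z) * T = S * (\<Prod>p\<in>insert p A. 1 - of_nat p powr (-1 - z))"
    using insert by (simp add: T_def algebra_simps)
  ultimately show ?case by simp
qed

lemma zeta_sum_ge_1:
  assumes "Re z > 0"
  shows "((\<lambda>n. of_nat n powr (-1 - z)) has_sum (\<Sum>n. of_nat (Suc n) powr (-1 - z))) {n::nat. n \<ge> 1}"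
proof -
  have "((\<lambda>n. of_nat (Suc n) powr (-1 - z)) has_sum (\<Sum>n. of_nat (Suc n) powr (-1 - z))) UNIV"
    using norm_summable_imp_has_sum[OF summable_norm_dirichlet[OF assms] 
        summable_sums[OF summable_norm_cancel[OF summable_norm_dirichlet[OF assms]]]] .
  hence "((\<lambda>n. of_nat n powr (-1 - z)) has_sum (\<Sum>n. of_nat (Suc n) powr (-1 - z))) (range Suc)"
    by (subst has_sum_reindex) (auto simp: o_def)
  also have "range Suc = {n. n \<ge> 1}" by (auto simp: image_iff) presburger
  finally show ?thesis .
qed

text \<open>A finite set \<open>F\<close> carries all but \<open>e\<close> of the absolutely
  convergent series. Once all primes up to \<open>Max F\<close> are sieved out, every surviving
  \<open>n > 1\<close> has a prime factor larger than \<open>Max F\<close> and so lies outside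
  \<open>F\<close>; the sieved sum differs from its term at \<open>n = 1\<close> by less than
  \<open>e\<close>.\<close>

lemma euler_product_limit:
  assumes z: "Re z > 0"
    and S: "((\<lambda>n. of_nat n powr (-1 - z)) has_sum S) {n::nat. n \<ge> 1}"
  shows "((\<lambda>A. S * (\<Prod>p\<in>A. 1 - of_nat p powr (-1 - z))) \<longlongrightarrow> 1) (finite_subsets_at_top {p::nat. prime p})"
proof (rule tendstoI)
  fix e :: real assume e: "e > 0"
  define f :: "nat \<Rightarrow> complex" where "f = (\<lambda>n. of_nat n powr (-1 - z))"
  have f1: "f 1 = 1" by (simp add: f_def)
  have ab: "(\<lambda>n. norm (f n)) summable_on B" for B unfolding f_def by (rule dirichlet_abs_summable_on[OF z])
  define N where "N = (\<Sum>\<^sub>\<infinity>n\<in>{n. n \<ge> 1}. norm (f n))"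
  have "((\<lambda>n. norm (f n)) has_sum N) {n. n \<ge> 1}" unfolding N_def by (rule has_sum_infsum[OF ab])
  hence "\<forall>\<^sub>F X in finite_subsets_at_top {n. n \<ge> 1}. dist (\<Sum>n\<in>X. norm (f n)) N < e"
    using e by (auto simp: has_sum_def tendsto_iff)
  then obtain F where F: "finite F" "F \<subseteq> {n. n \<ge> 1}" "dist (\<Sum>n\<in>F. norm (f n)) N < e"
    by (auto simp: eventually_finite_subsets_at_top)
  have "((\<lambda>n. norm (f n)) has_sum (N - (\<Sum>n\<in>F. norm (f n)))) ({n. n \<ge> 1} - F)"
    using F unfolding N_def by (intro has_sum_Diff has_sum_infsum ab has_sum_finite) auto
  hence tail: "(\<Sum>\<^sub>\<infinity>n\<in>{n. n \<ge> 1} - F. norm (f n)) < e"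
    using F(3) by (auto simp: infsumI dist_real_def)
  show "\<forall>\<^sub>F A in finite_subsets_at_top {p::nat. prime p}. dist (S * (\<Prod>p\<in>A. 1 - of_nat p powr (-1 - z))) 1 < e"
    unfolding eventually_finite_subsets_at_top
  proof (intro exI conjI allI impI)
    show "finite {p. prime p \<and> p \<le> Max F}" by simp
    show "{p. prime p \<and> p \<le> Max F} \<subseteq> {p. prime p}" by auto
    fix A assume A: "finite A \<and> {p. prime p \<and> p \<le> Max F} \<subseteq> A \<and> A \<subseteq> {p. prime p}"
    define B where "B = {n::nat. n \<ge> 1 \<and> (\<forall>p\<in>A. \<not> p dvd n)}"
    have 1: "(f has_sum (S * (\<Prod>p\<in>A. 1 - of_nat p powr (-1 - z)))) B"
      unfolding f_def B_def using A by (intro euler_product_finite z S) auto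
    have "1 \<in> B" using A by (auto simp: B_def)
    hence 2: "(f has_sum (S * (\<Prod>p\<in>A. 1 - of_nat p powr (-1 - z)) - 1)) (B - {1})"
      using has_sum_finite[of "{1}" f] f1 by (intro has_sum_Diff[OF 1]) auto
    have sub: "B - {1} \<subseteq> {n. n \<ge> 1} - F"
    proof
      fix n assume n: "n \<in> B - {1}"
      hence "n \<noteq> 1" by simp
      then obtain p where p: "prime p" "p dvd n" using prime_factor_nat by blast
      have "n \<notin> F"
      proof
        assume "n \<in> F"
        hence "n \<le> Max F" using F by simp
        moreover have "p \<le> n" using p n by (intro dvd_imp_le) (auto simp: B_def)
        ultimately have "p \<in> A" using A p by auto
        thus False using n p by (auto simp: B_def)
      qed
      thus "n \<in> {n. n \<ge> 1} - F" using n by (auto simp: B_def)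
    qed
    have "norm (S * (\<Prod>p\<in>A. 1 - of_nat p powr (-1 - z)) - 1) \<le> (\<Sum>\<^sub>\<infinity>n\<in>B - {1}. norm (f n))"
      by (rule norm_infsum_le[OF 2 has_sum_infsum[OF ab]]) auto
    also have "\<dots> \<le> (\<Sum>\<^sub>\<infinity>n\<in>{n. n \<ge> 1} - F. norm (f n))"
      by (rule infsum_mono2[OF ab ab sub]) auto
    finally show "dist (S * (\<Prod>p\<in>A. 1 - of_nat p powr (-1 - z))) 1 < e"
      using tail by (simp add: dist_norm)
  qed
qed

text \<open>No branch of the logarithm of an infinite product has to be controlled: exponentiating
  the finite sums of \<open>Ln (1 - p^(-1-z))\<close> gives finite products, whose limit is
  \<open>exp (prime_corr z - prime_sum z)\<close> by continuity and the reciprocal of the zeta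
  series by sieving.\<close>

lemma zeta_entire_eq_exp:
  assumes z: "Re z > 0"
  shows "zeta_entire z = z * exp (prime_sum z - prime_corr z)"
proof -
  define S where "S = (\<Sum>n. of_nat (Suc n) powr (-1 - z))"
  define g where "g = (\<lambda>p::nat. Ln (1 - of_nat p powr (-1 - z)))"
  have "((\<lambda>p. (of_nat p powr (-1 - z) + g p) + (- (of_nat p powr (-1 - z)))) has_sum
           (prime_corr z + - prime_sum z)) {p. prime p}"
    unfolding prime_corr_def prime_sum_def g_def using z
    by (intro has_sum_add has_sum_uminusI has_sum_infsum prime_corr_summable dirichlet_summable_on) auto
  hence "(g has_sum (prime_corr z - prime_sum z)) {p. prime p}" by simp
  hence "((\<lambda>A. exp (sum g A)) \<longlongrightarrow> exp (prime_corr z - prime_sum z)) (finite_subsets_at_top {p. prime p})"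
    unfolding has_sum_def by (rule tendsto_exp)
  moreover have "\<forall>\<^sub>F A in finite_subsets_at_top {p. prime p}. exp (sum g A) = (\<Prod>p\<in>A. 1 - of_nat p powr (-1 - z))"
  proof (rule eventually_finite_subsets_at_top_weakI)
    fix A :: "nat set" assume A: "finite A" "A \<subseteq> {p. prime p}"
    have "exp (sum g A) = (\<Prod>p\<in>A. exp (g p))" using A by (simp add: exp_sum)
    also have "\<dots> = (\<Prod>p\<in>A. 1 - of_nat p powr (-1 - z))"
    proof (rule prod.cong)
      fix p assume "p \<in> A"
      hence "norm (of_nat p powr (-1 - z) :: complex) \<le> 3/4" using A z by (intro prime_powr_le) auto
      hence "1 - of_nat p powr (-1 - z) \<noteq> (0::complex)" by auto
      thus "exp (g p) = 1 - of_nat p powr (-1 - z)" by (simp add: g_def)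
    qed simp
    finally show "exp (sum g A) = (\<Prod>p\<in>A. 1 - of_nat p powr (-1 - z))" .
  qed
  ultimately have "((\<lambda>A. \<Prod>p\<in>A. 1 - of_nat p powr (-1 - z)) \<longlongrightarrow> exp (prime_corr z - prime_sum z)) (finite_subsets_at_top {p. prime p})"
    by (rule Lim_transform_eventually)
  hence "((\<lambda>A. S * (\<Prod>p\<in>A. 1 - of_nat p powr (-1 - z))) \<longlongrightarrow> S * exp (prime_corr z - prime_sum z)) (finite_subsets_at_top {p. prime p})"
    by (rule tendsto_mult_left)
  moreover have "((\<lambda>A. S * (\<Prod>p\<in>A. 1 - of_nat p powr (-1 - z))) \<longlongrightarrow> 1) (finite_subsets_at_top {p::nat. prime p})"
    unfolding S_def by (rule euler_product_limit[OF z zeta_sum_ge_1[OF z]])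
  ultimately have "S * exp (prime_corr z - prime_sum z) = 1"
    using tendsto_unique[OF finite_subsets_at_top_neq_bot] by blast
  hence "S = exp (prime_sum z - prime_corr z)"
    by (simp add: exp_diff field_simps)
  thus ?thesis using zeta_entire_eq[OF z] by (simp add: S_def)
qed

section \<open>The cosine inequality for sums over primes\<close>

lemma three_four_one_prime_sum:
  assumes x: "x > 0"
  shows "3 * Re (prime_sum (of_real x)) + 4 * Re (prime_sum (Complex x t)) + Re (prime_sum (Complex x (2 * t))) \<ge> 0"
proof -
  have Re_hs: "((\<lambda>p. Re (of_nat p powr (-1 - z))) has_sum Re (prime_sum z)) {p::nat. prime p}" if "Re z > 0" for z
    unfolding prime_sum_def
    by (rule has_sum_bounded_linear[OF bounded_linear_Re, unfolded o_def]) 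
       (rule has_sum_infsum[OF dirichlet_summable_on[OF that]])
  have re: "Re (of_nat p powr (-1 - Complex x s)) = real p powr (-1 - x) * cos (s * ln (real p))" if "prime p" for p s
  proof -
    have "of_nat p powr (-1 - Complex x s) = exp ((-1 - Complex x s) * of_real (ln (real p)))"
      using prime_gt_0_nat[OF that] by (simp add: powr_def Ln_of_nat)
    thus ?thesis using prime_gt_0_nat[OF that] 
      by (simp add: Re_exp powr_def)
  qed
  define g where "g = (\<lambda>p. 3 * Re (of_nat p powr (-1 - Complex x 0)) + 4 * Re (of_nat p powr (-1 - Complex x t))
          + Re (of_nat p powr (-1 - Complex x (2*t))))"
  have "(g has_sum
      (3 * Re (prime_sum (Complex x 0)) + 4 * Re (prime_sum (Complex x t)) + Re (prime_sum (Complex x (2 * t))))) {p::nat. prime p}"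
    unfolding g_def using x by (intro has_sum_add has_sum_cmult_right Re_hs) auto
  moreover have "0 \<le> g p" if "p \<in> {p. prime p}" for p
  proof -
    define c where "c = cos (t * ln (real p))"
    have "cos (2 * t * ln (real p)) = 2 * c\<^sup>2 - 1"
      using cos_double_cos[of "t * ln (real p)"] by (simp add: c_def mult.assoc)
    hence "g p = real p powr (-1 - x) * (2 * (1 + c)\<^sup>2)"
      using that unfolding g_def by (simp only: re mem_Collect_eq c_def[symmetric]) (simp add: algebra_simps power2_eq_square)
    thus ?thesis by simp
  qed
  ultimately have "0 \<le> 3 * Re (prime_sum (Complex x 0)) + 4 * Re (prime_sum (Complex x t)) + Re (prime_sum (Complex x (2 * t)))"
    by (rule has_sum_nonneg)
  moreover have "Complex x 0 = of_real x" by (simp add: complex_eq_iff)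
  ultimately show ?thesis by simp
qed

text \<open>As \<open>zeta = exp (P - Q)\<close> with \<open>Q\<close> bounded, the inequality is only needed for the prime sum \<open>P\<close>,
  at the cost of a constant factor.\<close>

lemma three_four_one_zeta:
  obtains c where "c > 0" "\<And>x t. x > 0 \<Longrightarrow>
     norm (zeta_entire (of_real x)) ^ 3 * norm (zeta_entire (Complex x t)) ^ 4 * norm (zeta_entire (Complex x (2 * t)))
       \<ge> c * (x ^ 3 * norm (Complex x t) ^ 4 * norm (Complex x (2 * t)))"
proof -
  obtain C where C: "\<And>z. Re z \<ge> -1/4 \<Longrightarrow> norm (prime_corr z) \<le> C" by (rule prime_corr_bounded) blast
  show ?thesis
  proof (rule that[of "exp (-8 * C)"])
    fix x t :: real assume x: "x > 0"
    define a where "a = (\<lambda>z. Re (prime_sum z) - Re (prime_corr z))"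
    have n: "norm (zeta_entire z) = norm z * exp (a z)" if "Re z > 0" for z
      using that by (simp add: zeta_entire_eq_exp norm_mult a_def)
    have q: "- Re (prime_corr z) \<ge> - C" if "Re z > 0" for z
      using C[of z] abs_Re_le_cmod[of "prime_corr z"] that by linarith
    \<comment> \<open>The weights \<open>3 + 4 + 1\<close> produce eight values of
      \<open>prime_corr\<close>, each with real part at most \<open>C\<close>.\<close>
    have "3 * a (of_real x) + 4 * a (Complex x t) + a (Complex x (2*t)) \<ge> -8 * C"
      using three_four_one_prime_sum[OF x, of t] q[of "of_real x"] q[of "Complex x t"] q[of "Complex x (2*t)"] x
      by (simp add: a_def)
    hence "exp (-8 * C) \<le> exp (3 * a (of_real x) + 4 * a (Complex x t) + a (Complex x (2*t)))" by simp
    also have "\<dots> = exp (a (of_real x)) ^ 3 * exp (a (Complex x t)) ^ 4 * exp (a (Complex x (2*t)))"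
      by (simp add: exp_add exp_of_nat_mult[symmetric])
    finally have "exp (-8 * C) * (x ^ 3 * norm (Complex x t) ^ 4 * norm (Complex x (2 * t)))
       \<le> (exp (a (of_real x)) ^ 3 * exp (a (Complex x t)) ^ 4 * exp (a (Complex x (2*t)))) *
           (x ^ 3 * norm (Complex x t) ^ 4 * norm (Complex x (2 * t)))"
      using x by (intro mult_right_mono) auto
    also have "\<dots> = norm (zeta_entire (of_real x)) ^ 3 * norm (zeta_entire (Complex x t)) ^ 4 * norm (zeta_entire (Complex x (2 * t)))"
      using x by (simp add: n power_mult_distrib mult_ac)
    finally show "norm (zeta_entire (of_real x)) ^ 3 * norm (zeta_entire (Complex x t)) ^ 4 * norm (zeta_entire (Complex x (2 * t)))
       \<ge> exp (-8 * C) * (x ^ 3 * norm (Complex x t) ^ 4 * norm (Complex x (2 * t)))" .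
  qed simp
qed

section \<open>Growth, lower bounds, zero-free strips and the logarithm of zeta\<close>

lemma zeta_entire_nonzero: "Re z > 0 \<Longrightarrow> zeta_entire z \<noteq> 0"
  using zeta_entire_eq_exp[of z] by auto

lemma open_zeta_domain: "open {z. Re z > -1/2}"
  by (rule open_halfspace_Re_gt)

lemma zeta_entire_has_deriv:
  "Re z > -1/2 \<Longrightarrow> (zeta_entire has_field_derivative deriv zeta_entire z) (at z)"
  using zeta_entire_holomorphic open_zeta_domain holomorphic_derivI by blast

text \<open>The derivative is estimated by Cauchy's inequality on circles of radius
  \<open>d/2\<close>, which is why its range of real parts is smaller. On these strips
  \<open>norm z\<close> is comparable to \<open>1 + |Im z|\<close>.\<close>

lemma zeta_growth:
  assumes d: "0 < d" "d < 1/4"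
  obtains K where "K > 0"
    "\<And>z. -d \<le> Re z \<Longrightarrow> Re z \<le> 3 \<Longrightarrow> norm (zeta_entire z) \<le> K * (1 + \<bar>Im z\<bar>) powr (1 + 2 * d)"
    "\<And>z. -d/2 \<le> Re z \<Longrightarrow> Re z \<le> 2 \<Longrightarrow> norm (deriv zeta_entire z) \<le> K * (1 + \<bar>Im z\<bar>) powr (1 + 2 * d)"
proof -
  obtain K where K: "K > 0" "\<And>z. Re z \<ge> -d \<Longrightarrow> norm (zeta_entire z) \<le> K * (1 + norm z) powr (1 + 2 * d)"
    using zeta_entire_bound[of d] d by auto
  define K1 where "K1 = K * 4 powr (1 + 2 * d)"
  have K1: "K1 > 0" using K by (simp add: K1_def)
  have b1: "norm (zeta_entire z) \<le> K1 * (1 + \<bar>Im z\<bar>) powr (1 + 2 * d)" if "-d \<le> Re z" "Re z \<le> 3" for z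
  proof -
    have "\<bar>Re z\<bar> \<le> 3" using that d by auto
    hence "1 + norm z \<le> 4 * (1 + \<bar>Im z\<bar>)" using cmod_le[of z] by argo
    hence "(1 + norm z) powr (1 + 2 * d) \<le> (4 * (1 + \<bar>Im z\<bar>)) powr (1 + 2 * d)"
      using d by (intro powr_mono2) auto
    also have "\<dots> = 4 powr (1 + 2 * d) * (1 + \<bar>Im z\<bar>) powr (1 + 2 * d)"
      by (subst powr_mult) auto
    finally have "K * (1 + norm z) powr (1 + 2 * d) \<le> K * (4 powr (1 + 2 * d) * (1 + \<bar>Im z\<bar>) powr (1 + 2 * d))"
      using K by (intro mult_left_mono) auto
    thus ?thesis using K(2)[OF that(1)] by (simp add: K1_def mult.assoc)
  qed
  define K2 where "K2 = K1 * 2 powr (1 + 2 * d) / (d / 2)"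
  have b2: "norm (deriv zeta_entire z) \<le> K2 * (1 + \<bar>Im z\<bar>) powr (1 + 2 * d)" if z: "-d/2 \<le> Re z" "Re z \<le> 2" for z
  proof -
    have Re: "-d \<le> Re w" "Re w \<le> 3" if "w \<in> cball z (d/2)" for w
      using that z d abs_Re_le_cmod[of "z - w"] by (auto simp: dist_norm)
    have hol: "zeta_entire holomorphic_on cball z (d/2)"
      by (rule holomorphic_on_subset[OF zeta_entire_holomorphic]) (use Re d in force)
    have "norm ((deriv ^^ 1) zeta_entire z) \<le> fact 1 * (K1 * (2 * (1 + \<bar>Im z\<bar>)) powr (1 + 2 * d)) / (d/2) ^ 1"
    proof (rule Cauchy_inequality)
      show "zeta_entire holomorphic_on ball z (d/2)" using hol ball_subset_cball holomorphic_on_subset by blast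
      show "continuous_on (cball z (d/2)) zeta_entire" using hol by (rule holomorphic_on_imp_continuous_on)
      fix w assume w: "norm (z - w) = d / 2"
      hence "w \<in> cball z (d/2)" by (simp add: dist_norm)
      note R = Re[OF this]
      have "norm (zeta_entire w) \<le> K1 * (1 + \<bar>Im w\<bar>) powr (1 + 2 * d)" by (rule b1[OF R])
      also have "\<dots> \<le> K1 * (2 * (1 + \<bar>Im z\<bar>)) powr (1 + 2 * d)"
        using w abs_Im_le_cmod[of "z - w"] d K1 by (intro mult_left_mono powr_mono2) auto
      finally show "norm (zeta_entire w) \<le> K1 * (2 * (1 + \<bar>Im z\<bar>)) powr (1 + 2 * d)" .
    qed (use d in auto)
    moreover have "(2 * (1 + \<bar>Im z\<bar>)) powr (1 + 2 * d) = 2 powr (1 + 2 * d) * (1 + \<bar>Im z\<bar>) powr (1 + 2 * d)"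
      by (subst powr_mult) auto
    ultimately show ?thesis unfolding K2_def by (simp only:) (simp add: mult_ac)
  qed
  show ?thesis
  proof (rule that[of "max K1 K2"])
    show "max K1 K2 > 0" using K1 by simp
    show "norm (zeta_entire z) \<le> max K1 K2 * (1 + \<bar>Im z\<bar>) powr (1 + 2 * d)" if "-d \<le> Re z" "Re z \<le> 3" for z
      using b1[OF that] mult_right_mono[of K1 "max K1 K2" "(1 + \<bar>Im z\<bar>) powr (1 + 2 * d)"] by simp
    show "norm (deriv zeta_entire z) \<le> max K1 K2 * (1 + \<bar>Im z\<bar>) powr (1 + 2 * d)" if "-d/2 \<le> Re z" "Re z \<le> 2" for z
      using b2[OF that] mult_right_mono[of K2 "max K1 K2" "(1 + \<bar>Im z\<bar>) powr (1 + 2 * d)"] by simp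
  qed
qed

text \<open>In the cosine inequality \<open>zeta_entire\<close> is bounded at \<open>x\<close>,
  because the pole has been removed, and of order \<open>\<tau>^(1 + 2d)\<close> at
  \<open>2t\<close>, where \<open>\<tau> = 1 + |t|\<close>. The factors
  \<open>norm (Complex x t)\<close> and \<open>norm (Complex x (2 * t))\<close> contribute
  \<open>\<tau>^5\<close>. Hence the fourth power of the value at \<open>t\<close> is at least a
  constant times \<open>x^3 \<tau>^(4 - 2d)\<close>. Keeping \<open>|t|\<close> above
  \<open>r\<close> makes these moduli comparable to \<open>\<tau>\<close>.\<close>

lemma zeta_lower_bound_right:
  assumes d: "0 < d" "d < 1/4" and r: "r > 0"
  obtains c where "c > 0"
    "\<And>x t. 0 < x \<Longrightarrow> x \<le> 1 \<Longrightarrow> \<bar>t\<bar> \<ge> r \<Longrightarrow>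
       norm (zeta_entire (Complex x t)) \<ge> c * x powr (3/4) * (1 + \<bar>t\<bar>) powr (1 - d/2)"
proof -
  obtain c0 where c0: "c0 > 0" "\<And>x t. x > 0 \<Longrightarrow>
     norm (zeta_entire (of_real x)) ^ 3 * norm (zeta_entire (Complex x t)) ^ 4 * norm (zeta_entire (Complex x (2 * t)))
       \<ge> c0 * (x ^ 3 * norm (Complex x t) ^ 4 * norm (Complex x (2 * t)))"
    using three_four_one_zeta by blast
  obtain K where K: "K > 0" "\<And>z. -d \<le> Re z \<Longrightarrow> Re z \<le> 3 \<Longrightarrow> norm (zeta_entire z) \<le> K * (1 + \<bar>Im z\<bar>) powr (1 + 2 * d)"
    using zeta_growth[OF d] by metis
  \<comment> \<open>The largest factor with \<open>|t| \<ge> \<rho> (1 + |t|)\<close> for all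
    \<open>|t| \<ge> r\<close>.\<close>
  define \<rho> where "\<rho> = r / (1 + r)"
  have \<rho>: "\<rho> > 0" using r by (simp add: \<rho>_def)
  define c1 where "c1 = c0 * \<rho> ^ 5 / (K ^ 4 * 2 powr (1 + 2 * d))"
  have c1: "c1 > 0" using c0 \<rho> K by (simp add: c1_def)
  show ?thesis
  proof (rule that[of "c1 powr (1/4)"])
    show "c1 powr (1/4) > 0" using c1 by simp
    fix x t :: real assume x: "0 < x" "x \<le> 1" and t: "\<bar>t\<bar> \<ge> r"
    define \<tau> where "\<tau> = 1 + \<bar>t\<bar>"
    have \<tau>: "\<tau> \<ge> 1" by (simp add: \<tau>_def)
    have "r * (1 + \<bar>t\<bar>) \<le> (1 + r) * \<bar>t\<bar>" using t by (simp add: algebra_simps)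
    hence tt: "\<bar>t\<bar> \<ge> \<rho> * \<tau>" using r by (simp add: \<rho>_def \<tau>_def field_simps)
    define f where "f = norm (zeta_entire (Complex x t))"
    have 1: "norm (zeta_entire (of_real x)) \<le> K" using K(2)[of "of_real x"] x d by simp
    have "norm (zeta_entire (Complex x (2*t))) \<le> K * (1 + \<bar>2 * t\<bar>) powr (1 + 2 * d)"
      using K(2)[of "Complex x (2*t)"] x d by simp
    also have "\<dots> \<le> K * (2 * \<tau>) powr (1 + 2 * d)"
      using K d by (intro mult_left_mono powr_mono2) (auto simp: \<tau>_def)
    finally have 2: "norm (zeta_entire (Complex x (2*t))) \<le> K * (2 powr (1 + 2 * d) * \<tau> powr (1 + 2 * d))"
      using \<tau> by (simp add: powr_mult)
    have n1: "norm (Complex x t) \<ge> \<rho> * \<tau>" using abs_Im_le_cmod[of "Complex x t"] tt by simp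
    have n2: "norm (Complex x (2*t)) \<ge> \<rho> * \<tau>" using abs_Im_le_cmod[of "Complex x (2*t)"] tt by simp
    have "c0 * (x ^ 3 * (\<rho> * \<tau>) ^ 4 * (\<rho> * \<tau>)) \<le> c0 * (x ^ 3 * norm (Complex x t) ^ 4 * norm (Complex x (2 * t)))"
      using n1 n2 c0 x \<rho> \<tau> by (intro mult_left_mono mult_mono power_mono) auto
    also have "\<dots> \<le> norm (zeta_entire (of_real x)) ^ 3 * f ^ 4 * norm (zeta_entire (Complex x (2 * t)))"
      unfolding f_def by (rule c0(2)[OF x(1)])
    also have "\<dots> \<le> K ^ 3 * f ^ 4 * (K * (2 powr (1 + 2 * d) * \<tau> powr (1 + 2 * d)))"
      using 1 2 K by (intro mult_mono power_mono) (auto simp: f_def)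
    also have "\<dots> = (K ^ 4 * 2 powr (1 + 2 * d)) * (f ^ 4 * \<tau> powr (1 + 2 * d))"
      by (simp add: power_numeral_reduce)
    finally have "(K ^ 4 * 2 powr (1 + 2 * d)) * (f ^ 4 * \<tau> powr (1 + 2 * d)) \<ge> c0 * \<rho> ^ 5 * (x ^ 3 * \<tau> ^ 5)"
      by (simp add: power_numeral_reduce mult_ac)
    hence "f ^ 4 * \<tau> powr (1 + 2 * d) \<ge> c1 * (x ^ 3 * \<tau> ^ 5)"
      using K by (simp add: c1_def divide_le_eq mult_ac)
    also have "\<tau> ^ 5 = \<tau> powr (4 - 2 * d) * \<tau> powr (1 + 2 * d)"
    proof -
      have "\<tau> powr (4 - 2 * d) * \<tau> powr (1 + 2 * d) = \<tau> powr 5" unfolding powr_add[symmetric] by simp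
      thus ?thesis using \<tau> by simp
    qed
    finally have f4: "f ^ 4 \<ge> c1 * (x ^ 3 * \<tau> powr (4 - 2 * d))"
      using \<tau> by (simp add: mult.assoc[symmetric])
    have "(c1 powr (1/4) * x powr (3/4) * \<tau> powr (1 - d/2)) ^ 4 = (c1 powr (1/4)) ^ 4 * (x powr (3/4)) ^ 4 * (\<tau> powr (1 - d/2)) ^ 4"
      by (simp add: power_mult_distrib)
    also have "(c1 powr (1/4)) ^ 4 = c1" using c1 by (simp add: powr_power)
    also have "(x powr (3/4)) ^ 4 = x ^ 3" using x by (simp add: powr_power)
    also have "(\<tau> powr (1 - d/2)) ^ 4 = \<tau> powr (4 - 2 * d)" using \<tau> by (simp add: powr_power algebra_simps)
    finally have "(c1 powr (1/4) * x powr (3/4) * \<tau> powr (1 - d/2)) ^ 4 \<le> f ^ 4" using f4 by (simp add: mult.assoc)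
    hence "c1 powr (1/4) * x powr (3/4) * \<tau> powr (1 - d/2) \<le> f"
      by (subst (asm) power_mono_iff) (auto simp: f_def)
    thus "norm (zeta_entire (Complex x t)) \<ge> c1 powr (1/4) * x powr (3/4) * (1 + \<bar>t\<bar>) powr (1 - d/2)"
      unfolding f_def[symmetric] \<tau>_def[symmetric] .
  qed
qed

text \<open>Nonvanishing is included because division by zero gives \<open>0\<close>, so the
  inequality alone would hold at a zero of \<open>zeta_entire\<close>.\<close>

definition log_deriv_bounded :: "real \<Rightarrow> complex \<Rightarrow> bool" where
  "log_deriv_bounded B z \<longleftrightarrow> zeta_entire z \<noteq> 0 \<and> norm (deriv zeta_entire z / zeta_entire z) \<le> B"

text \<open>At distance \<open>x = k \<tau>^(-e)\<close> to the right of the line the cosine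
  inequality gives a lower bound of order \<open>x^(3/4) \<tau>^(1 - d/2)\<close>. Moving left by at
  most \<open>2x\<close> changes \<open>zeta_entire\<close> by at most \<open>2x\<close> times the
  derivative bound. As \<open>x\<close> tends to \<open>0\<close> faster than
  \<open>x^(3/4)\<close>, this change is at most half of the lower bound, which therefore survives
  up to \<open>-x\<close>.\<close>

lemma log_deriv_bound_high:
  assumes e: "0 < e" "e < 1" and r: "r > 0"
  obtains k C where "k > 0" "C > 0"
    "\<And>z. \<bar>Im z\<bar> \<ge> r \<Longrightarrow> - k * (1 + \<bar>Im z\<bar>) powr (-e) \<le> Re z \<Longrightarrow> Re z \<le> 1 \<Longrightarrow>
       log_deriv_bounded (C * (1 + \<bar>Im z\<bar>) powr e) z"
proof -
  \<comment> \<open>The ratio \<open>10\<close> fits both uses: \<open>x^(1/4)\<close> supplies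
    \<open>\<tau>^(-e/4) = \<tau>^(-5d/2)\<close>, exactly what turns \<open>\<tau>^(1 + 2d)\<close>
    into \<open>\<tau>^(1 - d/2)\<close>; and the final lower bound has exponent
    \<open>1 - d/2 - 3e/4 = 1 - 8d\<close>, so that the quotient has exponent
    \<open>10d = e\<close>.\<close>
  define d where "d = e / 10"
  have d: "0 < d" "d < 1/4" using e by (auto simp: d_def)
  obtain K where K: "K > 0"
    "\<And>z. -d/2 \<le> Re z \<Longrightarrow> Re z \<le> 2 \<Longrightarrow> norm (deriv zeta_entire z) \<le> K * (1 + \<bar>Im z\<bar>) powr (1 + 2 * d)"
    using zeta_growth[OF d] by metis
  obtain c where c: "c > 0"
    "\<And>x t. 0 < x \<Longrightarrow> x \<le> 1 \<Longrightarrow> \<bar>t\<bar> \<ge> r \<Longrightarrow>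
       norm (zeta_entire (Complex x t)) \<ge> c * x powr (3/4) * (1 + \<bar>t\<bar>) powr (1 - d/2)"
    using zeta_lower_bound_right[OF d r] by metis
  \<comment> \<open>The first entry makes the variation over a distance \<open>2x\<close> at most
    half of the lower bound; the second keeps \<open>x \<le> d/2\<close>, where the derivative bound
    is available.\<close>
  define k where "k = min ((c / (4 * K)) powr 4) (d / 2)"
  have k: "k > 0" "k \<le> d/2" "k \<le> (c / (4 * K)) powr 4" using c K d by (auto simp: k_def)
  define m where "m = c * k powr (3/4) / 2"
  have m: "m > 0" using c k by (simp add: m_def)
  show ?thesis
  proof (rule that[of k "K / m"])
    show "k > 0" by fact
    show "K / m > 0" using K m by simp
    fix z assume z: "\<bar>Im z\<bar> \<ge> r" "- k * (1 + \<bar>Im z\<bar>) powr (-e) \<le> Re z" "Re z \<le> 1"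
    define t where "t = Im z"
    define \<tau> where "\<tau> = 1 + \<bar>t\<bar>"
    have \<tau>: "\<tau> \<ge> 1" by (simp add: \<tau>_def)
    define x where "x = k * \<tau> powr (-e)"
    have "\<tau> powr (-e) \<le> \<tau> powr 0" using \<tau> e by (intro powr_mono) auto
    hence te1: "\<tau> powr (-e) \<le> 1" using \<tau> by simp
    hence "x \<le> k * 1" unfolding x_def using k by (intro mult_left_mono) auto
    moreover have "x > 0" using k \<tau> by (simp add: x_def)
    ultimately have x: "0 < x" "x \<le> d/2" "x \<le> 1" using k d by linarith+
    have "x powr (1/4) = k powr (1/4) * \<tau> powr (-e/4)"
      using \<tau> k by (simp add: x_def powr_mult powr_powr)
    also have "k powr (1/4) \<le> ((c / (4 * K)) powr 4) powr (1/4)"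
      using k by (intro powr_mono2) auto
    also have "\<dots> = c / (4 * K)" unfolding powr_powr using c K by simp
    finally have x4: "x powr (1/4) \<le> c / (4 * K) * \<tau> powr (-e/4)" by (simp add: mult_right_mono)
    have "x = x powr (1/4 + 3/4)" using x by simp
    also have "\<dots> = x powr (1/4) * x powr (3/4)" by (rule powr_add)
    also have "\<dots> \<le> c / (4 * K) * \<tau> powr (-e/4) * x powr (3/4)"
      by (intro mult_right_mono x4) auto
    finally have "2 * x * K * \<tau> powr (1 + 2 * d) \<le> 2 * (c / (4 * K) * \<tau> powr (-e/4) * x powr (3/4)) * K * \<tau> powr (1 + 2 * d)"
      using K by (intro mult_right_mono mult_left_mono) auto
    also have "\<dots> = c / 2 * x powr (3/4) * (\<tau> powr (-e/4) * \<tau> powr (1 + 2 * d))"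
      using K by (simp add: field_simps)
    also have "\<tau> powr (-e/4) * \<tau> powr (1 + 2 * d) = \<tau> powr (1 - d/2)"
      by (simp add: d_def flip: powr_add)
    finally have small: "2 * x * K * \<tau> powr (1 + 2 * d) \<le> c / 2 * x powr (3/4) * \<tau> powr (1 - d/2)" .
    have lower: "norm (zeta_entire z) \<ge> c / 2 * x powr (3/4) * \<tau> powr (1 - d/2)"
    proof (cases "Re z \<ge> x")
      case True
      have "c / 2 * x powr (3/4) * \<tau> powr (1 - d/2) \<le> c * (Re z) powr (3/4) * \<tau> powr (1 - d/2)"
        using c x True by (intro mult_right_mono mult_mono powr_mono2) auto
      also have "\<dots> \<le> norm (zeta_entire (Complex (Re z) t))"
        unfolding \<tau>_def using x True z by (intro c(2)) (auto simp: t_def)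
      finally show ?thesis by (simp add: t_def)
    next
      case False
      define w where "w = Complex x t"
      have zx: "- x \<le> Re z" using z by (simp add: x_def \<tau>_def t_def)
      have "norm (zeta_entire w - zeta_entire z) \<le> (K * \<tau> powr (1 + 2 * d)) * norm (w - z)"
      proof (rule field_differentiable_bound[where S = "closed_segment z w"])
        fix v assume v: "v \<in> closed_segment z w"
        obtain u where u: "0 \<le> u" "u \<le> 1" "v = (1 - u) *\<^sub>R z + u *\<^sub>R w"
          using v unfolding closed_segment_def by blast
        have "Im v = (1 - u) * t + u * t" unfolding u by (simp add: w_def t_def)
        hence Imv: "Im v = t" by (simp add: algebra_simps)
        have "Re v = (1 - u) *\<^sub>R Re z + u *\<^sub>R Re w" unfolding u by simp
        hence "Re v \<in> closed_segment (Re z) (Re w)"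
          using u unfolding closed_segment_def by blast
        hence Rev: "-x \<le> Re v" "Re v \<le> x" using False zx x
          by (auto simp: closed_segment_eq_real_ivl w_def split: if_splits)
        show "(zeta_entire has_field_derivative deriv zeta_entire v) (at v within closed_segment z w)"
          using Rev x d by (intro has_field_derivative_at_within[OF zeta_entire_has_deriv]) auto
        show "norm (deriv zeta_entire v) \<le> K * \<tau> powr (1 + 2 * d)"
          using K(2)[of v] Rev x d by (simp add: Imv \<tau>_def)
      qed auto
      also have "norm (w - z) \<le> 2 * x"
      proof -
        have "w - z = of_real (x - Re z)" by (simp add: w_def t_def complex_eq_iff)
        hence "norm (w - z) = \<bar>x - Re z\<bar>" by (simp only: norm_of_real)
        thus ?thesis using zx False by simp
      qed
      hence "(K * \<tau> powr (1 + 2 * d)) * norm (w - z) \<le> (K * \<tau> powr (1 + 2 * d)) * (2 * x)"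
        using K by (intro mult_left_mono) auto
      finally have "norm (zeta_entire w - zeta_entire z) \<le> 2 * x * K * \<tau> powr (1 + 2 * d)"
        by (simp add: mult_ac)
      hence "norm (zeta_entire w - zeta_entire z) \<le> c / 2 * x powr (3/4) * \<tau> powr (1 - d/2)"
        using small by linarith
      moreover have "norm (zeta_entire w) \<ge> c * x powr (3/4) * \<tau> powr (1 - d/2)"
        unfolding \<tau>_def w_def using x z by (intro c(2)) (auto simp: t_def)
      ultimately show ?thesis
        using norm_triangle_ineq2[of "zeta_entire w" "zeta_entire z"] by simp
    qed
    have "x powr (3/4) * \<tau> powr (1 - d/2) = k powr (3/4) * (\<tau> powr (-e*3/4) * \<tau> powr (1 - d/2))"
      using k \<tau> by (simp add: x_def powr_mult powr_powr)
    also have "\<tau> powr (-e*3/4) * \<tau> powr (1 - d/2) = \<tau> powr (1 - 8 * d)"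
      by (simp add: d_def flip: powr_add)
    finally have lower': "norm (zeta_entire z) \<ge> m * \<tau> powr (1 - 8 * d)"
      using lower by (simp add: m_def mult.assoc)
    have "m * \<tau> powr (1 - 8 * d) > 0" using m \<tau> by simp
    hence nz: "norm (zeta_entire z) > 0" using lower' by linarith
    have "norm (deriv zeta_entire z) \<le> K * \<tau> powr (1 + 2 * d)"
      using K(2)[of z] z x by (simp add: \<tau>_def t_def x_def)
    also have "\<dots> = K / m * \<tau> powr e * (m * \<tau> powr (1 - 8 * d))"
    proof -
      have "\<tau> powr e * \<tau> powr (1 - 8 * d) = \<tau> powr (1 + 2 * d)"
        unfolding powr_add[symmetric] by (rule arg_cong[where f = "\<lambda>s. \<tau> powr s"]) (simp add: d_def)
      thus ?thesis using m by simp
    qed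
    also have "\<dots> \<le> K / m * \<tau> powr e * norm (zeta_entire z)"
      using K m by (intro mult_left_mono lower') auto
    finally have "norm (deriv zeta_entire z / zeta_entire z) \<le> K / m * \<tau> powr e"
      using nz by (simp add: norm_divide divide_le_eq)
    thus "log_deriv_bounded (K / m * (1 + \<bar>Im z\<bar>) powr e) z"
      using nz by (auto simp: log_deriv_bounded_def \<tau>_def t_def)
  qed
qed

text \<open>Near the real axis the cosine inequality degenerates, since its right-hand side contains
  powers of small moduli. There \<open>zeta_entire 0 = 1\<close> excludes zeros around the origin,
  the Euler product excludes them for \<open>Re z > 0\<close>, and compactness of the box gives the
  bound.\<close>

lemma log_deriv_bound_low:
  obtains r C where "r > 0" "r \<le> 1/4" "C > 0"
    "\<And>z. \<bar>Im z\<bar> \<le> r \<Longrightarrow> -r \<le> Re z \<Longrightarrow> Re z \<le> 1 \<Longrightarrow> log_deriv_bounded C z"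
proof -
  have "isCont zeta_entire 0"
    using zeta_entire_has_deriv[of 0] DERIV_isCont by auto
  then obtain \<rho> where \<rho>: "\<rho> > 0" "\<And>z. norm z < \<rho> \<Longrightarrow> norm (zeta_entire z - 1) < 1"
    unfolding continuous_at_eps_delta dist_norm by (metis zero_less_one diff_zero zeta_entire_0)
  define r where "r = min (\<rho> / 4) (1/4)"
  have r: "r > 0" "r \<le> 1/4" "r \<le> \<rho>/4" using \<rho> by (auto simp: r_def)
  define B where "B = cbox (Complex (-r) (-r)) (Complex 1 r)"
  have nz: "zeta_entire z \<noteq> 0" if "z \<in> B" for z
  proof (cases "Re z > 0")
    case False
    hence "\<bar>Re z\<bar> \<le> r" "\<bar>Im z\<bar> \<le> r" using that by (auto simp: B_def in_cbox_complex_iff)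
    hence "norm z < \<rho>" using cmod_le[of z] r by linarith
    from \<rho>(2)[OF this] show ?thesis by auto
  qed (rule zeta_entire_nonzero)
  have hol: "deriv zeta_entire holomorphic_on {z. Re z > -1/2}"
    by (rule holomorphic_deriv[OF zeta_entire_holomorphic open_zeta_domain])
  have sub: "B \<subseteq> {z. Re z > -1/2}" using r by (auto simp: B_def in_cbox_complex_iff)
  have "continuous_on B (\<lambda>z. deriv zeta_entire z / zeta_entire z)"
    using holomorphic_on_subset[OF hol sub] holomorphic_on_subset[OF zeta_entire_holomorphic sub] nz
    by (intro continuous_intros holomorphic_on_imp_continuous_on) auto
  hence "compact ((\<lambda>z. deriv zeta_entire z / zeta_entire z) ` B)"
    by (rule compact_continuous_image) (simp add: B_def)
  then obtain C where C: "C > 0" "\<And>z. z \<in> B \<Longrightarrow> norm (deriv zeta_entire z / zeta_entire z) \<le> C"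
    using compact_imp_bounded bounded_pos by (metis (no_types, lifting) imageI)
  show ?thesis
    by (rule that[OF r(1,2) C(1)]) (use C nz in \<open>auto simp: log_deriv_bounded_def B_def in_cbox_complex_iff abs_le_iff\<close>)
qed

lemma log_deriv_bound:
  assumes e: "0 < e" "e < 1"
  obtains k C where "k > 0" "k \<le> 1/4" "C > 0"
    "\<And>z. - k * (1 + \<bar>Im z\<bar>) powr (-e) \<le> Re z \<Longrightarrow> Re z \<le> 1 \<Longrightarrow> log_deriv_bounded (C * (1 + \<bar>Im z\<bar>) powr e) z"
proof -
  obtain r C1 where r: "r > 0" "r \<le> 1/4" and C1: "C1 > 0"
    "\<And>z. \<bar>Im z\<bar> \<le> r \<Longrightarrow> -r \<le> Re z \<Longrightarrow> Re z \<le> 1 \<Longrightarrow> log_deriv_bounded C1 z"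
    using log_deriv_bound_low by metis
  obtain k C2 where k: "k > 0" and C2: "C2 > 0"
    "\<And>z. \<bar>Im z\<bar> \<ge> r \<Longrightarrow> - k * (1 + \<bar>Im z\<bar>) powr (-e) \<le> Re z \<Longrightarrow> Re z \<le> 1 \<Longrightarrow>
       log_deriv_bounded (C2 * (1 + \<bar>Im z\<bar>) powr e) z"
    using log_deriv_bound_high[OF e r(1)] by metis
  show ?thesis
  proof (rule that[of "min k r" "max C1 C2"])
    fix z assume z: "- min k r * (1 + \<bar>Im z\<bar>) powr (-e) \<le> Re z" "Re z \<le> 1"
    define a where "a = (1 + \<bar>Im z\<bar>) powr (-e)"
    define b where "b = (1 + \<bar>Im z\<bar>) powr e"
    have "a \<le> (1 + \<bar>Im z\<bar>) powr 0" unfolding a_def using e by (intro powr_mono) auto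
    moreover have "1 + \<bar>Im z\<bar> \<noteq> 0" by linarith
    ultimately have a: "0 \<le> a" "a \<le> 1" by (auto simp: a_def)
    have b: "b \<ge> 1" unfolding b_def using e by (intro ge_one_powr_ge_zero) auto
    have mono: "log_deriv_bounded B' z" if "log_deriv_bounded B z" "B \<le> B'" for B B'
      using that unfolding log_deriv_bounded_def by (blast intro: order_trans)
    show "log_deriv_bounded (max C1 C2 * (1 + \<bar>Im z\<bar>) powr e) z"
    proof (cases "\<bar>Im z\<bar> \<le> r")
      case True
      have "min k r * a \<le> r * 1" using a r k by (intro mult_mono) auto
      hence "-r \<le> Re z" using z by (simp add: a_def)
      hence "log_deriv_bounded C1 z" using C1(2) True z by blast
      moreover have "C1 * 1 \<le> max C1 C2 * b" using C1 C2 b by (intro mult_mono) auto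
      ultimately show ?thesis using mono unfolding b_def by simp
    next
      case False
      have "min k r * a \<le> k * a" using a by (intro mult_right_mono) auto
      hence "- k * a \<le> Re z" using z by (simp add: a_def)
      hence "log_deriv_bounded (C2 * b) z" unfolding b_def a_def using C2(2)[of z] False z by auto
      moreover have "C2 * b \<le> max C1 C2 * b" using b by (intro mult_right_mono) auto
      ultimately show ?thesis using mono unfolding b_def by simp
    qed
  qed (use k r C1 in auto)
qed

text \<open>The branch is fixed by integrating the logarithmic derivative over a convex region,
  starting at \<open>0\<close>, where \<open>zeta_entire\<close> equals \<open>1\<close>.
  Integration also gives the bound linear in \<open>norm z\<close>. For \<open>Re z > 0\<close> the
  result has the same derivative as \<open>prime_sum z - prime_corr z + Ln z\<close>, so only the
  constant between them is left to determine.\<close>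

lemma zeta_log_strip:
  assumes e: "0 < e" "e < 1"
  obtains k C where "k > 0" "k \<le> 1/4" "C > 0"
    "\<And>T. T \<ge> 1 \<Longrightarrow> \<exists>L. L holomorphic_on {z. Re z > - k * (2 + T) powr (-e) \<and> \<bar>Im z\<bar> < T + 1} \<and> L 0 = 0 \<and>
       (\<forall>z. Re z > 0 \<longrightarrow> \<bar>Im z\<bar> < T + 1 \<longrightarrow> L z = prime_sum z - prime_corr z + Ln z) \<and>
       (\<forall>z. Re z > - k * (2 + T) powr (-e) \<longrightarrow> \<bar>Im z\<bar> < T + 1 \<longrightarrow> Re z \<le> 1 \<longrightarrow> 
            norm (L z) \<le> C * (2 + T) powr e * norm z)"
proof -
  obtain k C where kC: "k > 0" "k \<le> 1/4" "C > 0"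
    "\<And>z. - k * (1 + \<bar>Im z\<bar>) powr (-e) \<le> Re z \<Longrightarrow> Re z \<le> 1 \<Longrightarrow> log_deriv_bounded (C * (1 + \<bar>Im z\<bar>) powr e) z"
    using log_deriv_bound[OF e] by metis
  show ?thesis
  proof (rule that[OF kC(1-3)])
    fix T :: real assume T: "T \<ge> 1"
    define \<eta> where "\<eta> = k * (2 + T) powr (-e)"
    define U where "U = {z. Re z > - \<eta> \<and> \<bar>Im z\<bar> < T + 1}"
    have "(2 + T) powr (-e) \<le> (2 + T) powr 0" using T e by (intro powr_mono) auto
    hence "\<eta> \<le> k * 1" unfolding \<eta>_def using kC T by (intro mult_left_mono) auto
    moreover have "\<eta> > 0" using kC T by (simp add: \<eta>_def)
    ultimately have \<eta>: "\<eta> > 0" "\<eta> \<le> 1/4" using kC by linarith+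
    have U_eq: "U = {z. Re z > -\<eta>} \<inter> {z. Im z < T + 1} \<inter> {z. Im z > -(T + 1)}" by (auto simp: U_def)
    have U: "open U" "convex U"
      unfolding U_eq by (intro open_Int convex_Int open_halfspace_Re_gt open_halfspace_Im_gt open_halfspace_Im_lt
           convex_halfspace_Re_gt convex_halfspace_Im_gt convex_halfspace_Im_lt)+
    have 0: "0 \<in> U" using \<eta> T by (auto simp: U_def)
    have sub: "U \<subseteq> {z. Re z > -1/2}" using \<eta> by (auto simp: U_def)
    have ldb: "log_deriv_bounded (C * (2 + T) powr e) z" if "z \<in> U" "Re z \<le> 1" for z
    proof -
      \<comment> \<open>The rectangular strip lies inside the curved zero-free region because
        \<open>1 + |Im z| < 2 + T\<close> on it.\<close>
      have "(2 + T) powr (-e) \<le> (1 + \<bar>Im z\<bar>) powr (-e)"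
        using that e by (intro powr_mono2') (auto simp: U_def)
      hence "\<eta> \<le> k * (1 + \<bar>Im z\<bar>) powr (-e)" unfolding \<eta>_def using kC by (intro mult_left_mono) auto
      hence "log_deriv_bounded (C * (1 + \<bar>Im z\<bar>) powr e) z" 
        using that by (intro kC(4)) (auto simp: U_def)
      moreover have "C * (1 + \<bar>Im z\<bar>) powr e \<le> C * (2 + T) powr e"
        using that kC e by (intro mult_left_mono powr_mono2) (auto simp: U_def)
      ultimately show ?thesis unfolding log_deriv_bounded_def by (blast intro: order_trans)
    qed
    have nz: "zeta_entire z \<noteq> 0" if "z \<in> U" for z
      using ldb[OF that] zeta_entire_nonzero[of z] by (cases "Re z \<le> 1") (auto simp: log_deriv_bounded_def)
    define q where "q = (\<lambda>z. deriv zeta_entire z / zeta_entire z)"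
    have q_hol: "q holomorphic_on U" unfolding q_def
      using holomorphic_on_subset[OF zeta_entire_holomorphic sub] nz
         holomorphic_on_subset[OF holomorphic_deriv[OF zeta_entire_holomorphic open_zeta_domain] sub]
      by (intro holomorphic_on_divide) auto
    obtain G where G: "\<And>z. z \<in> U \<Longrightarrow> (G has_field_derivative q z) (at z within U)"
      by (rule holomorphic_convex_primitive'[OF U(2,1) q_hol]) (rule that)
    define L where "L = (\<lambda>z. G z - G 0)"
    have L: "(L has_field_derivative q z) (at z)" if "z \<in> U" for z
    proof -
      have "(G has_field_derivative q z) (at z)" using G[OF that] at_within_open[OF that U(1)] by simp
      from DERIV_diff[OF this DERIV_const[of "G 0"]] show ?thesis unfolding L_def by simp
    qed
    have L_hol: "L holomorphic_on U" using L U holomorphic_on_open by blast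
    define V where "V = U \<inter> {z. Re z > 0}"
    have V: "open V" "convex V" unfolding V_def by (intro open_Int convex_Int U open_halfspace_Re_gt convex_halfspace_Re_gt)+
    define H where "H = (\<lambda>z. prime_sum z - prime_corr z + Ln z)"
    have H_deriv: "(H has_field_derivative q z) (at z)" if z: "Re z > 0" for z
    proof -
      have op: "open {z. Re z > 0}" by (rule open_halfspace_Re_gt)
      have "prime_corr holomorphic_on {z. Re z > 0}"
        by (rule holomorphic_on_subset[OF prime_corr_holomorphic]) auto
      hence "H holomorphic_on {z. Re z > 0}" unfolding H_def
        using prime_sum_holomorphic by (intro holomorphic_intros) (auto simp: complex_nonpos_Reals_iff)
      hence H1: "(H has_field_derivative deriv H z) (at z)" using op z holomorphic_derivI by blast
      \<comment> \<open>The derivative of \<open>H\<close> is read off from that of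
        \<open>exp (H z)\<close>, which is \<open>zeta_entire\<close> on this half-plane.\<close>
      have "((\<lambda>z. exp (H z)) has_field_derivative (exp (H z) * deriv H z)) (at z)"
        using H1 by (auto intro!: derivative_eq_intros)
      moreover have "exp (H w) = zeta_entire w" if "w \<in> {z. Re z > 0}" for w
      proof -
        have "w \<noteq> 0" using that by auto
        thus ?thesis using that by (simp add: H_def zeta_entire_eq_exp exp_add)
      qed
      ultimately have "(zeta_entire has_field_derivative (zeta_entire z * deriv H z)) (at z)"
        using has_field_derivative_transform_within_open[of "\<lambda>z. exp (H z)" "exp (H z) * deriv H z" z "{z. Re z > 0}" zeta_entire]
          op z by auto
      hence "deriv zeta_entire z = zeta_entire z * deriv H z" by (rule DERIV_imp_deriv)
      hence "q z = deriv H z" using zeta_entire_nonzero[OF z] by (simp add: q_def)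
      thus ?thesis using H1 by simp
    qed
    have "\<exists>c. \<forall>z\<in>V. L z - H z = c"
    proof (rule has_field_derivative_zero_constant)
      show "convex V" by fact
      fix z assume "z \<in> V"
      hence "((\<lambda>z. L z - H z) has_field_derivative q z - q z) (at z)"
        by (intro derivative_intros L H_deriv) (auto simp: V_def)
      thus "((\<lambda>z. L z - H z) has_field_derivative 0) (at z within V)"
        using has_field_derivative_at_within by fastforce
    qed
    then obtain c where c: "\<And>z. z \<in> V \<Longrightarrow> L z = H z + c" by (metis diff_add_cancel add.commute)
    \<comment> \<open>The constant is determined along \<open>1 / (n + 1)\<close>. There
      \<open>L\<close> tends to \<open>0\<close> and
      \<open>exp (L z) = zeta_entire z * exp c\<close>, whence \<open>exp c = 1\<close>;
      \<open>H\<close> is real at these points, whence \<open>Im c = 0\<close>. Together they force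
      \<open>c = 0\<close>.\<close>
    have lim0: "(\<lambda>n. complex_of_real (1 / real (Suc n))) \<longlonglongrightarrow> 0"
      using tendsto_of_real[OF lim_inverse_n'[THEN LIMSEQ_Suc], where 'a = complex] by simp
    have contL: "isCont L 0" using L[OF 0] DERIV_isCont by blast
    have contF: "isCont zeta_entire 0" using zeta_entire_has_deriv[of 0] DERIV_isCont by auto
    have inV: "complex_of_real (1 / real (Suc n)) \<in> V" for n
    proof -
      have "0 < 1 / real (Suc n)" by simp
      moreover from this have "- \<eta> < 1 / real (Suc n)" using \<eta> by linarith
      ultimately show ?thesis using T by (simp only: V_def U_def) simp
    qed
    have limL: "(\<lambda>n. L (of_real (1 / real (Suc n)))) \<longlonglongrightarrow> 0"
      using isCont_tendsto_compose[OF contL lim0] by (simp add: L_def)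
    have "(\<lambda>n. exp (L (of_real (1 / real (Suc n))))) \<longlonglongrightarrow> exp 0"
      by (rule tendsto_exp[OF limL])
    moreover have "exp (L (of_real (1 / real (Suc n)))) = zeta_entire (of_real (1 / real (Suc n))) * exp c" for n
    proof -
      define w where "w = complex_of_real (1 / real (Suc n))"
      have "w \<in> V" unfolding w_def by (rule inV)
      hence "Re w > 0" "w \<noteq> 0" by (auto simp: V_def)
      thus ?thesis unfolding w_def[symmetric] using c[OF \<open>w \<in> V\<close>]
        by (simp add: H_def zeta_entire_eq_exp exp_add)
    qed
    moreover have "(\<lambda>n. zeta_entire (of_real (1 / real (Suc n))) * exp c) \<longlonglongrightarrow> zeta_entire 0 * exp c"
      by (intro tendsto_intros isCont_tendsto_compose[OF contF lim0])
    ultimately have expc: "exp c = 1" using LIMSEQ_unique by fastforce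
    have "Im (L (of_real (1 / real (Suc n)))) = Im c" for n
    proof -
      define x where "x = 1 / real (Suc n)"
      have x: "x > 0" "of_real x \<in> V" unfolding x_def using inV by auto
      have "Im (H (of_real x)) = 0" unfolding H_def
        using x by (simp add: prime_sum_of_real prime_corr_of_real Ln_of_real)
      thus ?thesis unfolding x_def[symmetric] using c[OF x(2)] by simp
    qed
    hence "Im c = 0" using tendsto_Im[OF limL] LIMSEQ_unique[OF tendsto_const] by fastforce
    hence "c = of_real (Re c)" by (simp add: complex_eq_iff)
    hence "exp (Re c) = 1" using expc by (metis exp_of_real of_real_eq_1_iff)
    hence "c = 0" using \<open>c = of_real (Re c)\<close> by simp
    moreover have "norm (L z) \<le> C * (2 + T) powr e * norm z" if z: "z \<in> U" "Re z \<le> 1" for z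
    proof -
      have "norm (L z - L 0) \<le> (C * (2 + T) powr e) * norm (z - 0)"
      proof (rule field_differentiable_bound[where S = "U \<inter> {z. Re z \<le> 1}"])
        show "convex (U \<inter> {z. Re z \<le> 1})" by (intro convex_Int U convex_halfspace_Re_le)
        fix w assume w: "w \<in> U \<inter> {z. Re z \<le> 1}"
        show "(L has_field_derivative q w) (at w within U \<inter> {z. Re z \<le> 1})"
          using w by (intro has_field_derivative_at_within[OF L]) auto
        show "norm (q w) \<le> C * (2 + T) powr e"
          using ldb[of w] w by (auto simp: log_deriv_bounded_def q_def)
      qed (use z 0 in auto)
      thus ?thesis by (simp add: L_def)
    qed
    ultimately show "\<exists>L. L holomorphic_on {z. Re z > - k * (2 + T) powr (-e) \<and> \<bar>Im z\<bar> < T + 1} \<and> L 0 = 0 \<and>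
       (\<forall>z. Re z > 0 \<longrightarrow> \<bar>Im z\<bar> < T + 1 \<longrightarrow> L z = prime_sum z - prime_corr z + Ln z) \<and>
       (\<forall>z. Re z > - k * (2 + T) powr (-e) \<longrightarrow> \<bar>Im z\<bar> < T + 1 \<longrightarrow> Re z \<le> 1 \<longrightarrow> 
            norm (L z) \<le> C * (2 + T) powr e * norm z)"
      using L_hol c \<eta> by (intro exI[of _ L]) (auto simp: L_def H_def U_def V_def \<eta>_def)
  qed
qed

section \<open>Newman's contour bound\<close>

text \<open>The path from \<open>-iR\<close> to \<open>iR\<close> along three sides of a rectangle whose vertical side has real
  part \<open>b\<close>; a full rectangle is the difference of a bracket with \<open>b > 0\<close> and one with \<open>b < 0\<close>.\<close>

definition bracket_integral :: "real \<Rightarrow> real \<Rightarrow> (complex \<Rightarrow> complex) \<Rightarrow> complex" where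
  "bracket_integral R b f =
     contour_integral (linepath (Complex 0 (-R)) (Complex b (-R))) f +
     contour_integral (linepath (Complex b (-R)) (Complex b R)) f +
     contour_integral (linepath (Complex b R) (Complex 0 R)) f"

definition bracket :: "real \<Rightarrow> real \<Rightarrow> complex set" where
  "bracket R b = closed_segment (Complex 0 (-R)) (Complex b (-R)) \<union>
     closed_segment (Complex b (-R)) (Complex b R) \<union> closed_segment (Complex b R) (Complex 0 R)"

lemma closed_segment_Re:
  "closed_segment (Complex a t) (Complex b t) = {z. Re z \<in> closed_segment a b \<and> Im z = t}"
proof (intro set_eqI iffI)
  fix z assume "z \<in> closed_segment (Complex a t) (Complex b t)"
  then obtain u where u: "0 \<le> u" "u \<le> 1" "z = (1 - u) *\<^sub>R Complex a t + u *\<^sub>R Complex b t"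
    unfolding closed_segment_def by blast
  have "Re z = (1 - u) *\<^sub>R a + u *\<^sub>R b" unfolding u(3) by simp
  moreover have "Im z = (1 - u) * t + u * t" unfolding u(3) by simp
  hence "Im z = t" by (simp add: algebra_simps)
  ultimately show "z \<in> {z. Re z \<in> closed_segment a b \<and> Im z = t}" using u unfolding closed_segment_def by blast
next
  fix z assume z: "z \<in> {z. Re z \<in> closed_segment a b \<and> Im z = t}"
  then obtain u where u: "0 \<le> u" "u \<le> 1" "Re z = (1 - u) *\<^sub>R a + u *\<^sub>R b"
    unfolding closed_segment_def by blast
  have "z = (1 - u) *\<^sub>R Complex a t + u *\<^sub>R Complex b t"
    using u z by (simp add: complex_eq_iff algebra_simps)
  thus "z \<in> closed_segment (Complex a t) (Complex b t)" using u unfolding closed_segment_def by blast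
qed

lemma closed_segment_Im:
  "closed_segment (Complex t a) (Complex t b) = {z. Im z \<in> closed_segment a b \<and> Re z = t}"
proof (intro set_eqI iffI)
  fix z assume "z \<in> closed_segment (Complex t a) (Complex t b)"
  then obtain u where u: "0 \<le> u" "u \<le> 1" "z = (1 - u) *\<^sub>R Complex t a + u *\<^sub>R Complex t b"
    unfolding closed_segment_def by blast
  have "Im z = (1 - u) *\<^sub>R a + u *\<^sub>R b" unfolding u(3) by simp
  moreover have "Re z = (1 - u) * t + u * t" unfolding u(3) by simp
  hence "Re z = t" by (simp add: algebra_simps)
  ultimately show "z \<in> {z. Im z \<in> closed_segment a b \<and> Re z = t}" using u unfolding closed_segment_def by blast
next
  fix z assume z: "z \<in> {z. Im z \<in> closed_segment a b \<and> Re z = t}"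
  then obtain u where u: "0 \<le> u" "u \<le> 1" "Im z = (1 - u) *\<^sub>R a + u *\<^sub>R b"
    unfolding closed_segment_def by blast
  have "z = (1 - u) *\<^sub>R Complex t a + u *\<^sub>R Complex t b"
    using u z by (simp add: complex_eq_iff algebra_simps)
  thus "z \<in> closed_segment (Complex t a) (Complex t b)" using u unfolding closed_segment_def by blast
qed

lemma bracket_pos:
  assumes "R \<ge> 0" "b \<ge> 0"
  shows "bracket R b = {z. (0 \<le> Re z \<and> Re z \<le> b \<and> \<bar>Im z\<bar> = R) \<or> (Re z = b \<and> \<bar>Im z\<bar> \<le> R)}"
  using assms unfolding bracket_def closed_segment_Re closed_segment_Im
  by (auto simp: closed_segment_eq_real_ivl abs_le_iff split: if_splits)

lemma bracket_neg:
  assumes "R \<ge> 0" "b \<ge> 0"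
  shows "bracket R (-b) = {z. (-b \<le> Re z \<and> Re z \<le> 0 \<and> \<bar>Im z\<bar> = R) \<or> (Re z = -b \<and> \<bar>Im z\<bar> \<le> R)}"
  using assms unfolding bracket_def closed_segment_Re closed_segment_Im
  by (auto simp: closed_segment_eq_real_ivl abs_le_iff split: if_splits)

lemma bracket_integrable:
  assumes "continuous_on (bracket R b) f"
  shows "f contour_integrable_on (linepath (Complex 0 (-R)) (Complex b (-R)))"
    and "f contour_integrable_on (linepath (Complex b (-R)) (Complex b R))"
    and "f contour_integrable_on (linepath (Complex b R) (Complex 0 R))"
  using assms by (auto intro!: contour_integrable_continuous_linepath elim!: continuous_on_subset simp: bracket_def)

lemma bracket_integral_diff:
  assumes "continuous_on (bracket R b) f" "continuous_on (bracket R b) g"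
  shows "bracket_integral R b (\<lambda>z. f z - g z) = bracket_integral R b f - bracket_integral R b g"
  using bracket_integrable[OF assms(1)] bracket_integrable[OF assms(2)]
  by (simp add: bracket_integral_def contour_integral_diff)

text \<open>The sides get separate bounds because the bracket at \<open>-\<eta>\<close> is small for
  two different reasons: the polynomial factor of the kernel on the horizontal sides, the
  exponential on the vertical one.\<close>

lemma bracket_integral_bound:
  assumes f: "continuous_on (bracket R b) f" and R: "R \<ge> 0"
    and M1: "\<And>z. z \<in> bracket R b \<Longrightarrow> \<bar>Im z\<bar> = R \<Longrightarrow> norm (f z) \<le> M1" "M1 \<ge> 0"
    and M2: "\<And>z. z \<in> bracket R b \<Longrightarrow> Re z = b \<Longrightarrow> norm (f z) \<le> M2" "M2 \<ge> 0"
  shows "norm (bracket_integral R b f) \<le> 2 * M1 * \<bar>b\<bar> + M2 * (2 * R)"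
proof -
  have n1: "norm (Complex b (-R) - Complex 0 (-R)) = \<bar>b\<bar>" "norm (Complex 0 R - Complex b R) = \<bar>b\<bar>"
    by (simp_all add: cmod_def)
  have n2: "norm (Complex b R - Complex b (-R)) = 2 * R"
    using R real_sqrt_abs[of "2 * R"] by (simp add: cmod_def)
  have 1: "norm (contour_integral (linepath (Complex 0 (-R)) (Complex b (-R))) f) \<le> M1 * \<bar>b\<bar>"
    unfolding n1(1)[symmetric]
    by (intro contour_integral_bound_linepath bracket_integrable[OF f] M1) (use R in \<open>auto simp: bracket_def closed_segment_Re\<close>)
  have 2: "norm (contour_integral (linepath (Complex b R) (Complex 0 R)) f) \<le> M1 * \<bar>b\<bar>"
    unfolding n1(2)[symmetric]
    by (intro contour_integral_bound_linepath bracket_integrable[OF f] M1) (use R in \<open>auto simp: bracket_def closed_segment_Re\<close>)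
  have 3: "norm (contour_integral (linepath (Complex b (-R)) (Complex b R)) f) \<le> M2 * (2 * R)"
    unfolding n2[symmetric]
    by (intro contour_integral_bound_linepath bracket_integrable[OF f] M2) (use R in \<open>auto simp: bracket_def closed_segment_Im\<close>)
  have "norm (x + y + w) \<le> norm x + norm y + norm w" for x y w :: complex
    using norm_triangle_ineq[of "x + y" w] norm_triangle_ineq[of x y] by linarith
  from order_trans[OF this add_mono[OF add_mono[OF 1 3] 2]] show ?thesis
    unfolding bracket_integral_def by simp
qed

lemma contour_integral_rectpath_bracket:
  assumes f: "continuous_on (bracket R b \<union> bracket R a) f" and ab: "a < 0" "0 < b"
  shows "contour_integral (rectpath (Complex a (-R)) (Complex b R)) f = bracket_integral R b f - bracket_integral R a f"
proof -
  have f1: "continuous_on (bracket R b) f" and f2: "continuous_on (bracket R a) f"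
    using f by (auto elim: continuous_on_subset)
  note int = bracket_integrable[OF f1] bracket_integrable[OF f2]
  have seg: "closed_segment (Complex a t) (Complex b t) \<subseteq> closed_segment (Complex 0 t) (Complex b t) \<union> closed_segment (Complex 0 t) (Complex a t)" for t
    using ab by (auto simp: closed_segment_Re closed_segment_eq_real_ivl)
  have c1: "continuous_on (closed_segment (Complex a (-R)) (Complex b (-R))) f"
    by (rule continuous_on_subset[OF f], rule subset_trans[OF seg]) (auto simp: bracket_def closed_segment_commute)
  have c2: "continuous_on (closed_segment (Complex b R) (Complex a R)) f"
    unfolding closed_segment_commute[of "Complex b R"]
    by (rule continuous_on_subset[OF f], rule subset_trans[OF seg]) (auto simp: bracket_def closed_segment_commute)
  have c3: "continuous_on (closed_segment (Complex a R) (Complex a (-R))) f"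
    by (rule continuous_on_subset[OF f]) (auto simp: bracket_def closed_segment_commute)
  have c4: "continuous_on (closed_segment (Complex b (-R)) (Complex b R)) f"
    by (rule continuous_on_subset[OF f]) (auto simp: bracket_def)
  have s1: "contour_integral (linepath (Complex a (-R)) (Complex b (-R))) f =
       contour_integral (linepath (Complex a (-R)) (Complex 0 (-R))) f + contour_integral (linepath (Complex 0 (-R)) (Complex b (-R))) f"
    by (rule contour_integral_split_linepath[OF c1]) (use ab in \<open>auto simp: closed_segment_Re closed_segment_eq_real_ivl\<close>)
  have s2: "contour_integral (linepath (Complex b R) (Complex a R)) f =
       contour_integral (linepath (Complex b R) (Complex 0 R)) f + contour_integral (linepath (Complex 0 R) (Complex a R)) f"
    by (rule contour_integral_split_linepath[OF c2]) (use ab in \<open>auto simp: closed_segment_Re closed_segment_eq_real_ivl\<close>)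
  have rev: "contour_integral (linepath y x) f = - contour_integral (linepath x y) f" 
    if "continuous_on (closed_segment x y) f" for x y
    using contour_integral_reverse_linepath[OF that] by simp
  have r1: "contour_integral (linepath (Complex a (-R)) (Complex 0 (-R))) f = - contour_integral (linepath (Complex 0 (-R)) (Complex a (-R))) f"
    by (rule rev, rule continuous_on_subset[OF f2]) (auto simp: bracket_def)
  have r2: "contour_integral (linepath (Complex a R) (Complex a (-R))) f = - contour_integral (linepath (Complex a (-R)) (Complex a R)) f"
    by (rule rev, rule continuous_on_subset[OF f2]) (auto simp: bracket_def)
  have r3: "contour_integral (linepath (Complex 0 R) (Complex a R)) f = - contour_integral (linepath (Complex a R) (Complex 0 R)) f"
    by (rule rev, rule continuous_on_subset[OF f2]) (auto simp: bracket_def)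
  have "contour_integral (rectpath (Complex a (-R)) (Complex b R)) f =
      contour_integral (linepath (Complex a (-R)) (Complex b (-R))) f + (contour_integral (linepath (Complex b (-R)) (Complex b R)) f +
      (contour_integral (linepath (Complex b R) (Complex a R)) f + contour_integral (linepath (Complex a R) (Complex a (-R))) f))"
    unfolding rectpath_def Let_def using c1 c2 c3 c4
    by (simp add: contour_integrable_continuous_linepath)
  thus ?thesis unfolding bracket_integral_def s1 s2 r1 r2 r3 by simp
qed

text \<open>Neither bracket contains the chord along the imaginary axis that they share, so the pole
  at \<open>0\<close> lies on no path although it is inside the rectangle they form.\<close>

lemma cauchy_rect_bracket:
  assumes hol: "f holomorphic_on S" and S: "convex S" "open S" and ab: "a < 0" "0 < b" and R: "R > 0"
    and sub: "cbox (Complex a (-R)) (Complex b R) \<subseteq> S"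
  shows "bracket_integral R b (\<lambda>z. f z / z) - bracket_integral R a (\<lambda>z. f z / z) = 2 * pi * \<i> * f 0"
    and "continuous_on (bracket R b) (\<lambda>z. f z / z)"
    and "continuous_on (bracket R a) (\<lambda>z. f z / z)"
proof -
  have br: "bracket R b \<union> bracket R a \<subseteq> S - {0}"
  proof -
    have "bracket R a = {z. (a \<le> Re z \<and> Re z \<le> 0 \<and> \<bar>Im z\<bar> = R) \<or> (Re z = a \<and> \<bar>Im z\<bar> \<le> R)}"
      using bracket_neg[of R "-a"] ab R by simp
    moreover have "bracket R b = {z. (0 \<le> Re z \<and> Re z \<le> b \<and> \<bar>Im z\<bar> = R) \<or> (Re z = b \<and> \<bar>Im z\<bar> \<le> R)}"
      using bracket_pos[of R b] ab R by simp
    ultimately have "bracket R b \<union> bracket R a \<subseteq> cbox (Complex a (-R)) (Complex b R) - {0}"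
      using ab R by (auto simp: in_cbox_complex_iff abs_le_iff)
    thus ?thesis using sub by blast
  qed
  have cont: "continuous_on (S - {0}) (\<lambda>z. f z / z)"
    using holomorphic_on_imp_continuous_on[OF hol] by (auto intro!: continuous_intros elim: continuous_on_subset)
  show "continuous_on (bracket R b) (\<lambda>z. f z / z)" "continuous_on (bracket R a) (\<lambda>z. f z / z)"
    using br by (auto intro: continuous_on_subset[OF cont])
  have 0: "0 \<in> box (Complex a (-R)) (Complex b R)"
    using ab R by (auto simp: in_box_complex_iff)
  have "((\<lambda>w. f w / (w - 0)) has_contour_integral (2*pi * \<i> * winding_number (rectpath (Complex a (-R)) (Complex b R)) 0 * f 0)) 
      (rectpath (Complex a (-R)) (Complex b R))"
  proof (rule Cauchy_integral_formula_convex_simple[OF S(1) hol])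
    show "0 \<in> interior S" using 0 box_subset_cbox sub S by (force simp: interior_open)
    show "path_image (rectpath (Complex a (-R)) (Complex b R)) \<subseteq> S - {0}"
      using sub 0 ab R by (subst path_image_rectpath_cbox_minus_box) auto
  qed auto
  moreover have "winding_number (rectpath (Complex a (-R)) (Complex b R)) 0 = 1"
    using 0 by (rule winding_number_rectpath)
  ultimately have "contour_integral (rectpath (Complex a (-R)) (Complex b R)) (\<lambda>w. f w / w) = 2 * pi * \<i> * f 0"
    by (simp add: contour_integral_unique)
  thus "bracket_integral R b (\<lambda>z. f z / z) - bracket_integral R a (\<lambda>z. f z / z) = 2 * pi * \<i> * f 0"
    using contour_integral_rectpath_bracket[OF continuous_on_subset[OF cont br] ab] by simp
qed

text \<open>The factor \<open>1 + z^2/R^2\<close> vanishes at \<open>\<plusminus>iR\<close>, which compensates the blow-up \<open>1/|Re z|\<close> of the bounds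
  for the truncated and the remaining Laplace integral near the imaginary axis.\<close>

definition newman_kernel :: "real \<Rightarrow> real \<Rightarrow> complex \<Rightarrow> complex" where
  "newman_kernel X R z = exp (of_real X * z) * (1 + z\<^sup>2 / of_real R ^ 2)"

lemma newman_kernel_bound:
  assumes R: "R > 0"
  shows "\<bar>Im z\<bar> = R \<Longrightarrow> \<bar>Re z\<bar> \<le> R \<Longrightarrow> norm (newman_kernel X R z) \<le> exp (X * Re z) * (3 * \<bar>Re z\<bar> / R)"
    and "\<bar>Im z\<bar> \<le> R \<Longrightarrow> \<bar>Re z\<bar> \<le> R \<Longrightarrow> norm (newman_kernel X R z) \<le> exp (X * Re z) * 3"
proof -
  have n: "norm (newman_kernel X R z) = exp (X * Re z) * norm (1 + z\<^sup>2 / of_real R ^ 2)"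
    by (simp add: newman_kernel_def norm_mult)
  show "norm (newman_kernel X R z) \<le> exp (X * Re z) * (3 * \<bar>Re z\<bar> / R)" if z: "\<bar>Im z\<bar> = R" "\<bar>Re z\<bar> \<le> R"
  proof -
    have "(Im z)\<^sup>2 = R\<^sup>2" using z by (metis power2_abs)
    \<comment> \<open>For \<open>z = x + iy\<close> with \<open>y^2 = R^2\<close> one has
      \<open>R^2 + z^2 = x (x + 2iy)\<close>; the factor \<open>x\<close> is the gain near the
      corners \<open>iR\<close> and \<open>-iR\<close>.\<close>
    hence e: "1 + z\<^sup>2 / of_real R ^ 2 = of_real (Re z) * Complex (Re z) (2 * Im z) / of_real (R\<^sup>2)"
      using R by (simp add: complex_eq_iff power2_eq_square field_simps Re_divide Im_divide)
    have nn: "norm (1 + z\<^sup>2 / of_real R ^ 2) = \<bar>Re z\<bar> * norm (Complex (Re z) (2 * Im z)) / \<bar>R\<^sup>2\<bar>"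
      unfolding e norm_divide norm_mult norm_of_real ..
    have "norm (Complex (Re z) (2 * Im z)) \<le> \<bar>Re z\<bar> + \<bar>2 * Im z\<bar>"
      using cmod_le[of "Complex (Re z) (2 * Im z)"] unfolding complex.sel .
    hence "norm (Complex (Re z) (2 * Im z)) \<le> 3 * R" using z by linarith
    hence "\<bar>Re z\<bar> * norm (Complex (Re z) (2 * Im z)) / \<bar>R\<^sup>2\<bar> \<le> \<bar>Re z\<bar> * (3 * R) / \<bar>R\<^sup>2\<bar>"
      by (intro divide_right_mono mult_left_mono) auto
    also have "\<dots> = 3 * \<bar>Re z\<bar> / R" using R by (simp add: power2_eq_square)
    finally have "norm (1 + z\<^sup>2 / of_real R ^ 2) \<le> 3 * \<bar>Re z\<bar> / R" unfolding nn .
    thus ?thesis unfolding n by (intro mult_left_mono) auto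
  qed
  show "norm (newman_kernel X R z) \<le> exp (X * Re z) * 3" if z: "\<bar>Im z\<bar> \<le> R" "\<bar>Re z\<bar> \<le> R"
  proof -
    have "(norm z)\<^sup>2 = (Re z)\<^sup>2 + (Im z)\<^sup>2" by (simp add: cmod_power2)
    also have "\<dots> \<le> R\<^sup>2 + R\<^sup>2" using z R by (intro add_mono) (metis abs_le_square_iff abs_of_pos)+
    finally have "norm (z\<^sup>2 / of_real R ^ 2) \<le> 2" using R by (simp add: norm_divide norm_power divide_le_eq)
    hence "norm (1 + z\<^sup>2 / of_real R ^ 2) \<le> 3" using norm_triangle_ineq[of 1 "z\<^sup>2 / of_real R ^ 2"] by simp
    thus ?thesis unfolding n by (intro mult_left_mono) auto
  qed
qed

text \<open>The exponential of the kernel cancels the one in the bound for \<open>f\<close>, and its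
  factor \<open>|Re z| / R\<close> cancels \<open>1 / |Re z|\<close>; on a vertical side that factor
  is \<open>1\<close>. At points with \<open>Re z = 0\<close>, where nothing is assumed about
  \<open>f\<close>, the kernel vanishes.\<close>

lemma norm_newman_quotient_bound:
  assumes R: "R > 0" and z: "\<bar>Re z\<bar> \<le> R" "\<bar>Im z\<bar> \<le> R" "\<bar>Im z\<bar> = R \<or> \<bar>Re z\<bar> = R"
    and f: "Re z \<noteq> 0 \<Longrightarrow> norm (f z) \<le> B * exp (- Re z * X) / \<bar>Re z\<bar>" and B: "B \<ge> 0"
  shows "norm (f z * newman_kernel X R z / z) \<le> 3 * B / R\<^sup>2"
proof -
  have zR: "norm z \<ge> R" using z abs_Im_le_cmod[of z] abs_Re_le_cmod[of z] by auto
  have *: "norm (f z * newman_kernel X R z) \<le> 3 * B / R"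
  proof (cases "Re z = 0")
    case True
    hence "\<bar>Im z\<bar> = R" using z R by auto
    hence "norm (newman_kernel X R z) \<le> 0" using newman_kernel_bound(1)[OF R, of z X] True R by simp
    thus ?thesis using B R by simp
  next
    case False
    have e: "B * exp (- Re z * X) / \<bar>Re z\<bar> * (exp (X * Re z) * c) = B * c / \<bar>Re z\<bar>" for c
    proof -
      have "exp (- Re z * X) * exp (X * Re z) = 1" by (simp flip: exp_add)
      thus ?thesis by (simp add: mult_ac)
    qed
    have "norm (newman_kernel X R z) \<le> exp (X * Re z) * (3 * \<bar>Re z\<bar> / R)"
    proof (cases "\<bar>Im z\<bar> = R")
      case True thus ?thesis using newman_kernel_bound(1)[OF R] z by blast
    next
      case False
      thus ?thesis using newman_kernel_bound(2)[OF R z(2,1), of X] z(3) R by simp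
    qed
    hence "norm (f z * newman_kernel X R z) \<le> B * exp (- Re z * X) / \<bar>Re z\<bar> * (exp (X * Re z) * (3 * \<bar>Re z\<bar> / R))"
      unfolding norm_mult using f[OF False] B by (intro mult_mono) auto
    also have "\<dots> = 3 * B / R" unfolding e using False by simp
    finally show ?thesis .
  qed
  have "norm (f z * newman_kernel X R z / z) = norm (f z * newman_kernel X R z) / norm z" by (simp add: norm_divide)
  also have "\<dots> \<le> (3 * B / R) / R" using * zR R B by (intro frac_le) auto
  finally show ?thesis by (simp add: power2_eq_square)
qed

text \<open>Cauchy's formula is used on different rectangles for the two functions: \<open>h\<close>
  is entire and its left side can be pushed to \<open>-R\<close>, while \<open>g\<close> is
  available only down to \<open>-\<eta>\<close>. The right bracket of \<open>g - h\<close> and the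
  left bracket of \<open>h\<close> contribute \<open>12 B / R\<close> each; the left bracket of
  \<open>g\<close> gives the two terms with \<open>M\<close>.\<close>

lemma newman_contour_bound:
  assumes R: "R > 0" and \<eta>: "0 < \<eta>" "\<eta> \<le> R" "\<eta> < \<eta>'" and R': "R < R'" and X: "X \<ge> 0"
    and h: "h holomorphic_on UNIV"
    and g: "g holomorphic_on {z. Re z > -\<eta>' \<and> \<bar>Im z\<bar> < R'}"
    and b1: "\<And>z. Re z > 0 \<Longrightarrow> \<bar>Im z\<bar> < R' \<Longrightarrow> norm (g z - h z) \<le> B * exp (- Re z * X) / Re z"
    and b2: "\<And>z. Re z < 0 \<Longrightarrow> norm (h z) \<le> B * exp (- Re z * X) / (- Re z)"
    and b3: "\<And>z. -\<eta> \<le> Re z \<Longrightarrow> Re z \<le> 0 \<Longrightarrow> \<bar>Im z\<bar> \<le> R \<Longrightarrow> Re z = -\<eta> \<or> \<bar>Im z\<bar> = R \<Longrightarrow> norm (g z) \<le> M"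
    and B: "B \<ge> 0"
  shows "norm (g 0 - h 0) \<le> 24 * B / R + 6 * M * \<eta>\<^sup>2 / R\<^sup>2 + 6 * M * R * exp (- \<eta> * X) / \<eta>"
proof -
  define K where "K = newman_kernel X R"
  have "norm (g (-of_real \<eta>)) \<le> M" using \<eta> R by (intro b3) auto
  hence M: "M \<ge> 0" by (rule order_trans[OF norm_ge_zero])
  have K0: "K 0 = 1" by (simp add: K_def newman_kernel_def)
  have K_hol: "K holomorphic_on A" for A unfolding K_def newman_kernel_def using R by (intro holomorphic_intros) auto
  define U where "U = {z. Re z > -\<eta>' \<and> \<bar>Im z\<bar> < R'}"
  have U_eq: "U = {z. Re z > -\<eta>'} \<inter> {z. Im z < R'} \<inter> {z. Im z > -R'}" by (auto simp: U_def)
  have U: "convex U" "open U"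
    unfolding U_eq by (intro open_Int convex_Int open_halfspace_Re_gt open_halfspace_Im_gt open_halfspace_Im_lt
           convex_halfspace_Re_gt convex_halfspace_Im_gt convex_halfspace_Im_lt)+
  have g': "(\<lambda>z. g z * K z) holomorphic_on U" unfolding U_def by (intro holomorphic_intros g K_hol)
  have h': "(\<lambda>z. h z * K z) holomorphic_on UNIV" by (intro holomorphic_intros h K_hol)
  have sub: "cbox (Complex (-\<eta>) (-R)) (Complex R R) \<subseteq> U"
    using \<eta> R' by (auto simp: U_def in_cbox_complex_iff)
  have neg: "-\<eta> < 0" "-R < 0" using \<eta> R by auto
  note cg = cauchy_rect_bracket[OF g' U neg(1) R R sub, unfolded K0]
  note ch = cauchy_rect_bracket[OF h' convex_UNIV open_UNIV neg(2) R R subset_UNIV, unfolded K0]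
  define G where "G = (\<lambda>z. g z * K z / z)"
  define H where "H = (\<lambda>z. h z * K z / z)"
  have "2 * pi * \<i> * (g 0 - h 0) = (bracket_integral R R G - bracket_integral R R H) - bracket_integral R (-\<eta>) G + bracket_integral R (-R) H"
    using cg(1) ch(1) unfolding G_def H_def by (simp add: algebra_simps)
  also have "bracket_integral R R G - bracket_integral R R H = bracket_integral R R (\<lambda>z. G z - H z)"
    using cg(2) ch(2) unfolding G_def H_def by (intro bracket_integral_diff[symmetric])
  finally have eq: "2 * pi * \<i> * (g 0 - h 0) = bracket_integral R R (\<lambda>z. G z - H z) - bracket_integral R (-\<eta>) G + bracket_integral R (-R) H" .
  have B1: "norm (bracket_integral R R (\<lambda>z. G z - H z)) \<le> 2 * (3 * B / R\<^sup>2) * \<bar>R\<bar> + 3 * B / R\<^sup>2 * (2 * R)"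
  proof (rule bracket_integral_bound)
    show "continuous_on (bracket R R) (\<lambda>z. G z - H z)" 
      using cg(2) ch(2) unfolding G_def H_def by (intro continuous_on_diff)
    have *: "norm (G z - H z) \<le> 3 * B / R\<^sup>2" if "z \<in> bracket R R" for z
    proof -
      have "(0 \<le> Re z \<and> Re z \<le> R \<and> \<bar>Im z\<bar> = R) \<or> (Re z = R \<and> \<bar>Im z\<bar> \<le> R)"
        using that bracket_pos[of R R] R by simp
      hence z: "0 \<le> Re z" "\<bar>Re z\<bar> \<le> R" "\<bar>Im z\<bar> \<le> R" "\<bar>Im z\<bar> = R \<or> \<bar>Re z\<bar> = R"
        using R by linarith+
      have "G z - H z = (g z - h z) * K z / z" by (simp only: G_def H_def diff_divide_distrib left_diff_distrib)
      also have "norm \<dots> \<le> 3 * B / R\<^sup>2" unfolding K_def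
        by (rule norm_newman_quotient_bound[where f = "\<lambda>z. g z - h z", OF R z(2-4) _ B]) (use b1[of z] z R' in auto)
      finally show ?thesis .
    qed
    show "norm (G z - H z) \<le> 3 * B / R\<^sup>2" if "z \<in> bracket R R" for z by (rule *[OF that])
    show "norm (G z - H z) \<le> 3 * B / R\<^sup>2" if "z \<in> bracket R R" for z by (rule *[OF that])
  qed (use R B in auto)
  have B2: "norm (bracket_integral R (-R) H) \<le> 2 * (3 * B / R\<^sup>2) * \<bar>-R\<bar> + 3 * B / R\<^sup>2 * (2 * R)"
  proof (rule bracket_integral_bound)
    show "continuous_on (bracket R (-R)) H" using ch(3) unfolding H_def .
    have *: "norm (H z) \<le> 3 * B / R\<^sup>2" if "z \<in> bracket R (-R)" for z
    proof -
      have "(-R \<le> Re z \<and> Re z \<le> 0 \<and> \<bar>Im z\<bar> = R) \<or> (Re z = -R \<and> \<bar>Im z\<bar> \<le> R)"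
        using that bracket_neg[of R R] R by simp
      hence z: "Re z \<le> 0" "\<bar>Re z\<bar> \<le> R" "\<bar>Im z\<bar> \<le> R" "\<bar>Im z\<bar> = R \<or> \<bar>Re z\<bar> = R"
        using R by linarith+
      show ?thesis unfolding H_def K_def
        by (rule norm_newman_quotient_bound[OF R z(2-4) _ B]) (use b2[of z] z in auto)
    qed
    show "norm (H z) \<le> 3 * B / R\<^sup>2" if "z \<in> bracket R (-R)" for z by (rule *[OF that])
    show "norm (H z) \<le> 3 * B / R\<^sup>2" if "z \<in> bracket R (-R)" for z by (rule *[OF that])
  qed (use R B in auto)
  have B3: "norm (bracket_integral R (-\<eta>) G) \<le> 2 * (3 * M * \<eta> / R\<^sup>2) * \<bar>-\<eta>\<bar> + (3 * M * exp (- \<eta> * X) / \<eta>) * (2 * R)"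
  proof (rule bracket_integral_bound)
    show "continuous_on (bracket R (-\<eta>)) G" using cg(3) unfolding G_def .
    show "norm (G z) \<le> 3 * M * \<eta> / R\<^sup>2" if "z \<in> bracket R (-\<eta>)" "\<bar>Im z\<bar> = R" for z
    proof -
      have "(-\<eta> \<le> Re z \<and> Re z \<le> 0 \<and> \<bar>Im z\<bar> = R) \<or> (Re z = -\<eta> \<and> \<bar>Im z\<bar> \<le> R)"
        using that bracket_neg[of R \<eta>] R \<eta> by simp
      hence z: "-\<eta> \<le> Re z" "Re z \<le> 0" "\<bar>Re z\<bar> \<le> R" using \<eta> by linarith+
      have "norm (K z) \<le> exp (X * Re z) * (3 * \<bar>Re z\<bar> / R)" unfolding K_def
        using newman_kernel_bound(1)[OF R that(2) z(3)] .
      also have "\<dots> \<le> 1 * (3 * \<eta> / R)"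
      proof (rule mult_mono)
        show "exp (X * Re z) \<le> 1" using z X by (simp add: mult_nonneg_nonpos)
        show "3 * \<bar>Re z\<bar> / R \<le> 3 * \<eta> / R" using z R by (intro divide_right_mono) auto
        show "0 \<le> 3 * \<bar>Re z\<bar> / R" by (rule divide_nonneg_pos[OF _ R]) simp
      qed simp
      finally have Kz: "norm (K z) \<le> 3 * \<eta> / R" by simp
      have "norm (G z) = norm (g z) * norm (K z) / norm z" by (simp add: G_def norm_mult norm_divide)
      also have "\<dots> \<le> M * (3 * \<eta> / R) / R"
        using Kz b3[of z] z that M R \<eta> abs_Im_le_cmod[of z] by (intro frac_le mult_mono) auto
      finally show ?thesis by (simp add: power2_eq_square mult_ac)
    qed
    show "norm (G z) \<le> 3 * M * exp (- \<eta> * X) / \<eta>" if "z \<in> bracket R (-\<eta>)" "Re z = -\<eta>" for z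
    proof -
      have "(-\<eta> \<le> Re z \<and> Re z \<le> 0 \<and> \<bar>Im z\<bar> = R) \<or> (Re z = -\<eta> \<and> \<bar>Im z\<bar> \<le> R)"
        using that bracket_neg[of R \<eta>] R \<eta> by simp
      hence z: "\<bar>Im z\<bar> \<le> R" "\<bar>Re z\<bar> \<le> R" using \<eta> by linarith+
      have Kz: "norm (K z) \<le> exp (- \<eta> * X) * 3" unfolding K_def
        using newman_kernel_bound(2)[OF R z, of X] that by (simp add: mult.commute)
      have "norm (G z) = norm (g z) * norm (K z) / norm z" by (simp add: G_def norm_mult norm_divide)
      also have "\<dots> \<le> M * (exp (- \<eta> * X) * 3) / \<eta>"
        using Kz b3[of z] z that M R \<eta> abs_Re_le_cmod[of z] by (intro frac_le mult_mono) auto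
      finally show ?thesis by (simp add: mult_ac)
    qed
  qed (use R M \<eta> in auto)
  have "norm (g 0 - h 0) \<le> 2 * pi * norm (g 0 - h 0)"
    using pi_gt3 mult_right_mono[of 1 "2 * pi" "norm (g 0 - h 0)"] by simp
  also have "\<dots> = norm (2 * pi * \<i> * (g 0 - h 0))" by (simp add: norm_mult)
  also have "\<dots> \<le> norm (bracket_integral R R (\<lambda>z. G z - H z)) + norm (bracket_integral R (-\<eta>) G) + norm (bracket_integral R (-R) H)"
  proof -
    have "norm (x - y + w) \<le> norm x + norm y + norm w" for x y w :: complex
      using norm_triangle_ineq[of "x - y" w] norm_triangle_ineq4[of x y] by linarith
    thus ?thesis unfolding eq .
  qed
  also have "\<dots> \<le> (12 * B / R) + (6 * M * \<eta>\<^sup>2 / R\<^sup>2 + 6 * M * R * exp (- \<eta> * X) / \<eta>) + (12 * B / R)"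
  proof (intro add_mono)
    show "norm (bracket_integral R R (\<lambda>z. G z - H z)) \<le> 12 * B / R"
      using B1 R by (simp add: power2_eq_square)
    show "norm (bracket_integral R (-R) H) \<le> 12 * B / R"
      using B2 R by (simp add: power2_eq_square)
    show "norm (bracket_integral R (-\<eta>) G) \<le> 6 * M * \<eta>\<^sup>2 / R\<^sup>2 + 6 * M * R * exp (- \<eta> * X) / \<eta>"
      using B3 \<eta> by (simp add: power2_eq_square mult_ac)
  qed
  finally show ?thesis by simp
qed

section \<open>Laplace transforms\<close>

definition laplace_trunc :: "(real \<Rightarrow> real) \<Rightarrow> real \<Rightarrow> complex \<Rightarrow> complex" where
  "laplace_trunc D X z = integral {0..X} (\<lambda>u. of_real (D u) * exp (- z * of_real u))"

definition laplace :: "(real \<Rightarrow> real) \<Rightarrow> complex \<Rightarrow> complex" where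
  "laplace D z = integral {0..} (\<lambda>u. of_real (D u) * exp (- z * of_real u))"

lemma laplace_integrand_measurable:
  assumes "D \<in> borel_measurable borel"
  shows "(\<lambda>u. of_real (D u) * exp (- z * of_real u) :: complex) \<in> borel_measurable (lebesgue_on A)"
proof -
  have "(\<lambda>u. of_real (D u) * exp (- z * of_real u) :: complex) \<in> borel_measurable borel"
    using assms by measurable
  thus ?thesis by (intro measurable_restrict_space1 measurable_completion) simp
qed

lemma norm_exp_mult_of_real: "norm (exp (- z * of_real u) :: complex) = exp (- Re z * u)"
  by simp

lemma laplace_integrable:
  assumes D: "D \<in> borel_measurable borel" and B: "\<And>u. u \<ge> 0 \<Longrightarrow> \<bar>D u\<bar> \<le> B" and z: "Re z > 0" and a: "a \<ge> 0"
  shows "(\<lambda>u. of_real (D u) * exp (- z * of_real u) :: complex) integrable_on {a..}"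
    and "norm (integral {a..} (\<lambda>u. of_real (D u) * exp (- z * of_real u) :: complex)) \<le> B * exp (- Re z * a) / Re z"
proof -
  have I: "((\<lambda>u. B * exp (- Re z * u)) has_integral (B * (exp (- Re z * a) / Re z))) {a..}"
    by (intro has_integral_mult_right has_integral_exp_minus_to_infinity z)
  have le: "norm (of_real (D u) * exp (- z * of_real u) :: complex) \<le> B * exp (- Re z * u)" if "u \<in> {a..}" for u
    unfolding norm_mult norm_exp_mult_of_real norm_of_real using that a B by (intro mult_right_mono) auto
  show "(\<lambda>u. of_real (D u) * exp (- z * of_real u) :: complex) integrable_on {a..}"
    by (rule measurable_bounded_by_integrable_imp_integrable[OF laplace_integrand_measurable[OF D] has_integral_integrable[OF I] le]) auto
  show "norm (integral {a..} (\<lambda>u. of_real (D u) * exp (- z * of_real u) :: complex)) \<le> B * exp (- Re z * a) / Re z"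
    using integral_norm_bound_integral'[OF le laplace_integrand_measurable[OF D] _ I] by simp
qed

lemma laplace_trunc_integrable:
  assumes D: "D \<in> borel_measurable borel" and B: "\<And>u. u \<ge> 0 \<Longrightarrow> \<bar>D u\<bar> \<le> B"
  shows "(\<lambda>u. of_real (D u) * exp (- z * of_real u) :: complex) integrable_on {0..X}"
proof (rule measurable_bounded_by_integrable_imp_integrable[OF laplace_integrand_measurable[OF D]])
  show "(\<lambda>u. B * exp (- Re z * u)) integrable_on {0..X}"
    by (intro integrable_continuous_interval continuous_intros)
  show "norm (of_real (D u) * exp (- z * of_real u) :: complex) \<le> B * exp (- Re z * u)" if "u \<in> {0..X}" for u
    unfolding norm_mult norm_exp_mult_of_real norm_of_real using that B by (intro mult_right_mono) auto
qed auto

lemma laplace_minus_trunc_bound: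
  assumes D: "D \<in> borel_measurable borel" and B: "\<And>u. u \<ge> 0 \<Longrightarrow> \<bar>D u\<bar> \<le> B" and z: "Re z > 0" and X: "X \<ge> 0"
  shows "norm (laplace D z - laplace_trunc D X z) \<le> B * exp (- Re z * X) / Re z"
proof -
  have "((\<lambda>u. of_real (D u) * exp (- z * of_real u)) has_integral (laplace_trunc D X z + 
          integral {X..} (\<lambda>u. of_real (D u) * exp (- z * of_real u)))) ({0..X} \<union> {X..})"
    unfolding laplace_trunc_def
  proof (intro has_integral_Un integrable_integral laplace_trunc_integrable[OF D B] laplace_integrable(1)[OF D B z X])
    have "{0..X} \<inter> {X..} = {X}" using X by auto
    thus "negligible ({0..X} \<inter> {X..})" by simp
  qed
  moreover have "{0..X} \<union> {X..} = {0..}" using X by auto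
  ultimately have "((\<lambda>u. of_real (D u) * exp (- z * of_real u)) has_integral (laplace_trunc D X z + 
          integral {X..} (\<lambda>u. of_real (D u) * exp (- z * of_real u)))) {0..}" by (simp only:)
  from integral_unique[OF this]
  have "laplace D z = laplace_trunc D X z + integral {X..} (\<lambda>u. of_real (D u) * exp (- z * of_real u))"
    unfolding laplace_def .
  thus ?thesis using laplace_integrable(2)[OF D B z X] by simp
qed

lemma laplace_trunc_bound_left:
  assumes D: "D \<in> borel_measurable borel" and B: "\<And>u. u \<ge> 0 \<Longrightarrow> \<bar>D u\<bar> \<le> B" and z: "Re z < 0" and X: "X \<ge> 0"
  shows "norm (laplace_trunc D X z) \<le> B * exp (- Re z * X) / (- Re z)"
proof -
  have B0: "B \<ge> 0" using B[of 0] by simp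
  have I: "((\<lambda>u. B * exp (- Re z * u)) has_integral 
        (B * exp (- Re z * X) / (- Re z) - B * exp (- Re z * 0) / (- Re z))) {0..X}"
    using X z by (intro fundamental_theorem_of_calculus)
      (auto intro!: derivative_eq_intros simp flip: has_real_derivative_iff_has_vector_derivative)
  have "norm (laplace_trunc D X z) \<le> B * exp (- Re z * X) / (- Re z) - B * exp (- Re z * 0) / (- Re z)"
    unfolding laplace_trunc_def
  proof (rule integral_norm_bound_integral'[OF _ laplace_integrand_measurable[OF D] _ I])
    show "norm (of_real (D u) * exp (- z * of_real u) :: complex) \<le> B * exp (- Re z * u)" if "u \<in> {0..X}" for u
      unfolding norm_mult norm_exp_mult_of_real norm_of_real using that B by (intro mult_right_mono) auto
  qed auto
  also have "\<dots> \<le> B * exp (- Re z * X) / (- Re z)" using B0 z by (simp add: divide_nonneg_neg divide_nonneg_pos)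
  finally show ?thesis .
qed

text \<open>As \<open>D\<close> is only measurable, the integrand need not be continuous in
  \<open>u\<close>. Therefore \<open>exp (- z u)\<close> is expanded and integrated term by term
  over the bounded interval, which gives a power series in \<open>z\<close>, with moments of
  \<open>D\<close> as coefficients, that converges everywhere.\<close>

lemma laplace_trunc_holomorphic:
  assumes D: "D \<in> borel_measurable borel" and B: "\<And>u. u \<ge> 0 \<Longrightarrow> \<bar>D u\<bar> \<le> B" and X: "X \<ge> 0"
  shows "laplace_trunc D X holomorphic_on UNIV"
proof -
  define c where "c = (\<lambda>k. integral {0..X} (\<lambda>u. of_real (D u) * ((- of_real u) ^ k / fact k) :: complex))"
  have B0: "B \<ge> 0" using B[of 0] by simp
  have meas: "(\<lambda>u. of_real (D u) * p (complex_of_real u)) \<in> borel_measurable (lebesgue_on A)"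
    if "continuous_on UNIV p" for p :: "complex \<Rightarrow> complex" and A
  proof -
    have "p \<in> borel_measurable borel" using that by (rule borel_measurable_continuous_onI)
    hence "(\<lambda>u. of_real (D u) * p (complex_of_real u)) \<in> borel_measurable borel"
      using D by measurable
    thus ?thesis by (intro measurable_restrict_space1 measurable_completion) simp
  qed
  have int: "(\<lambda>u. of_real (D u) * p (complex_of_real u)) integrable_on {0..X}"
    if p: "continuous_on UNIV p" for p :: "complex \<Rightarrow> complex"
  proof (rule measurable_bounded_by_integrable_imp_integrable[OF meas[OF p]])
    show "(\<lambda>u. B * norm (p (complex_of_real u))) integrable_on {0..X}"
      by (intro integrable_continuous_interval continuous_intros continuous_on_compose2[OF p]) auto
    show "norm (of_real (D u) * p (complex_of_real u)) \<le> B * norm (p (complex_of_real u))" if "u \<in> {0..X}" for u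
      unfolding norm_mult norm_of_real using that B by (intro mult_right_mono) auto
  qed auto
  have sums: "(\<lambda>k. c k * z ^ k) sums laplace_trunc D X z" for z
  proof -
    define E where "E = (\<lambda>n u. \<Sum>k<n. (- z * of_real u) ^ k / fact k :: complex)"
    have part: "(\<Sum>k<n. c k * z ^ k) = integral {0..X} (\<lambda>u. of_real (D u) * E n u)" for n
    proof -
      have "((\<lambda>u. \<Sum>k<n. of_real (D u) * ((- of_real u) ^ k / fact k) * z ^ k) has_integral (\<Sum>k<n. c k * z ^ k)) {0..X}"
        unfolding c_def
        by (intro has_integral_sum has_integral_mult_left integrable_integral int) (auto intro!: continuous_intros)
      also have "(\<lambda>u. \<Sum>k<n. of_real (D u) * ((- of_real u) ^ k / fact k) * z ^ k) = (\<lambda>u. of_real (D u) * E n u)"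
        unfolding E_def sum_distrib_left
      proof (intro ext sum.cong refl)
        fix u k
        have "(- z * of_real u) ^ k = (- of_real u) ^ k * z ^ k"
          by (simp only: power_mult_distrib[symmetric]) (simp add: mult.commute)
        thus "of_real (D u) * ((- of_real u) ^ k / fact k) * z ^ k = of_real (D u) * ((- z * of_real u) ^ k / fact k)" by simp
      qed
      finally show ?thesis by (simp add: integral_unique)
    qed
    have "(\<lambda>n. integral {0..X} (\<lambda>u. of_real (D u) * E n u)) \<longlonglongrightarrow> integral {0..X} (\<lambda>u. of_real (D u) * exp (- z * of_real u))"
    proof (rule dominated_convergence(2))
      show "(\<lambda>u. of_real (D u) * E n u) integrable_on {0..X}" for n
        unfolding E_def by (rule int) (auto intro!: continuous_intros)
      show "(\<lambda>u. B * exp (norm z * X)) integrable_on {0..X}" by (intro integrable_continuous_interval continuous_intros)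
      fix n u assume u: "u \<in> {0..X}"
      have "norm (E n u) \<le> (\<Sum>k<n. norm ((- z * of_real u) ^ k / fact k))" unfolding E_def by (rule norm_sum)
      also have "\<dots> = (\<Sum>k<n. (norm z * u) ^ k / fact k)"
        using u by (simp add: norm_divide norm_power norm_mult)
      also have "\<dots> \<le> exp (norm z * u)"
        unfolding exp_def using u summable_exp_generic[of "norm z * u"]
        by (intro order_trans[OF sum_le_suminf[of "\<lambda>k. (norm z * u) ^ k / fact k" "{..<n}"]]) 
           (auto simp: divide_inverse mult.commute scaleR_conv_of_real)
      also have "\<dots> \<le> exp (norm z * X)" using u by (simp add: mult_left_mono)
      finally show "norm (of_real (D u) * E n u) \<le> B * exp (norm z * X)"
        unfolding norm_mult norm_of_real using u B B0 by (intro mult_mono) auto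
    next
      fix u assume "u \<in> {0..X}"
      have "(\<lambda>k. (- z * of_real u) ^ k / fact k) sums exp (- z * of_real u)"
        using exp_converges[of "- z * of_real u"] by (simp add: scaleR_conv_of_real divide_inverse mult.commute)
      hence "(\<lambda>n. E n u) \<longlonglongrightarrow> exp (- z * of_real u)" by (simp add: E_def sums_def)
      thus "(\<lambda>n. of_real (D u) * E n u) \<longlonglongrightarrow> of_real (D u) * exp (- z * of_real u)"
        by (intro tendsto_intros)
    qed
    thus ?thesis unfolding sums_def part laplace_trunc_def .
  qed
  show ?thesis
  proof -
    have ball: "laplace_trunc D X holomorphic_on ball 0 r" for r
      by (rule power_series_holomorphic[where a = c]) (use sums in simp)
    show ?thesis unfolding holomorphic_on_def
    proof
      fix x :: complex
      have "laplace_trunc D X field_differentiable at x"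
        by (rule holomorphic_on_imp_differentiable_at[OF ball[of "norm x + 1"]]) auto
      thus "laplace_trunc D X field_differentiable at x within UNIV" by simp
    qed
  qed
qed

text \<open>The value \<open>g 0\<close> takes the place of the integral of \<open>D\<close> over
  \<open>[0, \<infinity>)\<close>, whose convergence is not presupposed.\<close>

lemma newman_bound:
  assumes D: "D \<in> borel_measurable borel" and B: "\<And>u. u \<ge> 0 \<Longrightarrow> \<bar>D u\<bar> \<le> B"
    and R: "R > 0" and \<eta>: "0 < \<eta>" "\<eta> \<le> R" "\<eta> < \<eta>'" and R': "R < R'" and X: "0 \<le> X"
    and g: "g holomorphic_on {z. Re z > -\<eta>' \<and> \<bar>Im z\<bar> < R'}"
    and gD: "\<And>z. Re z > 0 \<Longrightarrow> \<bar>Im z\<bar> < R' \<Longrightarrow> g z = laplace D z"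
    and M: "\<And>z. -\<eta> \<le> Re z \<Longrightarrow> Re z \<le> 0 \<Longrightarrow> \<bar>Im z\<bar> \<le> R \<Longrightarrow> Re z = -\<eta> \<or> \<bar>Im z\<bar> = R \<Longrightarrow> norm (g z) \<le> M"
  shows "norm (g 0 - of_real (integral {0..X} D)) \<le> 24 * B / R + 6 * M * \<eta>\<^sup>2 / R\<^sup>2 + 6 * M * R * exp (- \<eta> * X) / \<eta>"
proof -
  have B0: "B \<ge> 0" using B[of 0] by simp
  have "norm (g 0 - laplace_trunc D X 0) \<le> 24 * B / R + 6 * M * \<eta>\<^sup>2 / R\<^sup>2 + 6 * M * R * exp (- \<eta> * X) / \<eta>"
  proof (rule newman_contour_bound[OF R \<eta> R' X laplace_trunc_holomorphic[OF D B X] g _ _ M B0])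
    show "norm (g z - laplace_trunc D X z) \<le> B * exp (- Re z * X) / Re z" if "Re z > 0" "\<bar>Im z\<bar> < R'" for z
      using laplace_minus_trunc_bound[OF D B that(1) X] gD[OF that] by simp
    show "norm (laplace_trunc D X z) \<le> B * exp (- Re z * X) / (- Re z)" if "Re z < 0" for z
      by (rule laplace_trunc_bound_left[OF D B that X])
  qed auto
  moreover have "laplace_trunc D X 0 = of_real (integral {0..X} D)"
  proof -
    have "(\<lambda>u. of_real (D u) * exp (- 0 * of_real u) :: complex) integrable_on {0..X}" 
      by (rule laplace_trunc_integrable[OF D B])
    hence "(\<lambda>u. complex_of_real (D u)) integrable_on {0..X}" by simp
    hence "D integrable_on {0..X}"
      using integrable_linear[of "\<lambda>u. complex_of_real (D u)" "{0..X}" Re] bounded_linear_Re by (auto simp: o_def)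
    thus ?thesis unfolding laplace_trunc_def
      using integral_linear[of D "{0..X}" complex_of_real] bounded_linear_of_real by (simp add: o_def)
  qed
  ultimately show ?thesis by simp
qed

section \<open>The exponential integral Ein\<close>

definition exp_quot :: "real \<Rightarrow> real" where
  "exp_quot v = (if v = 0 then 1 else (1 - exp (- v)) / v)"

text \<open>The substitution \<open>v = u s\<close> moves the integral from \<open>[0, u]\<close> to
  the fixed interval \<open>[0, 1]\<close>, where differentiation under the integral and exchange of
  integrals apply directly.\<close>

definition ein :: "real \<Rightarrow> real" where
  "ein u = integral {0..1} (\<lambda>s. u * exp_quot (u * s))"

text \<open>This representation yields the sign, the upper bound \<open>1\<close> and continuity at
  \<open>0\<close> of \<open>exp_quot\<close> without a separate discussion of the removable
  singularity.\<close>

lemma exp_quot_has_integral: "((\<lambda>s. exp (- (v * s))) has_integral exp_quot v) {0..1}"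
proof (cases "v = 0")
  case True
  thus ?thesis using has_integral_const_real[of "1::real" 0 1] by (simp add: exp_quot_def)
next
  case False
  have "((\<lambda>s. exp (- (v * s))) has_integral (- exp (- (v * 1)) / v - (- exp (- (v * 0)) / v))) {0..1}"
    using False by (intro fundamental_theorem_of_calculus)
      (auto intro!: derivative_eq_intros simp flip: has_real_derivative_iff_has_vector_derivative)
  also have "- exp (- (v * 1)) / v - (- exp (- (v * 0)) / v) = exp_quot v"
    using False by (simp add: exp_quot_def diff_divide_distrib)
  finally show ?thesis .
qed

lemma exp_quot_nonneg: "exp_quot v \<ge> 0"
  using has_integral_nonneg[OF exp_quot_has_integral] by simp

lemma exp_quot_le_1: "v \<ge> 0 \<Longrightarrow> exp_quot v \<le> 1"
  using has_integral_le[OF exp_quot_has_integral has_integral_const_real[of "1::real" 0 1]] by simp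

lemma continuous_exp_quot: "continuous_on UNIV exp_quot"
proof -
  have "continuous_on UNIV (\<lambda>v::real. integral (cbox 0 1) (\<lambda>s. exp (- (v * s))))"
    by (rule integral_continuous_on_param) (auto intro!: continuous_intros simp: case_prod_unfold)
  moreover have "integral (cbox 0 1) (\<lambda>s. exp (- (v * s))) = exp_quot v" for v
    using exp_quot_has_integral[of v] by (simp add: integral_unique)
  ultimately show ?thesis by simp
qed

lemma continuous_on_exp_quot [continuous_intros]:
  "continuous_on A f \<Longrightarrow> continuous_on A (\<lambda>x. exp_quot (f x))"
  by (rule continuous_on_compose2[OF continuous_exp_quot]) auto

lemma ein_has_derivative: "(ein has_field_derivative exp_quot u) (at u)"
proof -
  have "((\<lambda>u. integral (cbox 0 1) (\<lambda>s. u * exp_quot (u * s))) has_field_derivative integral (cbox 0 1) (\<lambda>s. exp (- (u * s)))) (at u within UNIV)"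
  proof (rule leibniz_rule_field_derivative)
    fix x s :: real
    show "((\<lambda>x. x * exp_quot (x * s)) has_field_derivative exp (- (x * s))) (at x within UNIV)"
    proof (cases "s = 0")
      case True thus ?thesis by (auto simp: exp_quot_def intro!: derivative_eq_intros)
    next
      case False
      have "((\<lambda>x. (1 - exp (- (x * s))) / s) has_field_derivative exp (- (x * s))) (at x)"
        using False by (auto intro!: derivative_eq_intros)
      moreover have "(\<lambda>x. (1 - exp (- (x * s))) / s) = (\<lambda>x. x * exp_quot (x * s))"
        using False by (auto simp: exp_quot_def)
      ultimately show ?thesis by simp
    qed
  next
    fix x :: real show "(\<lambda>s. x * exp_quot (x * s)) integrable_on cbox 0 1"
      by (intro integrable_continuous continuous_intros)
  qed (auto intro!: continuous_intros simp: case_prod_unfold)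
  moreover have "integral (cbox 0 1) (\<lambda>s. exp (- (u * s))) = exp_quot u"
    using exp_quot_has_integral[of u] by (simp add: integral_unique)
  ultimately show ?thesis by (simp add: ein_def[abs_def])
qed

lemma ein_0 [simp]: "ein 0 = 0"
  by (simp add: ein_def)

lemma ein_mono: "u \<le> v \<Longrightarrow> ein u \<le> ein v"
  by (rule DERIV_nonneg_imp_nondecreasing) (use ein_has_derivative exp_quot_nonneg in blast)+

lemma ein_diff_le:
  assumes "0 \<le> u" "u \<le> v"
  shows "ein v - ein u \<le> v - u"
proof -
  have "u - ein u \<le> v - ein v"
  proof (rule DERIV_nonneg_imp_nondecreasing[OF assms(2)])
    fix x assume "u \<le> x" "x \<le> v"
    hence "((\<lambda>x. x - ein x) has_real_derivative 1 - exp_quot x) (at x)" "0 \<le> 1 - exp_quot x"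
      using assms exp_quot_le_1[of x] by (auto intro!: derivative_eq_intros ein_has_derivative)
    thus "\<exists>y. ((\<lambda>x. x - ein x) has_real_derivative y) (at x) \<and> 0 \<le> y" by blast
  qed
  thus ?thesis by simp
qed

lemma ein_bounds:
  assumes "u \<ge> 0"
  shows "0 \<le> ein u" "ein u \<le> u"
  using ein_mono[of 0 u] ein_diff_le[of 0 u] assms by auto

lemma continuous_ein: "continuous_on A ein"
  using ein_has_derivative DERIV_isCont continuous_at_imp_continuous_on by blast

lemma power_diff_le:
  fixes a b :: real
  assumes "0 \<le> b" "b \<le> a"
  shows "a ^ Suc m - b ^ Suc m \<le> real (Suc m) * a ^ m * (a - b)"
proof (induction m)
  case (Suc m)
  have "a ^ Suc (Suc m) - b ^ Suc (Suc m) = a ^ Suc m * (a - b) + b * (a ^ Suc m - b ^ Suc m)"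
    by (simp add: algebra_simps)
  also have "\<dots> \<le> a ^ Suc m * (a - b) + a * (real (Suc m) * a ^ m * (a - b))"
    using assms Suc power_mono[of b a "Suc m"] by (intro add_left_mono mult_mono) auto
  finally show ?case by (simp add: algebra_simps)
qed simp

text \<open>The harmonic number is the integral over \<open>[0, 1]\<close> of
  \<open>(1 - (1-s)^n) / s\<close>, and \<open>ein n\<close> that of
  \<open>(1 - exp(-ns)) / s\<close>. The difference of the integrands is nonnegative as
  \<open>1 - s \<le> exp(-s)\<close>, and at most \<open>n s exp(-(n-1)s)\<close>. Taking
  \<open>n \<ge> 2\<close> gives \<open>n \<le> 2M\<close> for \<open>M = n - 1\<close>, and the
  resulting majorant has integral at most \<open>2/M\<close>.\<close>

lemma harm_minus_ein:
  "0 \<le> harm (Suc (Suc m)) - ein (real (Suc (Suc m)))"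
  "harm (Suc (Suc m)) - ein (real (Suc (Suc m))) \<le> 2 / real (Suc m)"
proof -
  define n where "n = Suc (Suc m)"
  define M where "M = real (Suc m)"
  have nM: "real n = M + 1" "n = Suc (Suc m)" "M \<ge> 1" by (auto simp: n_def M_def)
  have "((\<lambda>s. (1 - s) ^ k) has_integral (1 / real (Suc k))) {0..1::real}" for k
  proof -
    have d: "((\<lambda>s. - ((1 - s) ^ Suc k / real (Suc k))) has_real_derivative (1 - s) ^ k) (at s within {0..1})" for s :: real
    proof -
      have "((\<lambda>s. 1 - s) has_real_derivative -1) (at s within {0..1})" by (auto intro!: derivative_eq_intros)
      from DERIV_minus[OF DERIV_cdivide[OF DERIV_power_Suc[OF this, of k], of "real (Suc k)"]]
      show ?thesis by (rule DERIV_cong) (simp add: field_simps)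
    qed
    have "((\<lambda>s. (1 - s) ^ k) has_integral (- ((1 - 1) ^ Suc k / real (Suc k)) - - ((1 - 0) ^ Suc k / real (Suc k)))) {0..1::real}"
      by (intro fundamental_theorem_of_calculus) (use d in \<open>auto simp flip: has_real_derivative_iff_has_vector_derivative\<close>)
    thus ?thesis by simp
  qed
  hence "((\<lambda>s. \<Sum>k<n. (1 - s) ^ k) has_integral (\<Sum>k<n. 1 / real (Suc k))) {0..1::real}"
    by (intro has_integral_sum) auto
  also have "(\<Sum>k<n. 1 / real (Suc k)) = harm n"
    by (simp add: harm_altdef inverse_eq_divide)
  finally have 1: "((\<lambda>s. \<Sum>k<n. (1 - s) ^ k) has_integral harm n) {0..1::real}" .
  have 2: "((\<lambda>s. real n * exp_quot (real n * s)) has_integral ein (real n)) {0..1}"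
    unfolding ein_def by (intro integrable_integral integrable_continuous_interval continuous_intros)
  have diff: "((\<lambda>s. (\<Sum>k<n. (1 - s) ^ k) - real n * exp_quot (real n * s)) has_integral (harm n - ein (real n))) {0..1}"
    by (rule has_integral_diff[OF 1 2])
  have b: "0 \<le> (\<Sum>k<n. (1 - s) ^ k) - real n * exp_quot (real n * s) \<and>
           (\<Sum>k<n. (1 - s) ^ k) - real n * exp_quot (real n * s) \<le> 2 * (M * s * exp (- (M * s)))"
    if s: "s \<in> {0..1}" for s
  proof (cases "s = 0")
    case True thus ?thesis by (simp add: exp_quot_def)
  next
    case False
    hence s: "0 < s" "s \<le> 1" using s by auto
    have e: "exp (-s) \<ge> 1 - s" using exp_ge_add_one_self[of "-s"] by simp
    have "(\<Sum>k<n. (1 - s) ^ k) = (1 - (1 - s) ^ n) / s"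
      using sum_gp_strict[of "1 - s" n] s by simp
    moreover have "real n * exp_quot (real n * s) = (1 - exp (- s) ^ n) / s"
    proof -
      have "exp (- (real n * s)) = exp (- s) ^ n" using exp_of_nat_mult[of n "-s"] by simp
      moreover have "real n * s \<noteq> 0" "real n \<noteq> 0" using s by (auto simp: n_def)
      ultimately show ?thesis by (simp add: exp_quot_def)
    qed
    ultimately have eq: "(\<Sum>k<n. (1 - s) ^ k) - real n * exp_quot (real n * s) = (exp (-s) ^ n - (1 - s) ^ n) / s"
      by (simp add: diff_divide_distrib)
    have "(1 - s) ^ n \<le> exp (-s) ^ n" using e s by (intro power_mono) auto
    hence "0 \<le> (exp (-s) ^ n - (1 - s) ^ n) / s" using s by simp
    moreover have "(exp (-s) ^ n - (1 - s) ^ n) / s \<le> 2 * (M * s * exp (- (M * s)))"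
    proof -
      have "exp (-s) ^ n - (1 - s) ^ n \<le> real n * exp (-s) ^ Suc m * (exp (-s) - (1 - s))"
        unfolding nM(2) using e s by (intro power_diff_le) auto
      also have "\<dots> \<le> real n * exp (-s) ^ Suc m * s\<^sup>2"
      proof (intro mult_left_mono)
        have "exp (-s) \<le> 1 / (1 + s)"
          using exp_ge_add_one_self[of s] s by (simp add: exp_minus inverse_eq_divide frac_le)
        also have "1 / (1 + s) \<le> 1 - s + s\<^sup>2"
        proof -
          have "(1 - s + s\<^sup>2) * (1 + s) = 1 + s ^ 3"
            by (simp add: power2_eq_square power3_eq_cube algebra_simps)
          hence "1 \<le> (1 - s + s\<^sup>2) * (1 + s)" using s by simp
          thus ?thesis by (subst pos_divide_le_eq) (use s in auto)
        qed
        finally show "exp (-s) - (1 - s) \<le> s\<^sup>2" by simp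
      qed simp
      also have "exp (-s) ^ Suc m = exp (- (M * s))"
        using exp_of_nat_mult[of "Suc m" "-s"] by (simp only: M_def mult_minus_right)
      also have "real n * exp (- (M * s)) * s\<^sup>2 \<le> (2 * M) * exp (- (M * s)) * s\<^sup>2"
        using nM by (intro mult_right_mono) auto
      finally have "exp (-s) ^ n - (1 - s) ^ n \<le> (2 * M) * exp (- (M * s)) * s\<^sup>2" .
      thus ?thesis using s by (simp add: divide_le_eq power2_eq_square mult_ac)
    qed
    ultimately show ?thesis unfolding eq by blast
  qed
  have "0 \<le> harm n - ein (real n)" by (rule has_integral_nonneg[OF diff]) (use b in blast)
  thus "0 \<le> harm (Suc (Suc m)) - ein (real (Suc (Suc m)))" by (simp add: n_def)
  have I: "((\<lambda>s. 2 * (M * s * exp (- (M * s)))) has_integral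
     (- 2 * (1 + 1 / M) * exp (- (M * 1)) - - 2 * (0 + 1 / M) * exp (- (M * 0)))) {0..1}"
  proof (intro fundamental_theorem_of_calculus)
    fix s assume "s \<in> {0..1::real}"
    have "((\<lambda>s. - 2 * (s + 1 / M) * exp (- (M * s))) has_real_derivative 2 * (M * s * exp (- (M * s)))) (at s within {0..1})"
      using nM(3) by (auto intro!: derivative_eq_intros simp: field_simps)
    thus "((\<lambda>s. - 2 * (s + 1 / M) * exp (- (M * s))) has_vector_derivative 2 * (M * s * exp (- (M * s)))) (at s within {0..1})"
      by (simp add: has_real_derivative_iff_has_vector_derivative)
  qed simp
  have "harm n - ein (real n) \<le> - 2 * (1 + 1 / M) * exp (- (M * 1)) - - 2 * (0 + 1 / M) * exp (- (M * 0))"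
    by (rule has_integral_le[OF diff I]) (use b in blast)
  also have "\<dots> \<le> 2 / M"
  proof -
    have "0 \<le> 2 * (1 + 1 / M) * exp (- (M * 1))" using nM(3) by (intro mult_nonneg_nonneg) auto
    thus ?thesis by (simp add: algebra_simps)
  qed
  finally show "harm (Suc (Suc m)) - ein (real (Suc (Suc m))) \<le> 2 / real (Suc m)" by (simp add: n_def M_def)
qed

lemma ein_minus_ln_tendsto:
  "(\<lambda>n. ein (real n) - ln (real n)) \<longlonglongrightarrow> (euler_mascheroni :: real)"
proof -
  have "(\<lambda>m. harm (Suc (Suc m)) - ein (real (Suc (Suc m)))) \<longlonglongrightarrow> 0"
  proof (rule real_tendsto_sandwich[OF _ _ tendsto_const])
    show "(\<lambda>m. 2 / real (Suc m)) \<longlonglongrightarrow> 0"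
      using tendsto_mult_right_zero[OF LIMSEQ_Suc[OF lim_inverse_n'], of 2] by simp
  qed (use harm_minus_ein in auto)
  hence "(\<lambda>n. harm n - ein (real n)) \<longlonglongrightarrow> 0"
    by (rule LIMSEQ_imp_Suc[OF LIMSEQ_imp_Suc])
  from tendsto_diff[OF euler_mascheroni_LIMSEQ this] show ?thesis by (simp add: algebra_simps)
qed

text \<open>The function \<open>ein x - ln x\<close> has derivative \<open>- exp(-x) / x\<close> and
  so decreases, while \<open>ein x - ln x - exp(-x)\<close> increases for \<open>x \<ge> 1\<close>.
  Each is compared with the limit along the integers.\<close>

lemma ein_asymp:
  assumes u: "u \<ge> 1"
  shows "0 \<le> ein u - ln u - euler_mascheroni" "ein u - ln u - euler_mascheroni \<le> exp (- u)"
proof -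
  have d: "(ein has_real_derivative (1 - exp (-x)) / x) (at x)" if "x > 0" for x
    using ein_has_derivative[of x] that by (simp add: exp_quot_def)
  have 1: "ein v - ln v \<le> ein u - ln u" if "u \<le> v" for v
  proof (rule DERIV_nonpos_imp_nonincreasing[OF that])
    fix x assume x: "u \<le> x" "x \<le> v"
    have "((\<lambda>x. ein x - ln x) has_real_derivative (1 - exp (-x)) / x - 1 / x) (at x)"
      using x u by (auto intro!: derivative_eq_intros d)
    moreover have "(1 - exp (-x)) / x - 1 / x \<le> 0" using x u by (simp add: diff_divide_distrib)
    ultimately show "\<exists>y. ((\<lambda>x. ein x - ln x) has_real_derivative y) (at x) \<and> y \<le> 0" by blast
  qed
  have 2: "ein u - ln u - exp (-u) \<le> ein v - ln v - exp (-v)" if "u \<le> v" for v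
  proof (rule DERIV_nonneg_imp_nondecreasing[OF that])
    fix x assume x: "u \<le> x" "x \<le> v"
    have "((\<lambda>x. ein x - ln x - exp (-x)) has_real_derivative (1 - exp (-x)) / x - 1 / x + exp (-x)) (at x)"
      using x u by (auto intro!: derivative_eq_intros d)
    moreover have "0 \<le> (1 - exp (-x)) / x - 1 / x + exp (-x)"
    proof -
      have "exp (-x) / x \<le> exp (-x)" using x u by (simp add: divide_le_eq)
      thus ?thesis by (simp add: diff_divide_distrib)
    qed
    ultimately show "\<exists>y. ((\<lambda>x. ein x - ln x - exp (-x)) has_real_derivative y) (at x) \<and> 0 \<le> y" by blast
  qed
  have ev: "\<forall>\<^sub>F n in sequentially. u \<le> real n"
    using filterlim_real_sequentially by (auto simp: filterlim_at_top)
  have "euler_mascheroni \<le> ein u - ln u"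
    by (rule tendsto_upperbound[OF ein_minus_ln_tendsto]) (use ev 1 in \<open>auto elim: eventually_mono\<close>)
  thus "0 \<le> ein u - ln u - euler_mascheroni" by simp
  have "ein u - ln u - exp (-u) \<le> euler_mascheroni"
  proof (rule tendsto_lowerbound[OF ein_minus_ln_tendsto])
    show "\<forall>\<^sub>F n in sequentially. ein u - ln u - exp (-u) \<le> ein (real n) - ln (real n)"
      using ev
    proof eventually_elim
      case (elim n)
      show ?case using 2[OF elim] exp_ge_zero[of "- real n"] by linarith
    qed
  qed simp
  thus "ein u - ln u - euler_mascheroni \<le> exp (- u)" by simp
qed

section \<open>The error term in Mertens' theorem\<close>

lemma laplace_exp_tail:
  assumes z: "Re z > 0" and a: "a \<ge> 0"
  shows "((\<lambda>u. exp (- z * of_real u)) has_integral (exp (- z * of_real a) / z)) {a..}"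
proof -
  have z0: "z \<noteq> 0" using z by auto
  have int: "(\<lambda>u. exp (- z * of_real u)) integrable_on {b..}" 
    and bd: "norm (integral {b..} (\<lambda>u. exp (- z * of_real u))) \<le> exp (- Re z * b) / Re z" if "b \<ge> 0" for b
    using laplace_integrable[of "\<lambda>_. 1" 1 z b] z that by auto
  define I where "I = integral {a..} (\<lambda>u. exp (- z * of_real u))"
  have "I - exp (- z * of_real a) / z = 0"
  proof -
    have *: "norm (I - exp (- z * of_real a) / z) \<le> 2 * exp (- Re z * b) / Re z" if b: "b \<ge> a" for b
    proof -
      have "((\<lambda>u. exp (- z * of_real u)) has_integral (- exp (- z * of_real b) / z - (- exp (- z * of_real a) / z))) {a..b}"
        using b z0 by (intro fundamental_theorem_of_calculus)
          (auto intro!: derivative_eq_intros has_vector_derivative_real_field)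
      moreover have "((\<lambda>u. exp (- z * of_real u)) has_integral integral {b..} (\<lambda>u. exp (- z * of_real u))) {b..}"
        using a b by (intro integrable_integral int) auto
      moreover have "negligible ({a..b} \<inter> {b..})"
      proof -
        have "{a..b} \<inter> {b..} = {b}" using b by auto
        thus ?thesis by simp
      qed
      ultimately have "((\<lambda>u. exp (- z * of_real u)) has_integral (- exp (- z * of_real b) / z - (- exp (- z * of_real a) / z)
          + integral {b..} (\<lambda>u. exp (- z * of_real u)))) ({a..b} \<union> {b..})"
        by (rule has_integral_Un)
      moreover have "{a..b} \<union> {b..} = {a..}" using b by auto
      ultimately have "I = - exp (- z * of_real b) / z - (- exp (- z * of_real a) / z) + integral {b..} (\<lambda>u. exp (- z * of_real u))"
        unfolding I_def by (simp add: integral_unique)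
      hence e: "I - exp (- z * of_real a) / z = integral {b..} (\<lambda>u. exp (- z * of_real u)) - exp (- z * of_real b) / z" by simp
      have "norm (exp (- z * of_real b) / z) = exp (- Re z * b) / norm z"
        unfolding norm_divide norm_exp_mult_of_real ..
      also have "\<dots> \<le> exp (- Re z * b) / Re z"
        using z complex_Re_le_cmod[of z] by (intro divide_left_mono mult_pos_pos) auto
      finally have "norm (I - exp (- z * of_real a) / z) \<le> exp (- Re z * b) / Re z + exp (- Re z * b) / Re z"
        unfolding e using bd[of b] a b by (intro order_trans[OF norm_triangle_ineq4 add_mono]) auto
      thus ?thesis by simp
    qed
    have "((\<lambda>b. 2 * exp (- Re z * b) / Re z) \<longlongrightarrow> 0) at_top"
      using z by real_asymp
    hence "norm (I - exp (- z * of_real a) / z) \<le> 0"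
      by (rule tendsto_lowerbound) (use * in \<open>auto simp: eventually_at_top_linorder\<close>)
    thus ?thesis by simp
  qed
  thus ?thesis using int[OF a] unfolding I_def by (metis eq_iff_diff_eq_0 integrable_integral)
qed

section \<open>Boundedness of the error in Mertens' theorem\<close>

definition prime_recip :: "real \<Rightarrow> real" where
  "prime_recip x = (\<Sum>p::nat | prime p \<and> real p \<le> x. 1 / real p)"

lemma finite_primes_le [simp]: "finite {p::nat. prime p \<and> real p \<le> x}"
proof (rule finite_subset)
  show "{p::nat. prime p \<and> real p \<le> x} \<subseteq> {..nat \<lfloor>x\<rfloor>}" by (auto simp: le_nat_floor)
qed simp

lemma prime_recip_mono: "x \<le> y \<Longrightarrow> prime_recip x \<le> prime_recip y"
  unfolding prime_recip_def by (rule sum_mono2) auto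

lemma prime_recip_nonneg: "prime_recip x \<ge> 0"
  unfolding prime_recip_def by (rule sum_nonneg) auto

lemma Re_prime_sum_of_real:
  assumes "x > 0"
  shows "((\<lambda>p. real p powr (-1 - x)) has_sum Re (prime_sum (of_real x))) {p::nat. prime p}"
  unfolding prime_sum_of_real using assms by (simp add: powr_summable_on)

text \<open>By the Euler product, \<open>ln x\<close> plus the prime sum at \<open>x\<close> is
  \<open>ln (norm (zeta_entire x))\<close> plus \<open>prime_corr x\<close>; the former is
  continuous on \<open>[0, 2]\<close> because the pole is removed and no zero occurs, the latter is
  bounded.\<close>

lemma prime_sum_near_0:
  obtains C where "\<And>x. 0 < x \<Longrightarrow> x \<le> 2 \<Longrightarrow> \<bar>Re (prime_sum (of_real x)) + ln x\<bar> \<le> C"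
proof -
  \<comment> \<open>This box degenerates to the segment \<open>[0, 2]\<close> of the real
    axis.\<close>
  define K where "K = cbox (0::complex) (of_real 2)"
  have KD: "z \<in> K \<Longrightarrow> Re z \<ge> 0" for z by (auto simp: K_def in_cbox_complex_iff)
  have Im0: "z \<in> K \<Longrightarrow> Im z = 0" for z by (auto simp: K_def in_cbox_complex_iff)
  have nz: "zeta_entire z \<noteq> 0" if "z \<in> K" for z
  proof (cases "z = 0")
    case False
    hence "Re z > 0" using KD[OF that] Im0[OF that] by (auto simp: complex_eq_iff)
    thus ?thesis by (rule zeta_entire_nonzero)
  qed simp
  have "continuous_on K zeta_entire"
    using KD by (intro holomorphic_on_imp_continuous_on holomorphic_on_subset[OF zeta_entire_holomorphic]) force
  hence "continuous_on K (\<lambda>z. ln (norm (zeta_entire z)))" using nz by (intro continuous_intros) auto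
  hence "compact ((\<lambda>z. ln (norm (zeta_entire z))) ` K)"
    by (rule compact_continuous_image) (simp add: K_def)
  then obtain C1 where C1: "\<And>z. z \<in> K \<Longrightarrow> \<bar>ln (norm (zeta_entire z))\<bar> \<le> C1"
    using compact_imp_bounded bounded_real by (metis (no_types, lifting) imageI)
  obtain C2 where C2: "\<And>z. Re z \<ge> -1/4 \<Longrightarrow> norm (prime_corr z) \<le> C2" by (rule prime_corr_bounded) blast
  show ?thesis
  proof (rule that[of "C1 + C2"])
    fix x :: real assume x: "0 < x" "x \<le> 2"
    define z where "z = complex_of_real x"
    have "norm (zeta_entire z) = x * exp (Re (prime_sum z) - Re (prime_corr z))"
      using x by (simp add: z_def zeta_entire_eq_exp norm_mult)
    hence "ln (norm (zeta_entire z)) = ln x + (Re (prime_sum z) - Re (prime_corr z))"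
      using x by (simp add: ln_mult)
    hence "Re (prime_sum z) + ln x = ln (norm (zeta_entire z)) + Re (prime_corr z)" by simp
    moreover have "\<bar>ln (norm (zeta_entire z))\<bar> \<le> C1" using x by (intro C1) (auto simp: K_def z_def in_cbox_complex_iff)
    moreover have "\<bar>Re (prime_corr z)\<bar> \<le> C2"
      using C2[of z] abs_Re_le_cmod[of "prime_corr z"] x by (simp add: z_def)
    ultimately show "\<bar>Re (prime_sum (of_real x)) + ln x\<bar> \<le> C1 + C2" unfolding z_def by linarith
  qed
qed

text \<open>With \<open>y = exp (1/d)\<close>, both \<open>1/p - p^(-1-d)\<close> for \<open>p \<le> y\<close> and \<open>p^(-1-d)\<close> for \<open>p > y\<close> are at most
  \<open>3 p^(-1-d) (1 - p^(-d))\<close>, so Chebyshev-type estimates are not needed.\<close>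

lemma prime_recip_minus_prime_sum:
  assumes d: "0 < d"
  shows "\<bar>prime_recip (exp (1 / d)) - Re (prime_sum (of_real d))\<bar>
           \<le> 3 * (Re (prime_sum (of_real d)) - Re (prime_sum (of_real (2 * d))))"
proof -
  define y where "y = exp (1 / d)"
  define g where "g = (\<lambda>p::nat. (if real p \<le> y then 1 / real p else 0) + - (real p powr (-1 - d)))"
  define f where "f = (\<lambda>p::nat. real p powr (-1 - d) + - (real p powr (-1 - 2 * d)))"
  have "((\<lambda>p::nat. if real p \<le> y then 1 / real p else 0) has_sum prime_recip y) {p. prime p \<and> real p \<le> y}"
    unfolding prime_recip_def by (rule has_sum_finiteI) (auto intro!: sum.cong)
  hence "((\<lambda>p::nat. if real p \<le> y then 1 / real p else 0) has_sum prime_recip y) {p. prime p}"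
    by (rule has_sum_cong_neutral[THEN iffD1, rotated -1]) auto
  hence g: "(g has_sum (prime_recip y + - Re (prime_sum (of_real d)))) {p. prime p}"
    unfolding g_def using d by (intro has_sum_add has_sum_uminusI Re_prime_sum_of_real) auto
  have "(f has_sum (Re (prime_sum (of_real d)) + - Re (prime_sum (of_real (2 * d))))) {p. prime p}"
    unfolding f_def using d by (intro has_sum_add has_sum_uminusI Re_prime_sum_of_real) auto
  hence f3: "((\<lambda>p. 3 * f p) has_sum (3 * (Re (prime_sum (of_real d)) + - Re (prime_sum (of_real (2 * d)))))) {p. prime p}"
    by (rule has_sum_cmult_right)
  have le: "norm (g p) \<le> 3 * f p" if "p \<in> {p. prime p}" for p
  proof -
    have p: "real p \<ge> 2" using that prime_ge_2_nat[of p] by simp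
    define q where "q = real p powr (-d)"
    have q: "0 < q" "q \<le> 1" using p d powr_mono[of "-d" 0 "real p"] by (auto simp: q_def)
    have e1: "real p powr (-1 - d) = q / real p"
      using p by (simp add: q_def powr_diff powr_minus field_simps)
    have e2: "real p powr (-1 - 2 * d) = q * q / real p"
    proof -
      have "real p powr (-1 - 2 * d) = real p powr (-1) * (q * q)"
        unfolding q_def powr_add[symmetric] by simp
      thus ?thesis using p by (simp add: powr_minus divide_inverse)
    qed
    have f: "f p = q * (1 - q) / real p" 
      unfolding f_def e1 e2 by (simp add: algebra_simps diff_divide_distrib)
    have exp1: "exp (1::real) \<le> 3" using exp_le by simp
    show ?thesis
    proof (cases "real p \<le> y")
      case True
      have "ln (real p) \<le> 1 / d" using True p by (metis y_def exp_gt_zero ln_exp ln_le_cancel_iff less_le_trans zero_less_numeral)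
      hence "d * ln (real p) \<le> 1" using d by (simp add: field_simps)
      hence "exp (-1) \<le> q" using p by (simp add: q_def powr_def)
      hence "1 \<le> q * exp 1" by (simp add: exp_minus field_simps)
      also have "\<dots> \<le> q * 3" using exp1 q by (intro mult_left_mono) auto
      finally have "1 * (1 - q) \<le> (q * 3) * (1 - q)" using q by (intro mult_right_mono) auto
      hence "(1 - q) / real p \<le> 3 * (q * (1 - q)) / real p" using p by (intro divide_right_mono) auto
      moreover have "g p = (1 - q) / real p" using True by (simp add: g_def e1 diff_divide_distrib)
      ultimately show ?thesis using q p by (simp add: f)
    next
      case False
      have "1 / d \<le> ln (real p)" using False p by (metis y_def exp_gt_zero ln_exp ln_le_cancel_iff less_le_trans linear zero_less_numeral)
      hence "1 \<le> d * ln (real p)" using d by (simp add: field_simps)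
      hence "q \<le> exp (-1)" using p by (simp add: q_def powr_def)
      also have "exp (-1::real) \<le> 1 / 2" using exp_ge_add_one_self[of "1::real"] by (simp add: exp_minus field_simps)
      finally have "1 \<le> 3 * (1 - q)" by simp
      hence "q * 1 \<le> q * (3 * (1 - q))" using q by (intro mult_left_mono) auto
      hence "q / real p \<le> 3 * (q * (1 - q)) / real p" using p by (intro divide_right_mono) (auto simp: mult_ac)
      moreover have "g p = - (q / real p)" using False by (simp add: g_def e1)
      ultimately show ?thesis using q p by (simp add: f)
    qed
  qed
  have "norm (prime_recip y + - Re (prime_sum (of_real d))) \<le> 3 * (Re (prime_sum (of_real d)) + - Re (prime_sum (of_real (2 * d))))"
    by (rule norm_infsum_le[OF g f3 le])
  thus ?thesis by (simp add: y_def)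
qed

text \<open>For \<open>d = 1/u\<close> the prime sum at \<open>d\<close> is \<open>ln u\<close> up
  to \<open>C\<close>, and the prime sums at \<open>d\<close> and \<open>2d\<close> differ by at
  most \<open>2C + ln 2\<close>; this explains the constant.\<close>

lemma prime_recip_exp_bounded:
  obtains C where "\<And>u. u \<ge> 1 \<Longrightarrow> \<bar>prime_recip (exp u) - ln u\<bar> \<le> C"
proof -
  obtain C where C: "\<And>x. 0 < x \<Longrightarrow> x \<le> 2 \<Longrightarrow> \<bar>Re (prime_sum (of_real x)) + ln x\<bar> \<le> C"
    using prime_sum_near_0 by blast
  show ?thesis
  proof (rule that[of "3 * (C + C + ln 2) + C"])
    fix u :: real assume u: "u \<ge> 1"
    define d where "d = 1 / u"
    have d: "0 < d" "d \<le> 1" using u by (auto simp: d_def)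
    have "ln d = - ln u" using u by (simp add: d_def ln_div)
    moreover have "ln (2 * d) = ln 2 + ln d" using d by (simp add: ln_mult)
    moreover have "\<bar>Re (prime_sum (of_real d)) + ln d\<bar> \<le> C"
      "\<bar>Re (prime_sum (of_real (2 * d))) + ln (2 * d)\<bar> \<le> C" using C[of d] C[of "2 * d"] d by auto
    moreover have "1 / d = u" by (simp add: d_def)
    ultimately show "\<bar>prime_recip (exp u) - ln u\<bar> \<le> 3 * (C + C + ln 2) + C"
      using prime_recip_minus_prime_sum[OF d(1)] by (simp only: abs_le_iff) argo
  qed
qed

definition mertens_dev :: "real \<Rightarrow> real" where
  "mertens_dev u = prime_recip (exp u) - ein u - Re (prime_corr 0)"

lemma mertens_dev_measurable: "mertens_dev \<in> borel_measurable borel"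
proof -
  have "mono (\<lambda>u. prime_recip (exp u))" by (auto simp: mono_def intro!: prime_recip_mono)
  hence "(\<lambda>u. prime_recip (exp u)) \<in> borel_measurable borel" by (rule borel_measurable_mono)
  moreover have "ein \<in> borel_measurable borel" by (rule borel_measurable_continuous_onI[OF continuous_ein])
  ultimately show ?thesis unfolding mertens_dev_def[abs_def] by measurable
qed

lemma mertens_dev_bounded:
  obtains B where "\<And>u. u \<ge> 0 \<Longrightarrow> \<bar>mertens_dev u\<bar> \<le> B"
proof -
  obtain C where C: "\<And>u. u \<ge> 1 \<Longrightarrow> \<bar>prime_recip (exp u) - ln u\<bar> \<le> C" using prime_recip_exp_bounded by blast
  show ?thesis
  proof (rule that[of "max (C + 1 + \<bar>euler_mascheroni\<bar>) (prime_recip (exp 1) + 1) + \<bar>Re (prime_corr 0)\<bar>"])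
    fix u :: real assume u: "u \<ge> 0"
    have "\<bar>prime_recip (exp u) - ein u\<bar> \<le> max (C + 1 + \<bar>euler_mascheroni\<bar>) (prime_recip (exp 1) + 1)"
    proof (cases "u \<ge> 1")
      case True
      have "exp (-u) \<le> 1" using u by simp
      thus ?thesis using ein_asymp[OF True] C[OF True] by linarith
    next
      case False
      thus ?thesis using ein_bounds[OF u] prime_recip_nonneg[of "exp u"] prime_recip_mono[of "exp u" "exp 1"] by simp
    qed
    thus "\<bar>mertens_dev u\<bar> \<le> max (C + 1 + \<bar>euler_mascheroni\<bar>) (prime_recip (exp 1) + 1) + \<bar>Re (prime_corr 0)\<bar>"
      unfolding mertens_dev_def by linarith
  qed
qed

section \<open>The Laplace transform of the error term\<close>

lemma has_integral_mult_exp_infinity: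
  assumes "x > (0::real)"
  shows "(\<lambda>u. u * exp (- x * u)) integrable_on {0..}" "integral {0..} (\<lambda>u. u * exp (- x * u)) \<le> 4 / x\<^sup>2"
proof -
  have le: "u * exp (- x * u) \<le> 2 / x * exp (- (x / 2) * u)" "0 \<le> u * exp (- x * u)" if "u \<in> {0..}" for u
  proof -
    \<comment> \<open>Half of the exponential decay pays for the factor \<open>u\<close>.\<close>
    have "x / 2 * u \<le> exp (x / 2 * u)" using exp_ge_add_one_self[of "x / 2 * u"] by linarith
    hence "x / 2 * u * exp (- x * u) \<le> exp (x / 2 * u) * exp (- x * u)" by (intro mult_right_mono) auto
    also have "\<dots> = exp (- (x / 2) * u)" unfolding exp_add[symmetric] by (simp add: algebra_simps)
    finally show "u * exp (- x * u) \<le> 2 / x * exp (- (x / 2) * u)" using assms by (simp add: field_simps)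
    show "0 \<le> u * exp (- x * u)" using that by simp
  qed
  have I: "((\<lambda>u. 2 / x * exp (- (x / 2) * u)) has_integral (2 / x * (exp (- (x / 2) * 0) / (x / 2)))) {0..}"
    using assms by (intro has_integral_mult_right has_integral_exp_minus_to_infinity) auto
  show int: "(\<lambda>u. u * exp (- x * u)) integrable_on {0..}"
  proof (rule measurable_bounded_by_integrable_imp_integrable[OF _ has_integral_integrable[OF I]])
    have "(\<lambda>u. u * exp (- x * u)) \<in> borel_measurable borel" by measurable
    thus "(\<lambda>u. u * exp (- x * u)) \<in> borel_measurable (lebesgue_on {0..})"
      by (intro measurable_restrict_space1 measurable_completion) simp
  qed (use le in auto)
  have "integral {0..} (\<lambda>u. u * exp (- x * u)) \<le> 2 / x * (exp (- (x / 2) * 0) / (x / 2))"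
    by (rule has_integral_le[OF integrable_integral[OF int] I]) (use le in auto)
  thus "integral {0..} (\<lambda>u. u * exp (- x * u)) \<le> 4 / x\<^sup>2" by (simp add: power2_eq_square)
qed

text \<open>Writing \<open>ein u\<close> as an integral over \<open>s\<close> and exchanging the
  integrals, the inner transform of \<open>(1 - exp(-us)) / s\<close> is
  \<open>1 / (z (z + s))\<close>, and integration over \<open>s\<close> gives the logarithms. The
  exchange is made on \<open>[0, n] \<times> [0, 1]\<close>, where the integrand is continuous; then
  \<open>n\<close> tends to infinity by dominated convergence, with \<open>u exp(- Re z u)\<close>
  as majorant in \<open>u\<close> and its integral as majorant in \<open>s\<close>.\<close>

lemma laplace_ein_has_integral:
  assumes z: "Re z > 0"
  shows "((\<lambda>u. of_real (ein u) * exp (- z * of_real u)) has_integral ((Ln (1 + z) - Ln z) / z)) {0..}"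
proof -
  define x where "x = Re z"
  have x: "x > 0" and z0: "z \<noteq> 0" using z by (auto simp: x_def)
  define h where "h = (\<lambda>u. u * exp (- x * u))"
  define C where "C = integral {0..} h"
  have h_int: "h integrable_on {0..}" unfolding h_def by (rule has_integral_mult_exp_infinity(1)[OF x])
  have h_nonneg: "u \<ge> 0 \<Longrightarrow> h u \<ge> 0" for u by (simp add: h_def)
  define F where "F = (\<lambda>u. of_real (ein u) * exp (- z * of_real u))"
  define J where "J = (\<lambda>n s. integral {0..real n} (\<lambda>u. of_real (u * exp_quot (u * s)) * exp (- z * of_real u)))"
  have F_le: "norm (F u) \<le> h u" if "u \<ge> 0" for u
    unfolding F_def norm_mult norm_exp_mult_of_real norm_of_real h_def x_def
    using ein_bounds[OF that] by (intro mult_right_mono) auto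
  have F_meas: "F \<in> borel_measurable (lebesgue_on A)" for A
    unfolding F_def by (rule laplace_integrand_measurable[OF borel_measurable_continuous_onI[OF continuous_ein]])
  have F_int: "F integrable_on {0..}"
    by (rule measurable_bounded_by_integrable_imp_integrable[OF F_meas h_int]) (use F_le in auto)
  have F_intn: "F integrable_on {0..real n}" for n
    by (rule integrable_on_subinterval[OF F_int]) auto
  have lim1: "(\<lambda>n. integral {0..real n} F) \<longlonglongrightarrow> integral {0..} F"
  proof -
    have "(\<lambda>n. integral {0..} (\<lambda>u. if u \<in> {0..real n} then F u else 0)) \<longlonglongrightarrow> integral {0..} F"
    proof (rule dominated_convergence(2)[OF _ h_int])
      fix n
      show "(\<lambda>u. if u \<in> {0..real n} then F u else 0) integrable_on {0..}"
        using F_intn[of n] by (subst integrable_restrict_Int) (auto simp: Int_absorb1 Int_commute)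
      fix u :: real assume "u \<in> {0..}"
      thus "norm (if u \<in> {0..real n} then F u else 0) \<le> h u" using F_le h_nonneg by auto
    next
      fix u :: real assume u: "u \<in> {0..}"
      have "\<forall>\<^sub>F n in sequentially. u \<le> real n"
        using filterlim_real_sequentially by (auto simp: filterlim_at_top)
      hence "\<forall>\<^sub>F n in sequentially. (if u \<in> {0..real n} then F u else 0) = F u"
        by eventually_elim (use u in auto)
      thus "(\<lambda>n. if u \<in> {0..real n} then F u else 0) \<longlonglongrightarrow> F u" by (rule tendsto_eventually)
    qed
    moreover have "integral {0..} (\<lambda>u. if u \<in> {0..real n} then F u else 0) = integral {0..real n} F" for n
      by (subst integral_restrict_Int) (auto intro!: arg_cong2[where f = integral])
    ultimately show ?thesis by simp
  qed
  have swap: "integral {0..real n} F = integral {0..1} (J n)" for n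
  proof -
    have "integral (cbox 0 (real n)) (\<lambda>u. integral (cbox 0 1) (\<lambda>s. of_real (u * exp_quot (u * s)) * exp (- z * of_real u))) =
          integral (cbox 0 1) (\<lambda>s. integral (cbox 0 (real n)) (\<lambda>u. of_real (u * exp_quot (u * s)) * exp (- z * of_real u)))"
      by (rule integral_swap_continuous) (auto intro!: continuous_intros simp: case_prod_unfold)
    moreover have "integral (cbox 0 1) (\<lambda>s. of_real (u * exp_quot (u * s)) * exp (- z * of_real u)) = F u" for u
    proof -
      have "((\<lambda>s. u * exp_quot (u * s)) has_integral ein u) {0..1}"
        unfolding ein_def by (intro integrable_integral integrable_continuous_interval continuous_intros)
      from has_integral_mult_left[OF has_integral_of_real[OF this], of "exp (- z * of_real u)"]
      show ?thesis unfolding F_def cbox_interval by (rule integral_unique)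
    qed
    ultimately show ?thesis by (simp add: J_def)
  qed
  have J_cont: "continuous_on {0..1} (J n)" for n
  proof -
    have "continuous_on {0..1} (\<lambda>s. integral (cbox 0 (real n)) (\<lambda>u. of_real (u * exp_quot (u * s)) * exp (- z * of_real u)))"
      by (rule integral_continuous_on_param) (auto intro!: continuous_intros simp: case_prod_unfold)
    thus ?thesis by (simp add: J_def[abs_def])
  qed
  have J_bound: "norm (J n s) \<le> C" if s: "s \<ge> 0" for n s
  proof -
    have "norm (J n s) \<le> integral {0..real n} h"
      unfolding J_def
    proof (rule integral_norm_bound_integral)
      show "(\<lambda>u. of_real (u * exp_quot (u * s)) * exp (- z * of_real u)) integrable_on {0..real n}"
        by (intro integrable_continuous_interval continuous_intros)
      show "h integrable_on {0..real n}" by (rule integrable_on_subinterval[OF h_int]) auto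
      fix u assume u: "u \<in> {0..real n}"
      hence "\<bar>u * exp_quot (u * s)\<bar> \<le> u * 1"
        unfolding abs_mult using exp_quot_nonneg[of "u * s"] exp_quot_le_1[of "u * s"] s by (intro mult_mono) auto
      thus "norm (of_real (u * exp_quot (u * s)) * exp (- z * of_real u)) \<le> h u"
        unfolding norm_mult[where 'a = complex] norm_exp_mult_of_real norm_of_real h_def x_def by (intro mult_right_mono) auto
    qed
    also have "\<dots> \<le> C" unfolding C_def
      by (rule integral_subset_le) (use h_int h_nonneg in \<open>auto intro: integrable_on_subinterval\<close>)
    finally show ?thesis .
  qed
  have J_lim: "(\<lambda>n. J n s) \<longlonglongrightarrow> 1 / (z * (z + of_real s))" if s: "0 < s" for s
  proof -
    define w where "w = z + of_real s"
    have w: "Re w > 0" "w \<noteq> 0" using z s by (auto simp: w_def complex_eq_iff)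
    define A where "A = (\<lambda>u. (- exp (- z * of_real u) / z + exp (- w * of_real u) / w) / of_real s)"
    have "J n s = A (real n) - A 0" for n
    proof -
      have "((\<lambda>u. of_real (u * exp_quot (u * s)) * exp (- z * of_real u)) has_integral (A (real n) - A 0)) {0..real n}"
      proof (rule fundamental_theorem_of_calculus)
        fix u assume "u \<in> {0..real n}"
        have "((\<lambda>v. (- exp (- z * v) / z + exp (- w * v) / w) / of_real s) has_field_derivative
            (exp (- z * of_real u) - exp (- w * of_real u)) / of_real s) (at (of_real u))"
          using z0 w s by (auto intro!: derivative_eq_intros simp: field_simps)
        hence "(A has_vector_derivative (exp (- z * of_real u) - exp (- w * of_real u)) / of_real s) (at u within {0..real n})"
          unfolding A_def by (rule has_vector_derivative_real_field)
        moreover have "(exp (- z * of_real u) - exp (- w * of_real u)) / of_real s = of_real (u * exp_quot (u * s)) * exp (- z * of_real u)"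
        proof -
          have e1: "exp (- w * of_real u) = of_real (exp (- (u * s))) * exp (- z * of_real u)"
            unfolding exp_of_real[symmetric] exp_add[symmetric] by (simp add: w_def algebra_simps)
          have e2: "of_real (u * exp_quot (u * s)) = (1 - of_real (exp (- (u * s)))) / (of_real s :: complex)"
          proof -
            have "u * exp_quot (u * s) = (1 - exp (- (u * s))) / s" using s by (auto simp: exp_quot_def)
            thus ?thesis by simp
          qed
          show ?thesis unfolding e1 e2 by (simp only: left_diff_distrib times_divide_eq_left mult_1_left)
        qed
        ultimately show "(A has_vector_derivative of_real (u * exp_quot (u * s)) * exp (- z * of_real u)) (at u within {0..real n})" by simp
      qed simp
      thus ?thesis by (simp add: J_def integral_unique)
    qed
    moreover have "(\<lambda>n. A (real n) - A 0) \<longlonglongrightarrow> 1 / (z * (z + of_real s))"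
    proof -
      have e0: "(\<lambda>n. exp (- v * of_real (real n))) \<longlonglongrightarrow> 0" if "Re v > 0" for v
      proof (rule tendsto_norm_zero_cancel)
        have "(\<lambda>n. exp (- Re v * real n)) \<longlonglongrightarrow> 0" using that by real_asymp
        thus "(\<lambda>n. norm (exp (- v * of_real (real n)))) \<longlonglongrightarrow> 0" unfolding norm_exp_mult_of_real .
      qed
      have "(\<lambda>n. A (real n) - A 0) \<longlonglongrightarrow> (- 0 / z + 0 / w) / of_real s - A 0"
        unfolding A_def using z z0 w s by (intro tendsto_intros e0) auto
      also have "(- 0 / z + 0 / w) / of_real s - A 0 = 1 / (z * (z + of_real s))"
      proof -
        have "(- 0 / z + 0 / w) / of_real s - A 0 = (1 / z - 1 / w) / of_real s" by (simp add: A_def diff_divide_distrib)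
        also have "1 / z - 1 / w = of_real s / (z * w)" using z0 w by (simp add: field_simps w_def)
        finally show ?thesis using s by (simp add: w_def)
      qed
      finally show ?thesis .
    qed
    ultimately show ?thesis by simp
  qed
  \<comment> \<open>The limit of \<open>J\<close> was computed for \<open>s > 0\<close> only, as the
    antiderivative \<open>A\<close> divides by \<open>s\<close>; passing to the open interval
    discards the endpoints.\<close>
  have lim2: "(\<lambda>n. integral {0<..<1} (J n)) \<longlonglongrightarrow> integral {0<..<1} (\<lambda>s. 1 / (z * (z + of_real s)))"
  proof (rule dominated_convergence(2))
    show "J n integrable_on {0<..<1}" for n
      using integrable_continuous_interval[OF J_cont[of n]] integrable_on_Icc_iff_Ioo by blast
    show "(\<lambda>_. C) integrable_on {0<..<1::real}"
      using integrable_const_ivl[of C 0 "1::real"] integrable_on_Icc_iff_Ioo by blast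
  qed (use J_bound J_lim in auto)
  have int_Ioo: "integral {0<..<1} f = integral {0..1} f" for f :: "real \<Rightarrow> complex"
    using integral_open_interval[of 0 1 f] by simp
  have ftc: "((\<lambda>s. 1 / (z * (z + of_real s))) has_integral (Ln (z + of_real 1) / z - Ln (z + of_real 0) / z)) {0..1}"
  proof (rule fundamental_theorem_of_calculus)
    fix s :: real assume s: "s \<in> {0..1}"
    have "z + of_real s \<notin> \<real>\<^sub>\<le>\<^sub>0" "z + of_real s \<noteq> 0" using s z by (auto simp: complex_nonpos_Reals_iff complex_eq_iff)
    hence "((\<lambda>v. Ln (z + v) / z) has_field_derivative 1 / (z * (z + of_real s))) (at (of_real s))"
      by (auto intro!: derivative_eq_intros simp: divide_inverse inverse_mult_distrib mult.commute)
    thus "((\<lambda>s. Ln (z + of_real s) / z) has_vector_derivative 1 / (z * (z + of_real s))) (at s within {0..1})"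
      by (rule has_vector_derivative_real_field)
  qed simp
  have "(\<lambda>n. integral {0..real n} F) \<longlonglongrightarrow> Ln (z + of_real 1) / z - Ln (z + of_real 0) / z"
    using lim2 unfolding swap int_Ioo integral_unique[OF ftc] .
  with lim1 have "integral {0..} F = Ln (z + of_real 1) / z - Ln (z + of_real 0) / z" by (rule LIMSEQ_unique)
  also have "\<dots> = (Ln (1 + z) - Ln z) / z" by (simp add: diff_divide_distrib add.commute)
  finally show ?thesis using F_int unfolding F_def by (metis integrable_integral)
qed

text \<open>Each prime contributes a step of height \<open>1/p\<close> at \<open>u = ln p\<close>,
  with transform \<open>p^(-1-z) / z\<close>. Summation over all primes is dominated convergence;
  the majorant \<open>(u + C) exp(- Re z u)\<close> comes from the boundedness of
  \<open>mertens_dev\<close> and \<open>ein u \<le> u\<close>.\<close>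

lemma laplace_prime_recip_has_integral:
  assumes z: "Re z > 0"
  shows "((\<lambda>u. of_real (prime_recip (exp u)) * exp (- z * of_real u)) has_integral (prime_sum z / z)) {0..}"
proof -
  define x where "x = Re z"
  have x: "x > 0" and z0: "z \<noteq> 0" using z by (auto simp: x_def)
  obtain B where B: "\<And>u. u \<ge> 0 \<Longrightarrow> \<bar>mertens_dev u\<bar> \<le> B" using mertens_dev_bounded by blast
  define C where "C = B + \<bar>Re (prime_corr 0)\<bar>"
  have S_le: "prime_recip (exp u) \<le> u + C" if "u \<ge> 0" for u
    using B[OF that] ein_bounds[OF that] by (simp add: C_def mertens_dev_def)
  define h where "h = (\<lambda>u. u * exp (- x * u) + C * exp (- x * u))"
  have h_int: "h integrable_on {0..}" unfolding h_def
    using has_integral_exp_minus_to_infinity[OF x, of 0]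
    by (intro integrable_add has_integral_mult_exp_infinity(1)[OF x] integrable_on_mult_right) blast
  define P where "P = (\<lambda>n u. \<Sum>p | prime p \<and> p \<le> n \<and> real p \<le> exp u. 1 / real p)"
  have finP: "finite {p::nat. prime p \<and> p \<le> n}" for n by (rule finite_subset[of _ "{..n}"]) auto
  have P_eq: "of_real (P n u) * exp (- z * of_real u) = (\<Sum>p | prime p \<and> p \<le> n. if u \<in> {ln (real p)..} then of_real (1 / real p) * exp (- z * of_real u) else 0)" 
    (is "_ = ?R") for n u
  proof -
    have "ln (real p) \<le> u \<longleftrightarrow> real p \<le> exp u" if "prime p" for p
      using prime_gt_0_nat[OF that] by (metis exp_le_cancel_iff exp_ln of_nat_0_less_iff)
    hence "?R = (\<Sum>p | prime p \<and> p \<le> n. if real p \<le> exp u then of_real (1 / real p) * exp (- z * of_real u) else 0)"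
      by (intro sum.cong) auto
    also have "\<dots> = (\<Sum>p\<in>{p. prime p \<and> p \<le> n} \<inter> {p. real p \<le> exp u}. of_real (1 / real p) * exp (- z * of_real u))"
      by (subst sum.inter_restrict[OF finP]) simp
    also have "{p. prime p \<and> p \<le> n} \<inter> {p. real p \<le> exp u} = {p. prime p \<and> p \<le> n \<and> real p \<le> exp u}" by auto
    finally show ?thesis by (simp add: P_def sum_distrib_right)
  qed
  have trm: "((\<lambda>u. if u \<in> {ln (real p)..} then of_real (1 / real p) * exp (- z * of_real u) else 0) has_integral 
        of_nat p powr (-1 - z) / z) {0..}" if p: "prime p" for p
  proof -
    have p1: "real p \<ge> 1" using prime_ge_1_nat[OF p] by simp
    have "((\<lambda>u. of_real (1 / real p) * exp (- z * of_real u)) has_integral (of_real (1 / real p) * (exp (- z * of_real (ln (real p))) / z))) {ln (real p)..}"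
      using p1 by (intro has_integral_mult_right laplace_exp_tail z) auto
    also have "of_real (1 / real p) * (exp (- z * of_real (ln (real p))) / z) = of_nat p powr (-1 - z) / z"
    proof -
      have "of_nat p powr (-1 - z) = exp (- of_real (ln (real p)) + - z * of_real (ln (real p)))"
        using p1 by (simp add: powr_def Ln_of_nat algebra_simps)
      also have "\<dots> = of_real (1 / real p) * exp (- z * of_real (ln (real p)))"
      proof -
        have "exp (of_real (ln (real p))) = (of_nat p :: complex)" using p1 by (simp add: exp_of_real)
        thus ?thesis unfolding exp_add by (simp add: exp_minus inverse_eq_divide)
      qed
      finally show ?thesis by simp
    qed
    finally show ?thesis using p1 by (subst has_integral_restrict) auto
  qed
  have P_int: "((\<lambda>u. of_real (P n u) * exp (- z * of_real u)) has_integral (\<Sum>p | prime p \<and> p \<le> n. of_nat p powr (-1 - z) / z)) {0..}" for n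
    unfolding P_eq by (intro has_integral_sum finP trm) auto
  have P_le: "P n u \<le> prime_recip (exp u)" "P n u \<ge> 0" for n u
    unfolding P_def prime_recip_def by (intro sum_mono2 sum_nonneg; auto)+
  have le: "norm (of_real (P n u) * exp (- z * of_real u)) \<le> h u" if u: "u \<in> {0..}" for n u
  proof -
    have "norm (of_real (P n u) * exp (- z * of_real u)) \<le> (u + C) * exp (- x * u)"
      unfolding norm_mult norm_exp_mult_of_real norm_of_real x_def
      using P_le[of n u] S_le[of u] u by (intro mult_right_mono) auto
    thus ?thesis by (simp add: h_def algebra_simps)
  qed
  have conv: "(\<lambda>n. of_real (P n u) * exp (- z * of_real u)) \<longlonglongrightarrow> of_real (prime_recip (exp u)) * exp (- z * of_real u)" for u
  proof -
    have "\<forall>\<^sub>F n in sequentially. exp u \<le> real n"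
      using filterlim_real_sequentially by (auto simp: filterlim_at_top)
    hence "\<forall>\<^sub>F n in sequentially. of_real (P n u) * exp (- z * of_real u) = of_real (prime_recip (exp u)) * exp (- z * of_real u)"
    proof eventually_elim
      case (elim n)
      hence "{p. prime p \<and> p \<le> n \<and> real p \<le> exp u} = {p. prime p \<and> real p \<le> exp u}" by auto
      thus ?case by (simp add: P_def prime_recip_def)
    qed
    thus ?thesis by (rule tendsto_eventually)
  qed
  note dc = dominated_convergence[OF has_integral_integrable[OF P_int] h_int le conv]
  have "((\<lambda>A. \<Sum>p\<in>A. of_nat p powr (-1 - z)) \<longlongrightarrow> prime_sum z) (finite_subsets_at_top {p::nat. prime p})"
    using has_sum_infsum[OF dirichlet_summable_on[OF z]] unfolding prime_sum_def has_sum_def .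
  \<comment> \<open>The primes up to \<open>n\<close> eventually contain any finite set of primes,
    so the unordered sum becomes a sequential limit.\<close>
  moreover have "filterlim (\<lambda>n. {p. prime p \<and> p \<le> n}) (finite_subsets_at_top {p::nat. prime p}) sequentially"
    unfolding filterlim_finite_subsets_at_top
  proof (intro allI impI)
    fix X :: "nat set" assume X: "finite X \<and> X \<subseteq> {p. prime p}"
    then obtain m where m: "\<forall>p\<in>X. p \<le> m" using finite_nat_set_iff_bounded_le by blast
    show "\<forall>\<^sub>F n in sequentially. finite {p. prime p \<and> p \<le> n} \<and> X \<subseteq> {p. prime p \<and> p \<le> n} \<and> {p. prime p \<and> p \<le> n} \<subseteq> {p. prime p}"
      using eventually_ge_at_top[of m]
    proof eventually_elim
      case (elim n)
      have "p \<le> n" if "p \<in> X" for p using that m elim order_trans by blast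
      thus ?case using X finP by auto
    qed
  qed
  ultimately have "(\<lambda>n. \<Sum>p | prime p \<and> p \<le> n. of_nat p powr (-1 - z)) \<longlonglongrightarrow> prime_sum z"
    by (rule filterlim_compose)
  hence "(\<lambda>n. (\<Sum>p | prime p \<and> p \<le> n. of_nat p powr (-1 - z)) / z) \<longlonglongrightarrow> prime_sum z / z"
    using z0 by (intro tendsto_intros)
  hence "(\<lambda>n. integral {0..} (\<lambda>u. of_real (P n u) * exp (- z * of_real u))) \<longlonglongrightarrow> prime_sum z / z"
    using integral_unique[OF P_int] by (simp add: sum_divide_distrib)
  with dc(2) have "integral {0..} (\<lambda>u. of_real (prime_recip (exp u)) * exp (- z * of_real u)) = prime_sum z / z"
    by (rule LIMSEQ_unique)
  thus ?thesis using dc(1) by (metis integrable_integral)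
qed

lemma laplace_mertens_dev:
  assumes z: "Re z > 0"
  shows "laplace mertens_dev z = (prime_sum z - (Ln (1 + z) - Ln z) - of_real (Re (prime_corr 0))) / z"
proof -
  have "((\<lambda>u. of_real (Re (prime_corr 0)) * exp (- z * of_real u)) has_integral (of_real (Re (prime_corr 0)) * (exp (- z * of_real 0) / z))) {0..}"
    by (intro has_integral_mult_right laplace_exp_tail z) auto
  from has_integral_diff[OF has_integral_diff[OF laplace_prime_recip_has_integral[OF z] laplace_ein_has_integral[OF z]] this]
  have "((\<lambda>u. of_real (mertens_dev u) * exp (- z * of_real u)) has_integral 
      (prime_sum z / z - (Ln (1 + z) - Ln z) / z - of_real (Re (prime_corr 0)) * (exp (- z * of_real 0) / z))) {0..}"
    by (simp add: mertens_dev_def algebra_simps)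
  thus ?thesis unfolding laplace_def by (simp add: integral_unique diff_divide_distrib)
qed

section \<open>Continuation to the left of the imaginary axis and decay of the error\<close>

lemma power_le_exp:
  fixes y :: real
  assumes "y \<ge> 0"
  shows "y ^ m \<le> fact m * exp y"
proof -
  have "y ^ m / fact m \<le> (\<Sum>k\<le>m. y ^ k / fact k)"
    using assms by (intro member_le_sum) auto
  also have "\<dots> \<le> exp y"
    unfolding exp_def using assms summable_exp_generic[of y]
    by (intro order_trans[OF sum_le_suminf[of "\<lambda>k. y ^ k / fact k" "{..m}"]])
       (auto simp: divide_inverse mult.commute)
  finally show ?thesis by (simp add: field_simps)
qed

text \<open>The real part is at most \<open>norm w + 2\<close> in absolute value because
  \<open>norm w \<ge> 1/2\<close>, and the argument is at most \<open>\<pi> < 4\<close>.\<close>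

lemma norm_Ln_bound:
  assumes "Re w \<ge> 1/2"
  shows "norm (Ln w) \<le> norm w + 6"
proof -
  have nw: "norm w \<ge> 1/2" using assms complex_Re_le_cmod[of w] by linarith
  hence w0: "w \<noteq> 0" by auto
  have "ln (norm w) \<le> norm w" using nw ln_le_minus_one[of "norm w"] by linarith
  moreover have "- ln (norm w) \<le> 2"
  proof -
    have "- ln (norm w) = ln (1 / norm w)" using nw by (simp add: ln_div)
    also have "\<dots> \<le> 1 / norm w - 1" using nw by (intro ln_le_minus_one) auto
    also have "\<dots> \<le> 2"
    proof -
      have "1 / norm w \<le> 1 / (1/2)" using nw by (intro divide_left_mono) auto
      thus ?thesis by simp
    qed
    finally show ?thesis .
  qed
  moreover have "\<bar>Im (Ln w)\<bar> \<le> 4"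
    using Im_Ln_le_pi[OF w0] mpi_less_Im_Ln[OF w0] pi_less_4 by linarith
  ultimately show ?thesis using cmod_le[of "Ln w"] nw w0 by (simp add: abs_le_iff) linarith
qed

text \<open>The numerator \<open>L z - Ln (1 + z) + prime_corr z - prime_corr 0\<close> vanishes at
  \<open>0\<close>, so division by \<open>z\<close> creates no pole. The bound is claimed only on
  the part of the contour where \<open>norm z \<ge> \<eta>/2\<close>, and there the numerator is at
  most linear in \<open>T\<close> apart from the term controlled by \<open>norm z\<close>
  itself.\<close>

lemma mertens_dev_continuation:
  assumes e: "0 < e" "e < 1"
  obtains k C where "k > 0" "k \<le> 1/4" "C \<ge> 0"
    "\<And>T \<eta>. T \<ge> 1 \<Longrightarrow> \<eta> = k * (2 + T) powr (-e) \<Longrightarrow>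
       \<exists>g. g holomorphic_on {z. Re z > - \<eta> \<and> \<bar>Im z\<bar> < T + 1} \<and>
         (\<forall>z. Re z > 0 \<longrightarrow> \<bar>Im z\<bar> < T + 1 \<longrightarrow> g z = laplace mertens_dev z) \<and>
         (\<forall>z. - \<eta> / 2 \<le> Re z \<longrightarrow> Re z \<le> 0 \<longrightarrow> \<bar>Im z\<bar> \<le> T \<longrightarrow> Re z = - \<eta> / 2 \<or> \<bar>Im z\<bar> = T \<longrightarrow>
            norm (g z) \<le> C * (2 + T) / \<eta>)"
proof -
  obtain k C1 where kC: "k > 0" "k \<le> 1/4" "C1 > 0"
    "\<And>T. T \<ge> 1 \<Longrightarrow> \<exists>L. L holomorphic_on {z. Re z > - k * (2 + T) powr (-e) \<and> \<bar>Im z\<bar> < T + 1} \<and> L 0 = 0 \<and>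
       (\<forall>z. Re z > 0 \<longrightarrow> \<bar>Im z\<bar> < T + 1 \<longrightarrow> L z = prime_sum z - prime_corr z + Ln z) \<and>
       (\<forall>z. Re z > - k * (2 + T) powr (-e) \<longrightarrow> \<bar>Im z\<bar> < T + 1 \<longrightarrow> Re z \<le> 1 \<longrightarrow> 
            norm (L z) \<le> C1 * (2 + T) powr e * norm z)"
    by (rule zeta_log_strip[OF e]) (rule that)
  obtain C2 where C2: "\<And>z. Re z \<ge> -1/4 \<Longrightarrow> norm (prime_corr z) \<le> C2" by (rule prime_corr_bounded) blast
  have C2_nonneg: "C2 \<ge> 0" by (rule order_trans[OF norm_ge_zero C2[of 0]]) simp
  show ?thesis
  proof (rule that[OF kC(1,2), of "C1 + 2 * (8 + 2 * C2)"])
    show "C1 + 2 * (8 + 2 * C2) \<ge> 0" using kC C2_nonneg by simp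
    fix T \<eta> :: real assume T: "T \<ge> 1" and \<eta>_def: "\<eta> = k * (2 + T) powr (-e)"
    have "(2 + T) powr (-e) \<le> (2 + T) powr 0" using T e by (intro powr_mono) auto
    hence "\<eta> \<le> k * 1" unfolding \<eta>_def using kC T by (intro mult_left_mono) auto
    moreover have "\<eta> > 0" using kC T by (simp add: \<eta>_def)
    ultimately have \<eta>: "\<eta> > 0" "\<eta> \<le> 1/4" using kC by linarith+
    define U where "U = {z. Re z > - \<eta> \<and> \<bar>Im z\<bar> < T + 1}"
    obtain L where L: "L holomorphic_on U" "L 0 = 0"
      "\<And>z. Re z > 0 \<Longrightarrow> \<bar>Im z\<bar> < T + 1 \<Longrightarrow> L z = prime_sum z - prime_corr z + Ln z"
      "\<And>z. z \<in> U \<Longrightarrow> Re z \<le> 1 \<Longrightarrow> norm (L z) \<le> C1 * (2 + T) powr e * norm z"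
      using kC(4)[OF T] unfolding U_def \<eta>_def by auto
    have U_eq: "U = {z. Re z > -\<eta>} \<inter> {z. Im z < T + 1} \<inter> {z. Im z > -(T + 1)}" by (auto simp: U_def)
    have U: "open U"
      unfolding U_eq by (intro open_Int open_halfspace_Re_gt open_halfspace_Im_gt open_halfspace_Im_lt)
    have 0: "0 \<in> U" using \<eta> T by (auto simp: U_def)
    define h where "h = (\<lambda>z. L z - Ln (1 + z) + prime_corr z - prime_corr 0)"
    \<comment> \<open>The value at \<open>0\<close> fills the removable singularity.\<close>
    define g where "g = (\<lambda>z. if z = 0 then deriv h 0 else h z / z)"
    have "prime_corr holomorphic_on U"
      by (rule holomorphic_on_subset[OF prime_corr_holomorphic]) (use \<eta> in \<open>auto simp: U_def\<close>)
    hence h_hol: "h holomorphic_on U" unfolding h_def using L(1) \<eta>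
      by (intro holomorphic_intros) (auto simp: complex_nonpos_Reals_iff U_def)
    have h0: "h 0 = 0" by (simp add: h_def L)
    have g_hol: "g holomorphic_on U"
      by (rule pole_theorem_open_0[OF h_hol U, where a = 0]) (auto simp: g_def h0)
    have Re0: "of_real (Re (prime_corr 0)) = prime_corr 0"
      using prime_corr_of_real[of 0] by simp
    have g_eq: "g z = laplace mertens_dev z" if "Re z > 0" "\<bar>Im z\<bar> < T + 1" for z
    proof -
      have "z \<noteq> 0" using that by auto
      hence "g z = (prime_sum z - prime_corr z + Ln z - Ln (1 + z) + prime_corr z - prime_corr 0) / z"
        using that by (simp add: g_def h_def L(3))
      thus ?thesis unfolding laplace_mertens_dev[OF that(1)] Re0 by simp
    qed
    have g_bound: "norm (g z) \<le> (C1 + 2 * (8 + 2 * C2)) * (2 + T) / \<eta>"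
      if z: "- \<eta> / 2 \<le> Re z" "Re z \<le> 0" "\<bar>Im z\<bar> \<le> T" "Re z = - \<eta> / 2 \<or> \<bar>Im z\<bar> = T" for z
    proof -
      have zU: "z \<in> U" using z \<eta> by (auto simp: U_def)
      have nz: "norm z \<ge> \<eta> / 2" using z \<eta> T abs_Re_le_cmod[of z] abs_Im_le_cmod[of z] by auto
      hence z0: "z \<noteq> 0" using \<eta> by auto
      have "norm (L z) \<le> C1 * (2 + T) powr e * norm z" using L(4)[OF zU] z by simp
      also have "\<dots> \<le> C1 * (2 + T) powr 1 * norm z"
        using e T kC by (intro mult_right_mono mult_left_mono powr_mono) auto
      finally have 1: "norm (L z) / norm z \<le> C1 * (2 + T)" using T z0 by (simp add: divide_le_eq)
      have "norm (1 + z) \<le> 1 + (\<bar>Re z\<bar> + \<bar>Im z\<bar>)" using norm_triangle_ineq[of 1 z] cmod_le[of z] by simp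
      hence "norm (Ln (1 + z)) \<le> 8 + T" using norm_Ln_bound[of "1 + z"] z \<eta> by simp
      moreover have "norm (prime_corr z) \<le> C2" "norm (prime_corr 0) \<le> C2" using z \<eta> by (auto intro!: C2)
      ultimately have "norm (Ln (1 + z)) + norm (prime_corr z) + norm (prime_corr 0) \<le> 8 + T + 2 * C2" by simp
      also have "\<dots> \<le> (8 + 2 * C2) * (2 + T)" using T C2_nonneg
        by (simp add: algebra_simps mult_nonneg_nonneg add_nonneg_nonneg)
      finally have "(norm (Ln (1 + z)) + norm (prime_corr z) + norm (prime_corr 0)) / norm z \<le> (8 + 2 * C2) * (2 + T) / (\<eta> / 2)"
        using nz \<eta> T C2_nonneg by (intro frac_le) auto
      also have "(8 + 2 * C2) * (2 + T) / (\<eta> / 2) = 2 * (8 + 2 * C2) * (2 + T) / \<eta>" by simp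
      finally have 2: "(norm (Ln (1 + z)) + norm (prime_corr z) + norm (prime_corr 0)) / norm z \<le> 2 * (8 + 2 * C2) * (2 + T) / \<eta>" .
      have "norm (h z) \<le> norm (L z) + norm (Ln (1 + z)) + norm (prime_corr z) + norm (prime_corr 0)"
      proof -
        have "norm (a - b + c - d) \<le> norm a + norm b + norm c + norm d" for a b c d :: complex
          using norm_triangle_ineq4[of "a - b + c" d] norm_triangle_ineq[of "a - b" c] norm_triangle_ineq4[of a b] by linarith
        thus ?thesis unfolding h_def .
      qed
      hence "norm (g z) \<le> (norm (L z) + norm (Ln (1 + z)) + norm (prime_corr z) + norm (prime_corr 0)) / norm z"
        using z0 by (simp add: g_def norm_divide divide_right_mono)
      also have "\<dots> = norm (L z) / norm z + (norm (Ln (1 + z)) + norm (prime_corr z) + norm (prime_corr 0)) / norm z"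
        by (simp add: add_divide_distrib)
      also have "\<dots> \<le> C1 * (2 + T) + 2 * (8 + 2 * C2) * (2 + T) / \<eta>" using 1 2 by linarith
      also have "C1 * (2 + T) \<le> C1 * (2 + T) / \<eta>"
        using \<eta> kC T by (simp add: le_divide_eq mult_left_le)
      finally show ?thesis by (simp add: add_divide_distrib ring_distribs)
    qed
    show "\<exists>g. g holomorphic_on {z. Re z > - \<eta> \<and> \<bar>Im z\<bar> < T + 1} \<and>
         (\<forall>z. Re z > 0 \<longrightarrow> \<bar>Im z\<bar> < T + 1 \<longrightarrow> g z = laplace mertens_dev z) \<and>
         (\<forall>z. - \<eta> / 2 \<le> Re z \<longrightarrow> Re z \<le> 0 \<longrightarrow> \<bar>Im z\<bar> \<le> T \<longrightarrow> Re z = - \<eta> / 2 \<or> \<bar>Im z\<bar> = T \<longrightarrow>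
            norm (g z) \<le> (C1 + 2 * (8 + 2 * C2)) * (2 + T) / \<eta>)"
      using g_hol g_eq g_bound unfolding U_def by blast
  qed
qed

lemma mertens_dev_integrable: "mertens_dev integrable_on {a..b}" if "a \<ge> 0"
proof -
  obtain B where B: "\<And>u. u \<ge> 0 \<Longrightarrow> \<bar>mertens_dev u\<bar> \<le> B" using mertens_dev_bounded by blast
  show ?thesis
  proof (rule measurable_bounded_by_integrable_imp_integrable)
    show "mertens_dev \<in> borel_measurable (lebesgue_on {a..b})"
      using mertens_dev_measurable by (intro measurable_restrict_space1 measurable_completion) simp
    show "(\<lambda>_. B) integrable_on {a..b}" by (rule integrable_const_ivl)
  qed (use B that in auto)
qed

lemma mertens_dev_integral_decay:
  fixes A :: nat
  assumes A: "A \<ge> 1"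
  obtains C where "C \<ge> 0" "\<And>X Y. 1 \<le> X \<Longrightarrow> X \<le> Y \<Longrightarrow> \<bar>integral {X..Y} mertens_dev\<bar> \<le> C / X ^ A"
proof -
  obtain B where B: "\<And>u. u \<ge> 0 \<Longrightarrow> \<bar>mertens_dev u\<bar> \<le> B" using mertens_dev_bounded by blast
  have B0: "B \<ge> 0" using B[of 0] by simp
  \<comment> \<open>With the height \<open>T = X^(2A)\<close> chosen below, \<open>T powr e\<close>
    is exactly \<open>sqrt X\<close>.\<close>
  define e where "e = 1 / (4 * real A)"
  have e: "0 < e" "e < 1" using A by (auto simp: e_def field_simps)
  obtain k C where kC: "k > 0" "k \<le> 1/4" "C \<ge> 0"
    "\<And>T \<eta>. T \<ge> 1 \<Longrightarrow> \<eta> = k * (2 + T) powr (-e) \<Longrightarrow>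
       \<exists>g. g holomorphic_on {z. Re z > - \<eta> \<and> \<bar>Im z\<bar> < T + 1} \<and>
         (\<forall>z. Re z > 0 \<longrightarrow> \<bar>Im z\<bar> < T + 1 \<longrightarrow> g z = laplace mertens_dev z) \<and>
         (\<forall>z. - \<eta> / 2 \<le> Re z \<longrightarrow> Re z \<le> 0 \<longrightarrow> \<bar>Im z\<bar> \<le> T \<longrightarrow> Re z = - \<eta> / 2 \<or> \<bar>Im z\<bar> = T \<longrightarrow>
            norm (g z) \<le> C * (2 + T) / \<eta>)"
    by (rule mertens_dev_continuation[OF e]) (rule that)
  \<comment> \<open>The factor \<open>6\<close> is \<open>2\<close> from halving the strip times
    \<open>3\<close> from \<open>2 + T \<le> 3T\<close>; it gives
    \<open>\<eta> \<ge> c / sqrt X\<close>.\<close>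
  define c where "c = k / 6"
  have c: "c > 0" using kC by (simp add: c_def)
  \<comment> \<open>Chosen so that \<open>sqrt X ^ m = X * T^2 * X^A\<close>: the factor
    \<open>X\<close> pays for \<open>1/\<eta>^2\<close>, the factor \<open>T^2\<close> for the
    powers of the height in the last error term, and \<open>X^A\<close> is the saving.\<close>
  define m where "m = 10 * A + 2"
  define C' where "C' = 24 * B + 18 * C + 18 * C / c\<^sup>2 * (fact m / c ^ m)"
  have C'0: "C' \<ge> 0" using B0 kC c by (simp add: C'_def)
  show ?thesis
  proof (rule that[of "2 * C'"])
    show "2 * C' \<ge> 0" using C'0 by simp
    fix X Y :: real assume X: "1 \<le> X" and XY: "X \<le> Y"
    define T where "T = X ^ (2 * A)"
    have T: "T \<ge> 1" using X by (simp add: T_def)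
    define \<eta>' where "\<eta>' = k * (2 + T) powr (-e)"
    define \<eta> where "\<eta> = \<eta>' / 2"
    have "(2 + T) powr (-e) \<le> (2 + T) powr 0" using T e by (intro powr_mono) auto
    hence "\<eta>' \<le> k * 1" unfolding \<eta>'_def using kC T by (intro mult_left_mono) auto
    moreover have "\<eta>' > 0" using kC T by (simp add: \<eta>'_def)
    ultimately have \<eta>': "\<eta>' > 0" "\<eta>' \<le> 1/4" using kC by linarith+
    hence \<eta>: "0 < \<eta>" "\<eta> \<le> 1" "\<eta> \<le> T" "\<eta> < \<eta>'" using T by (auto simp: \<eta>_def)
    have \<eta>_ge: "\<eta> \<ge> c / sqrt X"
    proof -
      have "sqrt X = X powr (1/2)" using X by (simp add: powr_half_sqrt)
      also have "\<dots> = T powr e"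
      proof -
        have "T powr e = (X powr (2 * real A)) powr e" using X by (simp add: T_def powr_realpow[symmetric])
        also have "\<dots> = X powr (1/2)" unfolding powr_powr using A by (simp add: e_def)
        finally show ?thesis by simp
      qed
      finally have sq: "sqrt X = T powr e" .
      have "(2 + T) powr e \<le> (3 * T) powr e" using T e by (intro powr_mono2) auto
      also have "\<dots> = 3 powr e * T powr e" using T by (subst powr_mult) auto
      also have "\<dots> \<le> 3 powr 1 * T powr e" using e by (intro mult_right_mono powr_mono) auto
      finally have "(2 + T) powr e \<le> 3 * sqrt X" unfolding sq by simp
      hence "k / (2 * (3 * sqrt X)) \<le> k / (2 * (2 + T) powr e)"
        using kC T X by (intro divide_left_mono) auto
      also have "\<dots> = \<eta>" by (simp add: \<eta>_def \<eta>'_def powr_minus field_simps)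
      finally show ?thesis by (simp add: c_def)
    qed
    obtain g where g: "g holomorphic_on {z. Re z > - \<eta>' \<and> \<bar>Im z\<bar> < T + 1}"
      "\<And>z. Re z > 0 \<Longrightarrow> \<bar>Im z\<bar> < T + 1 \<Longrightarrow> g z = laplace mertens_dev z"
      "\<And>z. - \<eta>' / 2 \<le> Re z \<Longrightarrow> Re z \<le> 0 \<Longrightarrow> \<bar>Im z\<bar> \<le> T \<Longrightarrow> Re z = - \<eta>' / 2 \<or> \<bar>Im z\<bar> = T \<Longrightarrow>
            norm (g z) \<le> C * (2 + T) / \<eta>'"
      using kC(4)[OF T \<eta>'_def] by auto
    define M where "M = C * (2 + T) / \<eta>'"
    have M: "0 \<le> M" "M \<le> 3 * C * T / \<eta>"
    proof -
      show "0 \<le> M" using kC T \<eta>' by (simp add: M_def)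
      have "M \<le> C * (3 * T) / \<eta>" unfolding M_def using kC T \<eta> \<eta>' by (intro frac_le mult_left_mono) auto
      thus "M \<le> 3 * C * T / \<eta>" by (simp add: mult_ac)
    qed
    \<comment> \<open>Height and strip depend on \<open>X\<close> alone, while the truncation point
      \<open>Z \<ge> X\<close> varies. Hence the same \<open>g 0\<close> occurs for
      \<open>Z = X\<close> and \<open>Z = Y\<close> and cancels in the difference.\<close>
    have bound: "norm (g 0 - of_real (integral {0..Z} mertens_dev)) \<le> C' / X ^ A" if Z: "X \<le> Z" for Z
    proof -
      have t0: "norm (g 0 - of_real (integral {0..Z} mertens_dev)) \<le> 24 * B / T + 6 * M * \<eta>\<^sup>2 / T\<^sup>2 + 6 * M * T * exp (- \<eta> * Z) / \<eta>"
      proof (rule newman_bound[OF mertens_dev_measurable B _ \<eta>(1,3,4) _ _ g(1,2)])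
        show "norm (g z) \<le> M" if "- \<eta> \<le> Re z" "Re z \<le> 0" "\<bar>Im z\<bar> \<le> T" "Re z = - \<eta> \<or> \<bar>Im z\<bar> = T" for z
          unfolding M_def using that by (intro g(3)) (auto simp: \<eta>_def)
      qed (use T X Z in auto)
      have t1: "6 * M * \<eta>\<^sup>2 / T\<^sup>2 \<le> 18 * C / T"
      proof -
        have "6 * M * \<eta>\<^sup>2 / T\<^sup>2 \<le> 6 * (3 * C * T / \<eta>) * \<eta>\<^sup>2 / T\<^sup>2"
          using M by (intro divide_right_mono mult_right_mono mult_left_mono) auto
        also have "\<dots> = 18 * C * \<eta> / T" using \<eta> T by (simp add: power2_eq_square)
        also have "\<dots> \<le> 18 * C * 1 / T" using \<eta> kC T by (intro divide_right_mono mult_left_mono) auto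
        finally show ?thesis by simp
      qed
      have t2: "6 * M * T * exp (- \<eta> * Z) / \<eta> \<le> 18 * C / c\<^sup>2 * (fact m / c ^ m) / X ^ A"
      proof -
        define y where "y = c * sqrt X"
        have y: "y > 0" using c X by (simp add: y_def)
        have "c / sqrt X * X \<le> \<eta> * Z" using \<eta>_ge X Z \<eta> c by (intro mult_mono) auto
        also have "c / sqrt X * X = y"
        proof -
          have "c / s * (s * s) = c * s" if "s \<noteq> 0" for s using that by simp
          from this[of "sqrt X"] show ?thesis using X by (simp add: y_def)
        qed
        finally have "exp (- \<eta> * Z) \<le> exp (- y)" by simp
        also have "\<dots> \<le> fact m / y ^ m"
        proof -
          have "y ^ m \<le> fact m * exp y" using y by (intro power_le_exp) simp
          thus ?thesis using y by (simp add: exp_minus field_simps)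
        qed
        also have "y ^ m = c ^ m * (X * T\<^sup>2 * X ^ A)"
        proof -
          have "sqrt X ^ m = (sqrt X ^ 2) ^ (5 * A + 1)" 
            unfolding power_mult[symmetric] by (rule arg_cong[where f = "\<lambda>n. sqrt X ^ n"]) (simp add: m_def)
          also have "\<dots> = X ^ (5 * A + 1)" using X by simp
          also have "\<dots> = X * T\<^sup>2 * X ^ A"
          proof -
            have "5 * A + 1 = 1 + 2 * A * 2 + A" by simp
            thus ?thesis by (simp only: T_def power_add power_one_right power_mult)
          qed
          finally show ?thesis by (simp add: y_def power_mult_distrib)
        qed
        finally have ex: "exp (- \<eta> * Z) \<le> fact m / (c ^ m * (X * T\<^sup>2 * X ^ A))" .
        have "1 / \<eta>\<^sup>2 \<le> 1 / (c / sqrt X)\<^sup>2"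
          using \<eta>_ge c X \<eta>(1) by (intro divide_left_mono power_mono mult_pos_pos zero_less_power divide_pos_pos) auto
        also have "\<dots> = X / c\<^sup>2" using X by (simp add: power_divide)
        finally have e2: "1 / \<eta>\<^sup>2 \<le> X / c\<^sup>2" .
        have "6 * M * T * exp (- \<eta> * Z) / \<eta> \<le> 6 * (3 * C * T / \<eta>) * T * exp (- \<eta> * Z) / \<eta>"
          using M T \<eta> by (intro divide_right_mono mult_right_mono mult_left_mono) auto
        also have "\<dots> = (18 * C * T\<^sup>2) * (exp (- \<eta> * Z) * (1 / \<eta>\<^sup>2))" by (simp add: power2_eq_square)
        also have "\<dots> \<le> (18 * C * T\<^sup>2) * (fact m / (c ^ m * (X * T\<^sup>2 * X ^ A)) * (X / c\<^sup>2))"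
          using ex e2 kC c X T by (intro mult_left_mono mult_mono) auto
        also have "\<dots> = 18 * C / c\<^sup>2 * (fact m / c ^ m) / X ^ A"
          using X T c by (simp add: field_simps)
        finally show ?thesis .
      qed
      have "X ^ A \<le> T" unfolding T_def using X by (intro power_increasing) auto
      hence "24 * B / T \<le> 24 * B / X ^ A" "18 * C / T \<le> 18 * C / X ^ A"
        using X B0 kC(3) T by (intro divide_left_mono mult_pos_pos zero_less_power; simp)+
      with t0 t1 t2 have "norm (g 0 - of_real (integral {0..Z} mertens_dev)) \<le>
          24 * B / X ^ A + 18 * C / X ^ A + 18 * C / c\<^sup>2 * (fact m / c ^ m) / X ^ A" by linarith
      thus ?thesis by (simp add: C'_def add_divide_distrib)
    qed
    have "integral {0..Y} mertens_dev = integral {0..X} mertens_dev + integral {X..Y} mertens_dev"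
      using X XY by (intro Henstock_Kurzweil_Integration.integral_combine[symmetric] mertens_dev_integrable) auto
    hence "of_real (integral {X..Y} mertens_dev) = (g 0 - of_real (integral {0..X} mertens_dev)) - (g 0 - of_real (integral {0..Y} mertens_dev))"
      by simp
    hence "norm (complex_of_real (integral {X..Y} mertens_dev)) \<le> C' / X ^ A + C' / X ^ A"
      by (simp only:) (intro order_trans[OF norm_triangle_ineq4 add_mono] bound XY order_refl)
    thus "\<bar>integral {X..Y} mertens_dev\<bar> \<le> 2 * C' / X ^ A" by simp
  qed
qed

text \<open>As \<open>ein\<close> has slope at most \<open>1\<close>, \<open>mertens_dev\<close> can
  fall no faster than with slope \<open>-1\<close>. A value of modulus \<open>d\<close> at
  \<open>u\<close> therefore forces a triangle of area \<open>d^2/2\<close> between graph and axis,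
  to the right of \<open>u\<close> if the value is positive and to the left if it is negative. Decay
  of the integral of order \<open>2m + 2\<close> thus gives decay of order \<open>m\<close> after
  taking the square root.\<close>

lemma mertens_dev_decay:
  obtains C where "C \<ge> 0" "\<And>u. u > 0 \<Longrightarrow> \<bar>mertens_dev u\<bar> \<le> C / u ^ m"
proof -
  obtain B where B: "\<And>u. u \<ge> 0 \<Longrightarrow> \<bar>mertens_dev u\<bar> \<le> B" using mertens_dev_bounded by blast
  have B0: "B \<ge> 0" using B[of 0] by simp
  obtain C where C: "C \<ge> 0" "\<And>X Y. 1 \<le> X \<Longrightarrow> X \<le> Y \<Longrightarrow> \<bar>integral {X..Y} mertens_dev\<bar> \<le> C / X ^ (2 * m + 2)"
    using mertens_dev_integral_decay[of "2 * m + 2"] by auto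
  \<comment> \<open>The entry \<open>2 * B\<close> guarantees \<open>d \<le> u/2\<close>, so the
    triangle on the left stays beyond \<open>u/2\<close>; the entry \<open>2\<close> gives
    \<open>u/2 \<ge> 1\<close>, as the integral bound requires.\<close>
  define w where "w = max 2 (2 * B)"
  have w: "w \<ge> 2" "w \<ge> 2 * B" by (auto simp: w_def)
  have almost_mono: "mertens_dev u - (v - u) \<le> mertens_dev v" if "0 \<le> u" "u \<le> v" for u v
    using ein_diff_le[OF that] prime_recip_mono[of "exp u" "exp v"] that by (simp add: mertens_dev_def)
  have large: "(mertens_dev u)\<^sup>2 \<le> 2 * C * (2 / u) ^ (2 * m)" if u: "u \<ge> w" for u
  proof -
    define d where "d = \<bar>mertens_dev u\<bar>"
    have d: "0 \<le> d" "d \<le> B" using B[of u] u w by (auto simp: d_def)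
    have tri: "((\<lambda>v. d - (v - a)) has_integral d\<^sup>2 / 2) {a..a + d}" for a
    proof -
      have "((\<lambda>v. d - (v - a)) has_integral ((d * (a + d) - ((a + d) - a)\<^sup>2 / 2) - (d * a - (a - a)\<^sup>2 / 2))) {a..a + d}"
        using d by (intro fundamental_theorem_of_calculus)
          (auto intro!: derivative_eq_intros simp: field_simps simp flip: has_real_derivative_iff_has_vector_derivative)
      thus ?thesis by (simp add: power2_eq_square algebra_simps)
    qed
    have "d\<^sup>2 / 2 \<le> C / (u / 2) ^ (2 * m + 2)"
    proof (cases "mertens_dev u \<ge> 0")
      case True
      have "d\<^sup>2 / 2 \<le> integral {u..u + d} mertens_dev"
      proof (rule has_integral_le[OF tri integrable_integral])
        show "mertens_dev integrable_on {u..u + d}" using u w by (intro mertens_dev_integrable) auto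
        show "d - (v - u) \<le> mertens_dev v" if "v \<in> {u..u + d}" for v
          using almost_mono[of u v] that True u w by (simp add: d_def)
      qed
      also have "\<dots> \<le> C / u ^ (2 * m + 2)" using C(2)[of u "u + d"] u w d by simp
      also have "\<dots> \<le> C / (u / 2) ^ (2 * m + 2)"
        using C u w by (intro divide_left_mono power_mono mult_pos_pos zero_less_power) auto
      finally show ?thesis .
    next
      case False
      have ud: "u - d \<ge> u / 2" using d u w by simp
      have "((\<lambda>v. d - (u - v)) has_integral d\<^sup>2 / 2) {u - d..u}"
      proof -
        have "((\<lambda>v. d - (u - v)) has_integral ((d * u + (u - u)\<^sup>2 / 2) - (d * (u - d) + (u - (u - d))\<^sup>2 / 2))) {u - d..u}"
          using d by (intro fundamental_theorem_of_calculus)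
            (auto intro!: derivative_eq_intros simp: field_simps simp flip: has_real_derivative_iff_has_vector_derivative)
        thus ?thesis by (simp add: power2_eq_square algebra_simps)
      qed
      moreover have "((\<lambda>v. - mertens_dev v) has_integral - integral {u - d..u} mertens_dev) {u - d..u}"
        using ud u w by (intro has_integral_neg integrable_integral mertens_dev_integrable) auto
      ultimately have "d\<^sup>2 / 2 \<le> - integral {u - d..u} mertens_dev"
      proof (rule has_integral_le)
        show "d - (u - v) \<le> - mertens_dev v" if "v \<in> {u - d..u}" for v
          using almost_mono[of v u] that False ud u w by (simp add: d_def)
      qed
      also have "\<dots> \<le> C / (u - d) ^ (2 * m + 2)" using C(2)[of "u - d" u] ud u w d by simp
      also have "\<dots> \<le> C / (u / 2) ^ (2 * m + 2)"
        using C u w ud by (intro divide_left_mono power_mono mult_pos_pos zero_less_power) auto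
      finally show ?thesis .
    qed
    also have "\<dots> = C * (2 / u) ^ (2 * m + 2)" using u w by (simp add: power_divide field_simps)
    also have "\<dots> \<le> C * (2 / u) ^ (2 * m)"
      using C u w by (intro mult_left_mono power_decreasing) auto
    finally show ?thesis by (simp add: d_def mult_ac)
  qed
  define C' where "C' = max (sqrt (2 * C) * 2 ^ m) (B * w ^ m)"
  show ?thesis
  proof (rule that[of C'])
    show "C' \<ge> 0" using C by (simp add: C'_def le_max_iff_disj)
    fix u :: real assume u: "u > 0"
    show "\<bar>mertens_dev u\<bar> \<le> C' / u ^ m"
    proof (cases "u \<ge> w")
      case True
      have "(2 / u) ^ (2 * m) = ((2 / u) ^ m)\<^sup>2" by (simp add: power_mult[symmetric] mult.commute)
      hence "\<bar>mertens_dev u\<bar> \<le> sqrt (2 * C * ((2 / u) ^ m)\<^sup>2)" using large[OF True] by (simp add: real_le_rsqrt)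
      also have "\<dots> = sqrt (2 * C) * \<bar>(2 / u) ^ m\<bar>" unfolding real_sqrt_mult[of "2 * C"] real_sqrt_abs ..
      also have "\<dots> = sqrt (2 * C) * 2 ^ m / u ^ m" using u by (simp add: power_divide)
      also have "\<dots> \<le> C' / u ^ m" using u by (intro divide_right_mono) (auto simp: C'_def)
      finally show ?thesis .
    next
      case False
      have "\<bar>mertens_dev u\<bar> * u ^ m \<le> B * w ^ m"
        using B[of u] u False B0 by (intro mult_mono power_mono) auto
      also have "\<dots> \<le> C'" by (simp add: C'_def)
      finally show ?thesis using u by (simp add: le_divide_eq)
    qed
  qed
qed

lemma mertens_const_eq: "mertens_const = euler_mascheroni + Re (prime_corr 0)"
proof -
  have "prime_corr 0 = of_real (\<Sum>\<^sub>\<infinity>p\<in>{p::nat. prime p}. real p powr (-1 - 0) + ln (1 - real p powr (-1 - 0)))"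
    using prime_corr_of_real[of 0] by simp
  also have "(\<Sum>\<^sub>\<infinity>p\<in>{p::nat. prime p}. real p powr (-1 - 0) + ln (1 - real p powr (-1 - 0)))
      = (\<Sum>\<^sub>\<infinity>p\<in>{p::nat. prime p}. 1 / real p + ln (1 - 1 / real p))"
    by (rule infsum_cong) (simp add: powr_minus inverse_eq_divide)
  finally show ?thesis unfolding mertens_const_def by simp
qed

lemma mertens_error_eq:
  assumes "x > 1"
  shows "mertens_error x = mertens_dev (ln x) + (ein (ln x) - ln (ln x) - euler_mascheroni)"
  using assms by (simp add: mertens_error_def mertens_dev_def mertens_const_eq loglog_def prime_recip_def)

lemma ln_2_pos: "ln (2::real) > 0" by simp

text \<open>Replacing \<open>ein u\<close> by \<open>ln u + euler_mascheroni\<close> costs at most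
  \<open>exp(-u)\<close> for \<open>u \<ge> 1\<close>, which is below every power of
  \<open>1/u\<close>. Between \<open>ln 2\<close> and \<open>1\<close> boundedness suffices, because
  \<open>u^m \<le> 1\<close> there.\<close>

lemma mertens_error_bound:
  obtains C where "C \<ge> 0" "\<And>x. x \<ge> 2 \<Longrightarrow> \<bar>mertens_error x\<bar> \<le> C / ln x ^ m"
proof -
  obtain C where C: "C \<ge> 0" "\<And>u. u > 0 \<Longrightarrow> \<bar>mertens_dev u\<bar> \<le> C / u ^ m" using mertens_dev_decay by blast
  \<comment> \<open>Bounds \<open>ein u - ln u - euler_mascheroni\<close> for
    \<open>ln 2 \<le> u < 1\<close>, where \<open>ein u\<close> lies in \<open>[0, 1]\<close> and
    \<open>ln u\<close> between \<open>ln (ln 2)\<close> and \<open>0\<close>.\<close>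
  define C2 where "C2 = 1 + \<bar>ln (ln 2)\<bar> + \<bar>euler_mascheroni :: real\<bar>"
  show ?thesis
  proof (rule that[of "C + max (fact m) C2"])
    show "C + max (fact m) C2 \<ge> 0" using C by (simp add: C2_def add_nonneg_nonneg le_max_iff_disj)
    fix x :: real assume x: "x \<ge> 2"
    define u where "u = ln x"
    have u2: "u \<ge> ln 2" unfolding u_def using x by simp
    hence u: "u > 0" using ln_2_pos by linarith
    have "\<bar>ein u - ln u - euler_mascheroni\<bar> \<le> max (fact m) C2 / u ^ m"
    proof (cases "u \<ge> 1")
      case True
      have "u ^ m \<le> fact m * exp u" using u by (intro power_le_exp) simp
      hence "exp (- u) \<le> fact m / u ^ m" using u by (simp add: exp_minus field_simps)
      also have "\<dots> \<le> max (fact m) C2 / u ^ m" using u by (intro divide_right_mono) auto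
      finally show ?thesis using ein_asymp[OF True] by simp
    next
      case False
      have "ln (ln 2) \<le> ln u" using u2 ln_2_pos by (subst ln_le_cancel_iff) (use u in auto)
      moreover have "ln u \<le> 0" using u False by (subst ln_le_zero_iff) auto
      ultimately have "\<bar>ln u\<bar> \<le> \<bar>ln (ln 2)\<bar>" by linarith
      hence "\<bar>ein u - ln u - euler_mascheroni\<bar> \<le> C2" unfolding C2_def using ein_bounds[of u] u False by linarith
      also have "\<dots> \<le> C2 / u ^ m" using u False power_le_one[of u m]
        by (simp add: le_divide_eq mult_left_le C2_def)
      also have "\<dots> \<le> max (fact m) C2 / u ^ m" using u by (intro divide_right_mono) auto
      finally show ?thesis .
    qed
    moreover have "mertens_error x = mertens_dev u + (ein u - ln u - euler_mascheroni)"
      unfolding u_def using x by (intro mertens_error_eq) auto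
    ultimately have "\<bar>mertens_error x\<bar> \<le> C / u ^ m + max (fact m) C2 / u ^ m"
      using C(2)[OF u] by linarith
    thus "\<bar>mertens_error x\<bar> \<le> (C + max (fact m) C2) / ln x ^ m" by (simp add: u_def add_divide_distrib)
  qed
qed

section \<open>The dilogarithm\<close>

definition li2 :: "real \<Rightarrow> real" where
  "li2 w = (\<Sum>n. w ^ Suc n / real (Suc n) ^ 2)"

lemma li2_term_bound:
  assumes "0 \<le> w" "w \<le> 1"
  shows "norm (w ^ Suc n / real (Suc n) ^ 2) \<le> 1 / real (Suc n) ^ 2"
proof -
  have "w ^ Suc n \<le> 1" using assms by (intro power_le_one) auto
  thus ?thesis using assms by (simp add: divide_right_mono)
qed

lemma summable_inverse_squares: "summable (\<lambda>n. 1 / real (Suc n) ^ 2)"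
  using inverse_power_summable[of 2, where 'a = real] summable_Suc_iff[of "\<lambda>n. inverse (real n ^ 2)"]
  by (simp add: inverse_eq_divide)

lemma li2_sums:
  assumes "0 \<le> w" "w \<le> 1"
  shows "(\<lambda>n. w ^ Suc n / real (Suc n) ^ 2) sums li2 w"
  unfolding li2_def
  by (rule summable_sums, rule summable_comparison_test'[OF summable_inverse_squares, of 0])
     (use li2_term_bound[OF assms] in auto)

lemma continuous_li2: "continuous_on {0..1} li2"
proof -
  have "uniform_limit {0..1} (\<lambda>N w. \<Sum>n<N. w ^ Suc n / real (Suc n) ^ 2) (\<lambda>w. \<Sum>n. w ^ Suc n / real (Suc n) ^ 2) sequentially"
    by (rule Weierstrass_m_test[OF _ summable_inverse_squares]) (use li2_term_bound in auto)
  thus ?thesis unfolding li2_def[abs_def]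
    by (rule uniform_limit_theorem[rotated]) (auto intro!: always_eventually continuous_intros simp del: of_nat_Suc)
qed

lemma li2_0 [simp]: "li2 0 = 0"
  by (simp add: li2_def)

lemma li2_1: "li2 1 = zeta 2"
proof -
  have "((\<lambda>n. 1 / real (Suc n) ^ 2) has_sum li2 1) UNIV"
    using norm_summable_imp_has_sum[of "\<lambda>n. 1 / real (Suc n) ^ 2" "li2 1"] summable_inverse_squares li2_sums[of 1]
    by simp
  hence "((\<lambda>n. real n powr (-2)) has_sum li2 1) (range Suc)"
    by (subst has_sum_reindex) (auto simp: o_def powr_minus inverse_eq_divide simp del: of_nat_Suc)
  also have "range Suc = {n. n \<ge> 1}" by (auto simp: image_iff) presburger
  finally show ?thesis unfolding zeta_def by (simp add: infsumI)
qed

lemma ln_minus_series: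
  assumes "\<bar>w\<bar> < (1::real)"
  shows "(\<lambda>n. w ^ Suc n / real (Suc n)) sums (- ln (1 - w))"
proof -
  have "(\<lambda>n. - ((- (-w)) ^ n) / real n) sums ln (1 + (-w))"
    using assms by (intro ln_series') auto
  hence "(\<lambda>n. w ^ n / real n) sums (- ln (1 - w))" using sums_minus by fastforce
  thus ?thesis by (subst sums_Suc_iff) simp
qed

lemma li2_has_derivative:
  assumes w: "0 < w" "w < 1"
  shows "(li2 has_real_derivative (- ln (1 - w) / w)) (at w)"
proof -
  define c where "c = (\<lambda>n. 1 / real n ^ 2)"
  have sm: "summable (\<lambda>n. c n * K ^ n)" if "0 \<le> K" "K < 1" for K
  proof -
    have "summable (\<lambda>n. c (Suc n) * K ^ Suc n)"
      using li2_sums[of K] that by (auto simp: sums_iff c_def)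
    thus ?thesis by (subst (asm) summable_Suc_iff)
  qed
  have li2_eq: "li2 v = (\<Sum>n. c n * v ^ n)" if "0 \<le> v" "v < 1" for v
  proof -
    have "(\<lambda>n. c (Suc n) * v ^ Suc n) sums li2 v" using li2_sums[of v] that by (simp add: c_def)
    hence "(\<lambda>n. c n * v ^ n) sums li2 v" by (subst (asm) sums_Suc_iff) (simp add: c_def)
    thus ?thesis by (simp add: sums_iff)
  qed
  define K where "K = (1 + w) / 2"
  have K: "w < K" "K < 1" using w by (auto simp: K_def)
  have "((\<lambda>v. \<Sum>n. c n * v ^ n) has_real_derivative (\<Sum>n. diffs c n * w ^ n)) (at w)"
    by (rule termdiffs_strong[OF sm[of K]]) (use K w in auto)
  moreover have "(\<Sum>n. diffs c n * w ^ n) = - ln (1 - w) / w"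
  proof -
    have "(\<lambda>n. (w ^ Suc n / real (Suc n)) / w) sums (- ln (1 - w) / w)"
      using w by (intro sums_divide ln_minus_series) auto
    moreover have "(w ^ Suc n / real (Suc n)) / w = diffs c n * w ^ n" for n
      using w by (simp add: diffs_def c_def power2_eq_square del: of_nat_Suc)
    ultimately show ?thesis by (simp add: sums_iff)
  qed
  ultimately have "((\<lambda>v. \<Sum>n. c n * v ^ n) has_real_derivative (- ln (1 - w) / w)) (at w)" by simp
  thus ?thesis
    by (rule has_field_derivative_transform_within_open[of _ _ _ "{0<..<1}"]) (use w li2_eq in auto)
qed

text \<open>Euler's reflection formula: \<open>li2 w + li2 (1 - w) + ln w * ln (1 - w)\<close> has
  derivative \<open>0\<close> on \<open>(0, 1)\<close>. Its constant value is \<open>zeta 2\<close>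
  by the limit at \<open>0\<close>, for which continuity of \<open>li2\<close> up to the endpoint
  \<open>1\<close> is essential; evaluation at \<open>1/2\<close> gives the identity.\<close>

lemma li2_half: "2 * li2 (1/2) + ln 2 ^ 2 = zeta 2"
proof -
  define G where "G = (\<lambda>w. li2 w + li2 (1 - w) + ln w * ln (1 - w))"
  have G': "(G has_real_derivative 0) (at w)" if w: "0 < w" "w < 1" for w
  proof -
    have "((\<lambda>w. li2 (1 - w)) has_real_derivative (- ln (1 - (1 - w)) / (1 - w) * (- 1))) (at w)"
      by (rule DERIV_chain2[OF li2_has_derivative]) (use w in \<open>auto intro!: derivative_eq_intros\<close>)
    hence "(G has_real_derivative (- ln (1 - w) / w + (- ln (1 - (1 - w)) / (1 - w) * (- 1)) + (1 / w * ln (1 - w) + - 1 / (1 - w) * ln w))) (at w)"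
      unfolding G_def using w by (auto intro!: derivative_eq_intros li2_has_derivative)
    moreover have "- ln (1 - w) / w + (- ln (1 - (1 - w)) / (1 - w) * (- 1)) + (1 / w * ln (1 - w) + - 1 / (1 - w) * ln w) = 0" by simp
    ultimately show ?thesis by simp
  qed
  have "\<exists>c. \<forall>w\<in>{0<..<1}. G w = c"
    by (rule has_field_derivative_zero_constant) (use G' in \<open>auto intro: has_field_derivative_at_within\<close>)
  then obtain c where c: "\<And>w. 0 < w \<Longrightarrow> w < 1 \<Longrightarrow> G w = c" by auto
  have 1: "(li2 \<longlongrightarrow> li2 0) (at_right 0)"
    using continuous_li2 unfolding continuous_on_def
    by (metis atLeastAtMost_iff at_within_Icc_at_right order_refl zero_le_one zero_less_one)
  have 2: "(li2 \<longlongrightarrow> li2 1) (at_left 1)"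
    using continuous_li2 unfolding continuous_on_def
    by (metis atLeastAtMost_iff at_within_Icc_at_left order_refl zero_le_one zero_less_one)
  have "((\<lambda>w. li2 (1 - w)) \<longlongrightarrow> li2 1) (at_right (0::real))"
    by (rule filterlim_compose[OF 2]) real_asymp
  moreover have "((\<lambda>w::real. ln w * ln (1 - w)) \<longlongrightarrow> 0) (at_right 0)" by real_asymp
  ultimately have "(G \<longlongrightarrow> li2 0 + li2 1 + 0) (at_right 0)"
    unfolding G_def using 1 by (intro tendsto_add)
  moreover have "(G \<longlongrightarrow> c) (at_right 0)"
  proof (rule tendsto_eventually)
    show "\<forall>\<^sub>F w in at_right 0. G w = c"
      unfolding eventually_at_right_field using c by (intro exI[of _ 1]) auto
  qed
  ultimately have "li2 1 = c" using tendsto_unique[of "at_right (0::real)" G] by fastforce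
  moreover have "G (1/2) = 2 * li2 (1/2) + ln 2 ^ 2"
    by (simp add: G_def power2_eq_square ln_div)
  ultimately show ?thesis using c[of "1/2"] li2_1 by simp
qed

text \<open>Coefficients in \<open>[0, 1]\<close> make one statement serve both the dilogarithm and
  the logarithm; \<open>a \<le> 1/2\<close> bounds the geometric factor \<open>1 / (1 - a)\<close>
  by \<open>2\<close>.\<close>

lemma geometric_tail_bound:
  fixes f :: "nat \<Rightarrow> real"
  assumes a: "0 \<le> a" "a \<le> 1/2" and f: "\<And>n. 0 \<le> f n" "\<And>n. f n \<le> 1" and s: "(\<lambda>n. f n * a ^ Suc n) sums S"
  shows "\<bar>S - (\<Sum>j=1..N. f (j - 1) * a ^ j)\<bar> \<le> 2 * a ^ Suc N"
proof -
  have "(\<Sum>j=1..N. f (j - 1) * a ^ j) = (\<Sum>n<N. f n * a ^ Suc n)"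
    by (rule sum.reindex_bij_witness[of _ Suc "\<lambda>j. j - 1"]) auto
  hence eq: "S - (\<Sum>j=1..N. f (j - 1) * a ^ j) = (\<Sum>n. f (n + N) * a ^ Suc (n + N))"
    using suminf_minus_initial_segment[of "\<lambda>n. f n * a ^ Suc n" N] s by (auto simp: sums_iff)
  have sm: "summable (\<lambda>n. f (n + N) * a ^ Suc (n + N))"
    using s summable_ignore_initial_segment[of "\<lambda>n. f n * a ^ Suc n" N] by (auto simp: sums_iff)
  have g: "(\<lambda>n. a ^ Suc N * a ^ n) sums (a ^ Suc N * (1 / (1 - a)))"
    using a by (intro sums_mult geometric_sums) auto
  have "(\<Sum>n. f (n + N) * a ^ Suc (n + N)) \<le> (\<Sum>n. a ^ Suc N * a ^ n)"
  proof (rule suminf_le[OF _ sm])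
    fix n have "f (n + N) * a ^ Suc (n + N) \<le> 1 * a ^ Suc (n + N)" using f a by (intro mult_right_mono) auto
    thus "f (n + N) * a ^ Suc (n + N) \<le> a ^ Suc N * a ^ n" by (simp add: power_add mult_ac)
  qed (use g in \<open>auto simp: sums_iff\<close>)
  also have "\<dots> = a ^ Suc N * (1 / (1 - a))" using g by (simp add: sums_iff)
  also have "\<dots> \<le> a ^ Suc N * 2" using a by (intro mult_left_mono) (auto simp: divide_le_eq)
  finally have "(\<Sum>n. f (n + N) * a ^ Suc (n + N)) \<le> 2 * a ^ Suc N" by (simp only: mult.commute)
  moreover have "0 \<le> (\<Sum>n. f (n + N) * a ^ Suc (n + N))" using f a by (intro suminf_nonneg sm) auto
  ultimately show ?thesis unfolding eq by simp
qed

lemma li2_expansion: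
  assumes "0 \<le> a" "a \<le> 1/2"
  shows "\<bar>li2 a - (\<Sum>j=1..N. a ^ j / real j ^ 2)\<bar> \<le> 2 * a ^ Suc N"
proof -
  have "\<bar>li2 a - (\<Sum>j=1..N. (1 / real (Suc (j - 1)) ^ 2) * a ^ j)\<bar> \<le> 2 * a ^ Suc N"
    by (rule geometric_tail_bound[OF assms]) (use li2_sums[of a] assms in \<open>auto simp: divide_le_eq\<close>)
  also have "(\<Sum>j=1..N. (1 / real (Suc (j - 1)) ^ 2) * a ^ j) = (\<Sum>j=1..N. a ^ j / real j ^ 2)"
    by (rule sum.cong) auto
  finally show ?thesis .
qed

lemma ln_expansion:
  assumes "0 \<le> a" "a \<le> (1/2::real)"
  shows "\<bar>ln (1 - a) + (\<Sum>j=1..N. a ^ j / real j)\<bar> \<le> 2 * a ^ Suc N"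
proof -
  have "\<bar>- ln (1 - a) - (\<Sum>j=1..N. (1 / real (Suc (j - 1))) * a ^ j)\<bar> \<le> 2 * a ^ Suc N"
    by (rule geometric_tail_bound[OF assms]) (use ln_minus_series[of a] assms in \<open>auto simp: divide_le_eq\<close>)
  also have "(\<Sum>j=1..N. (1 / real (Suc (j - 1))) * a ^ j) = (\<Sum>j=1..N. a ^ j / real j)"
    by (rule sum.cong) auto
  finally show ?thesis by linarith
qed

section \<open>Products of two primes\<close>

lemma bigomega_eq_2_iff: "bigomega n = 2 \<longleftrightarrow> (\<exists>p q. prime p \<and> prime q \<and> p \<le> q \<and> n = p * q)"
proof
  assume b: "bigomega n = 2"
  hence "n \<noteq> 0" by (intro notI) (simp add: bigomega_def)
  from b obtain p M where M: "prime_factorization n = add_mset p M"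
    unfolding bigomega_def numeral_2_eq_2 using size_eq_Suc_imp_eq_union by blast
  hence "size M = 1" using b by (simp add: bigomega_def)
  then obtain q where "M = {#q#}" using size_1_singleton_mset by blast
  hence pq: "prime_factorization n = {#p, q#}" using M by simp
  have pr: "prime p" "prime q"
    using pq in_prime_factors_imp_prime[of p n] in_prime_factors_imp_prime[of q n] by auto
  have "n = prod_mset (prime_factorization n)" using \<open>n \<noteq> 0\<close> by (simp add: prod_mset_prime_factorization_nat)
  hence "n = p * q" by (simp add: pq)
  thus "\<exists>p q. prime p \<and> prime q \<and> p \<le> q \<and> n = p * q"
    using pr by (metis linear mult.commute)
next
  assume "\<exists>p q. prime p \<and> prime q \<and> p \<le> q \<and> n = p * q"
  then obtain p q where "prime p" "prime q" "n = p * q" by blast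
  thus "bigomega n = 2"
    by (simp add: bigomega_def prime_factorization_mult prime_factorization_prime prime_gt_0_nat)
qed

lemma prime_product_unique:
  fixes p q p' q' :: nat
  assumes "prime p" "prime q" "prime p'" "prime q'" "p \<le> q" "p' \<le> q'" "p * q = p' * q'"
  shows "p = p' \<and> q = q'"
proof -
  have pf: "prime_factorization (a * b) = {#a, b#}" if "prime a" "prime b" for a b :: nat
    using that by (simp add: prime_factorization_mult prime_factorization_prime prime_gt_0_nat)
  have "{#p, q#} = {#p', q'#}"
    unfolding pf[OF assms(1,2), symmetric] pf[OF assms(3,4), symmetric] assms(7) ..
  hence "(p = p' \<and> q = q') \<or> (p = q' \<and> q = p')" by (auto simp: add_eq_conv_ex)
  thus ?thesis using assms by auto
qed

definition prime_pairs :: "real \<Rightarrow> (nat \<times> nat) set" where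
  "prime_pairs x = {(p, q). prime p \<and> prime q \<and> real p * real q \<le> x}"

lemma finite_prime_pairs: "finite (prime_pairs x)"
proof (rule finite_subset)
  show "prime_pairs x \<subseteq> {p. prime p \<and> real p \<le> x} \<times> {p. prime p \<and> real p \<le> x}"
  proof
    fix pq assume "pq \<in> prime_pairs x"
    then obtain p q where pq: "pq = (p, q)" "prime p" "prime q" "real p * real q \<le> x" by (auto simp: prime_pairs_def)
    have "real p \<ge> 1" "real q \<ge> 1" using pq prime_ge_1_nat[of p] prime_ge_1_nat[of q] by auto
    hence "real p * 1 \<le> real p * real q" "1 * real q \<le> real p * real q" by (auto intro!: mult_left_mono mult_right_mono)
    thus "pq \<in> {p. prime p \<and> real p \<le> x} \<times> {p. prime p \<and> real p \<le> x}" using pq by auto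
  qed
qed simp

text \<open>Ordered pairs count a product of two distinct primes twice but a square only once;
  adding the squares again completes the double. This extra sum is the source of
  \<open>prime_zeta 2 / 2\<close>.\<close>

lemma R2_eq_prime_pairs:
  "2 * R2 x = (\<Sum>(p, q)\<in>prime_pairs x. 1 / (real p * real q)) + (\<Sum>p | prime p \<and> real p * real p \<le> x. 1 / (real p * real p))"
proof -
  define f where "f = (\<lambda>(p::nat, q::nat). 1 / (real p * real q))"
  define LE where "LE = {(p, q) \<in> prime_pairs x. p \<le> q}"
  define GT where "GT = {(p, q) \<in> prime_pairs x. q < p}"
  define LT where "LT = {(p, q) \<in> prime_pairs x. p < q}"
  define DI where "DI = {(p, q) \<in> prime_pairs x. p = q}"
  have fin: "finite LE" "finite GT" "finite LT" "finite DI"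
    by (auto simp: LE_def GT_def LT_def DI_def intro: finite_subset[OF _ finite_prime_pairs])
  have "R2 x = sum f LE"
    unfolding R2_def
  proof (rule sum.reindex_bij_betw[symmetric, of "\<lambda>(p, q). p * q", THEN trans])
    have "{n. real n \<le> x \<and> bigomega n = 2} = (\<lambda>(p, q). p * q) ` LE"
      by (auto simp: bigomega_eq_2_iff LE_def prime_pairs_def image_iff)
    moreover have "inj_on (\<lambda>(p, q). p * q) LE"
    proof (rule inj_onI)
      fix a b assume ab: "a \<in> LE" "b \<in> LE" "(case a of (p, q) \<Rightarrow> p * q) = (case b of (p, q) \<Rightarrow> p * q)"
      obtain p q where a: "a = (p, q)" by (cases a)
      obtain p' q' where b: "b = (p', q')" by (cases b)
      show "a = b" using prime_product_unique[of p q p' q'] ab unfolding a b LE_def prime_pairs_def by simp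
    qed
    ultimately show "bij_betw (\<lambda>(p, q). p * q) LE {n. real n \<le> x \<and> bigomega n = 2}"
      by (simp add: bij_betw_def)
    show "(\<Sum>pq\<in>LE. 1 / real ((\<lambda>(p, q). p * q) pq)) = sum f LE"
      by (rule sum.cong) (auto simp: f_def)
  qed
  moreover have "sum f LE = sum f LT + sum f DI"
  proof -
    have "LE = LT \<union> DI" "LT \<inter> DI = {}" by (auto simp: LE_def LT_def DI_def)
    thus ?thesis using sum.union_disjoint[OF fin(3,4)] by simp
  qed
  moreover have "sum f (prime_pairs x) = sum f LE + sum f GT"
  proof -
    have "prime_pairs x = LE \<union> GT" "LE \<inter> GT = {}" by (auto simp: LE_def GT_def)
    thus ?thesis using sum.union_disjoint[OF fin(1,2)] by simp
  qed
  moreover have "sum f GT = sum f LT"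
    by (rule sum.reindex_bij_witness[of _ prod.swap prod.swap])
       (auto simp: GT_def LT_def prime_pairs_def f_def mult.commute)
  moreover have "sum f DI = (\<Sum>p | prime p \<and> real p * real p \<le> x. 1 / (real p * real p))"
    by (rule sum.reindex_bij_witness[of _ "\<lambda>p. (p, p)" fst]) (auto simp: DI_def prime_pairs_def f_def)
  ultimately show ?thesis by (simp add: f_def)
qed

text \<open>In a pair with product at most \<open>x\<close> one entry is at most
  \<open>sqrt x\<close>. The two symmetric halves intersect exactly in the square of the primes up
  to \<open>sqrt x\<close>.\<close>

lemma prime_pairs_hyperbola:
  assumes x: "x > 0"
  shows "(\<Sum>(p, q)\<in>prime_pairs x. 1 / (real p * real q)) =
     2 * (\<Sum>p | prime p \<and> real p \<le> sqrt x. prime_recip (x / real p) / real p) - prime_recip (sqrt x) ^ 2"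
proof -
  define f where "f = (\<lambda>(p::nat, q::nat). 1 / (real p * real q))"
  define Y where "Y = {p::nat. prime p \<and> real p \<le> sqrt x}"
  define A where "A = {(p, q) \<in> prime_pairs x. real p \<le> sqrt x}"
  define B where "B = {(p, q) \<in> prime_pairs x. real q \<le> sqrt x}"
  have fin: "finite A" "finite B" "finite Y"
    by (auto simp: A_def B_def Y_def intro: finite_subset[OF _ finite_prime_pairs])
  have "prime_pairs x = A \<union> B"
  proof -
    have "real p \<le> sqrt x \<or> real q \<le> sqrt x" if "real p * real q \<le> x" for p q
    proof (rule ccontr)
      assume "\<not> ?thesis"
      hence pq: "sqrt x < real p" "sqrt x < real q" by auto
      have "0 < sqrt x" using x by simp
      hence "sqrt x * sqrt x < real p * real q" using pq by (intro mult_strict_mono) linarith+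
      thus False using that x by simp
    qed
    thus ?thesis by (auto simp: A_def B_def prime_pairs_def)
  qed
  hence "sum f (prime_pairs x) = sum f A + sum f B - sum f (A \<inter> B)"
    using fin by (simp add: sum_Un)
  moreover have "sum f B = sum f A"
    by (rule sum.reindex_bij_witness[of _ prod.swap prod.swap])
       (auto simp: A_def B_def prime_pairs_def f_def mult.commute)
  moreover have "A \<inter> B = Y \<times> Y"
  proof -
    have "real p * real q \<le> x" if "real p \<le> sqrt x" "real q \<le> sqrt x" for p q
      using mult_mono[OF that] x by simp
    thus ?thesis by (auto simp: A_def B_def Y_def prime_pairs_def)
  qed
  moreover have "sum f (Y \<times> Y) = prime_recip (sqrt x) ^ 2"
    unfolding prime_recip_def Y_def[symmetric] power2_eq_square sum_product f_def
    by (simp add: sum.cartesian_product)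
  moreover have "sum f A = (\<Sum>p\<in>Y. prime_recip (x / real p) / real p)"
  proof -
    have "A = (SIGMA p:Y. {q. prime q \<and> real q \<le> x / real p})"
      by (auto simp: A_def Y_def prime_pairs_def le_divide_eq prime_gt_0_nat mult.commute)
    moreover have "(\<Sum>p\<in>Y. prime_recip (x / real p) / real p) = (\<Sum>p\<in>Y. \<Sum>q | prime q \<and> real q \<le> x / real p. f (p, q))"
      unfolding prime_recip_def by (rule sum.cong) (auto simp: f_def sum_divide_distrib mult.commute)
    ultimately show ?thesis using fin by (simp add: sum.Sigma case_prod_beta)
  qed
  ultimately show ?thesis by (simp add: f_def Y_def)
qed

text \<open>For \<open>p > y\<close> a factor \<open>p^(-1/2) \<le> y^(-1/2)\<close> is split off
  from \<open>p^(-2)\<close>, leaving a convergent sum. Any negative power of \<open>y\<close> is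
  enough against powers of the logarithm.\<close>

lemma prime_squares_tail:
  obtains C where "C \<ge> 0" "\<And>y. y \<ge> 1 \<Longrightarrow>
     \<bar>prime_zeta 2 - (\<Sum>p | prime p \<and> real p \<le> y. 1 / (real p * real p))\<bar> \<le> C * y powr (-1/2)"
proof -
  define C where "C = (\<Sum>\<^sub>\<infinity>p\<in>{p::nat. prime p}. real p powr (-3/2))"
  have hC: "((\<lambda>p. real p powr (-3/2)) has_sum C) {p::nat. prime p}"
    unfolding C_def by (intro has_sum_infsum powr_summable_on) simp
  show ?thesis
  proof (rule that[of C])
    show "C \<ge> 0" unfolding C_def by (intro infsum_nonneg) auto
    fix y :: real assume y: "y \<ge> 1"
    define F where "F = {p::nat. prime p \<and> real p \<le> y}"
    have "((\<lambda>p. real p powr (-2)) has_sum prime_zeta 2) {p::nat. prime p}"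
      unfolding prime_zeta_def by (intro has_sum_infsum powr_summable_on) simp
    hence 1: "((\<lambda>p. real p powr (-2)) has_sum (prime_zeta 2 - (\<Sum>p\<in>F. real p powr (-2)))) ({p. prime p} - F)"
      by (rule has_sum_Diff) (auto simp: F_def intro!: has_sum_finite)
    have S: "(\<lambda>p. real p powr (-3/2)) summable_on A" for A :: "nat set" by (rule powr_summable_on) simp
    have "norm (prime_zeta 2 - (\<Sum>p\<in>F. real p powr (-2))) \<le> (\<Sum>\<^sub>\<infinity>p\<in>{p. prime p} - F. y powr (-1/2) * real p powr (-3/2))"
    proof (rule norm_infsum_le[OF 1 has_sum_infsum])
      show "(\<lambda>p. y powr (-1/2) * real p powr (-3/2)) summable_on ({p. prime p} - F)"
        by (intro summable_on_cmult_right S)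
      fix p assume p: "p \<in> {p. prime p} - F"
      hence py: "real p > y" by (auto simp: F_def)
      have "real p powr (-2) = real p powr (-1/2) * real p powr (-3/2)" by (simp flip: powr_add)
      also have "\<dots> \<le> y powr (-1/2) * real p powr (-3/2)" using py y by (intro mult_right_mono powr_mono2') auto
      finally show "norm (real p powr (-2)) \<le> y powr (-1/2) * real p powr (-3/2)" by simp
    qed
    also have "\<dots> = y powr (-1/2) * (\<Sum>\<^sub>\<infinity>p\<in>{p. prime p} - F. real p powr (-3/2))"
      by (intro infsum_cmult_right S)
    also have "\<dots> \<le> y powr (-1/2) * C"
      unfolding C_def by (intro mult_left_mono infsum_mono2 S) auto
    also have "(\<Sum>p\<in>F. real p powr (-2)) = (\<Sum>p\<in>F. 1 / (real p * real p))"
      by (rule sum.cong) (auto simp: powr_minus inverse_eq_divide power2_eq_square)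
    finally show "\<bar>prime_zeta 2 - (\<Sum>p | prime p \<and> real p \<le> y. 1 / (real p * real p))\<bar> \<le> C * y powr (-1/2)"
      by (simp add: F_def mult.commute)
  qed
qed

section \<open>Partial summation\<close>

text \<open>The weight \<open>1 / (t (ln t)^2)\<close> is the integrable majorant used for
  \<open>alpha_integrand\<close> and for the remainder of the kernel expansion; powers of
  \<open>ln t\<close> in the error bound beyond it become powers of the final saving.\<close>

lemma inverse_mult_ln_squared_has_integral:
  assumes a: "a > (1::real)"
  shows "((\<lambda>t. 1 / (t * (ln t)\<^sup>2)) has_integral 1 / ln a) {a..}"
proof -
  define f where "f = (\<lambda>t::real. 1 / (t * (ln t)\<^sup>2))"
  have f_meas: "f \<in> borel_measurable borel" unfolding f_def by measurable
  have "(\<integral>\<^sup>+t. ennreal (f t) * indicator {a..} t \<partial>lborel) = ennreal (0 - - 1 / ln a)"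
  proof (rule nn_integral_FTC_atLeast[OF f_meas])
    fix t assume t: "a \<le> t"
    hence "ln t > 0" using a by simp
    thus "((\<lambda>t. - 1 / ln t) has_real_derivative f t) (at t)"
      using t a by (auto intro!: derivative_eq_intros simp: f_def power2_eq_square field_simps)
    show "0 \<le> f t" using t a by (simp add: f_def)
  next
    show "((\<lambda>t. - 1 / ln t) \<longlongrightarrow> (0::real)) at_top" by real_asymp
  qed
  hence nn: "(\<integral>\<^sup>+t. ennreal (if t \<in> {a..} then f t else 0) \<partial>lborel) = ennreal (1 / ln a)"
    by (subst nn_integral_cong[where v = "\<lambda>t. ennreal (f t) * indicator {a..} t"]) (auto simp: indicator_def)
  have "((\<lambda>t. if t \<in> {a..} then f t else 0) has_integral 1 / ln a) UNIV"
  proof (rule nn_integral_has_integral[OF _ _ nn])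
    show "(\<lambda>t. if t \<in> {a..} then f t else 0) \<in> borel_measurable borel" using f_meas by measurable
    show "0 \<le> (if t \<in> {a..} then f t else 0)" for t using a by (auto simp: f_def)
    show "0 \<le> 1 / ln a" using a by simp
  qed
  thus ?thesis unfolding has_integral_restrict_UNIV f_def .
qed

lemma mertens_error_measurable: "mertens_error \<in> borel_measurable borel"
proof -
  have "mono prime_recip" by (auto simp: mono_def intro!: prime_recip_mono)
  hence "prime_recip \<in> borel_measurable borel" by (rule borel_measurable_mono)
  hence "(\<lambda>x. prime_recip x - (ln (ln x) + mertens_const)) \<in> borel_measurable borel" by measurable
  thus ?thesis by (simp add: mertens_error_def[abs_def] prime_recip_def[abs_def] loglog_def)
qed

lemma alpha_integrand_measurable: "alpha_integrand j \<in> borel_measurable (lebesgue_on A)"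
proof -
  have "alpha_integrand j \<in> borel_measurable borel"
    unfolding alpha_integrand_def[abs_def] using mertens_error_measurable by measurable
  thus ?thesis by (intro measurable_restrict_space1 measurable_completion) simp
qed

text \<open>Mertens' error is used with exponent \<open>N + 2\<close>, which splits as
  \<open>(j - 1) + 2 + (N + 1 - j)\<close>: the first part cancels the logarithms of the integrand,
  the \<open>2\<close> makes it integrable, and the rest is frozen at the left end \<open>y\<close>.
  One constant serves all \<open>j \<le> N\<close>.\<close>

lemma alpha_integrand_bound:
  obtains C where "C \<ge> 0" "\<And>j t y. 1 \<le> j \<Longrightarrow> j \<le> N \<Longrightarrow> 2 \<le> y \<Longrightarrow> y \<le> t \<Longrightarrow>
     \<bar>alpha_integrand j t\<bar> \<le> C / ln y ^ (N + 1 - j) * (1 / (t * (ln t)\<^sup>2))"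
proof -
  obtain C where C: "C \<ge> 0" "\<And>x. x \<ge> 2 \<Longrightarrow> \<bar>mertens_error x\<bar> \<le> C / ln x ^ (N + 2)"
    using mertens_error_bound by blast
  show ?thesis
  proof (rule that[OF C(1)])
    fix j t y assume j: "1 \<le> j" "j \<le> N" and y: "2 \<le> y" "y \<le> (t::real)"
    define v where "v = ln t"
    have v: "v > 0" "ln y > 0" "ln y \<le> v" using y by (auto simp: v_def)
    have "\<bar>alpha_integrand j t\<bar> = \<bar>mertens_error t\<bar> * v ^ (j - 1) / t"
      using y v by (simp add: alpha_integrand_def abs_mult v_def)
    also have "\<dots> \<le> (C / v ^ (N + 2)) * v ^ (j - 1) / t"
      using y v C(2)[of t] by (intro divide_right_mono mult_right_mono) (auto simp: v_def)
    also have "\<dots> = C / v ^ (N + 1 - j) * (1 / (t * v\<^sup>2))"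
    proof -
      have "N + 2 = (j - 1) + 2 + (N + 1 - j)" using j by simp
      hence "v ^ (N + 2) = v ^ (j - 1) * v\<^sup>2 * v ^ (N + 1 - j)" by (simp only: power_add)
      thus ?thesis using v y by (simp add: field_simps)
    qed
    also have "\<dots> \<le> C / ln y ^ (N + 1 - j) * (1 / (t * v\<^sup>2))"
    proof (rule mult_right_mono)
      have "ln y ^ (N + 1 - j) \<le> v ^ (N + 1 - j)" using v by (intro power_mono) auto
      thus "C / v ^ (N + 1 - j) \<le> C / ln y ^ (N + 1 - j)"
        using v(1,2) C(1) by (intro divide_left_mono mult_pos_pos zero_less_power)
      show "0 \<le> 1 / (t * v\<^sup>2)" using y by simp
    qed
    finally show "\<bar>alpha_integrand j t\<bar> \<le> C / ln y ^ (N + 1 - j) * (1 / (t * (ln t)\<^sup>2))" by (simp add: v_def)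
  qed
qed

lemma alpha_integrand_integrable:
  assumes "1 \<le> j" "2 \<le> y"
  shows "alpha_integrand j integrable_on {y..}"
proof -
  obtain C where C: "C \<ge> 0" "\<And>j' t y. 1 \<le> j' \<Longrightarrow> j' \<le> j \<Longrightarrow> 2 \<le> y \<Longrightarrow> y \<le> t \<Longrightarrow>
     \<bar>alpha_integrand j' t\<bar> \<le> C / ln y ^ (j + 1 - j') * (1 / (t * (ln t)\<^sup>2))"
    using alpha_integrand_bound[of j] by blast
  show ?thesis
  proof (rule measurable_bounded_by_integrable_imp_integrable[OF alpha_integrand_measurable])
    show "(\<lambda>t. C / ln y ^ (j + 1 - j) * (1 / (t * (ln t)\<^sup>2))) integrable_on {y..}"
      using assms by (intro integrable_on_mult_right has_integral_integrable[OF inverse_mult_ln_squared_has_integral]) auto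
    show "norm (alpha_integrand j t) \<le> C / ln y ^ (j + 1 - j) * (1 / (t * (ln t)\<^sup>2))" if "t \<in> {y..}" for t
      using C(2)[of j y t] assms that by simp
  qed auto
qed

lemma alpha_integral_truncation:
  obtains C where "C \<ge> 0" "\<And>j y. 1 \<le> j \<Longrightarrow> j \<le> N \<Longrightarrow> 2 \<le> y \<Longrightarrow>
     \<bar>integral {2..} (alpha_integrand j) - integral {2..y} (alpha_integrand j)\<bar> \<le> C / ln y ^ (N + 2 - j)"
proof -
  obtain C where C: "C \<ge> 0" "\<And>j t y. 1 \<le> j \<Longrightarrow> j \<le> N \<Longrightarrow> 2 \<le> y \<Longrightarrow> y \<le> t \<Longrightarrow>
     \<bar>alpha_integrand j t\<bar> \<le> C / ln y ^ (N + 1 - j) * (1 / (t * (ln t)\<^sup>2))"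
    using alpha_integrand_bound[of N] by blast
  show ?thesis
  proof (rule that[OF C(1)])
    fix j and y :: real assume j: "1 \<le> j" "j \<le> N" and y: "2 \<le> y"
    have int: "alpha_integrand j integrable_on {2..y}"
      by (rule integrable_on_subinterval[OF alpha_integrand_integrable[OF j(1) order_refl]]) auto
    have "negligible ({2..y} \<inter> {y..})"
    proof -
      have "{2..y} \<inter> {y..} = {y}" using y by auto
      thus ?thesis by simp
    qed
    from has_integral_Un[OF integrable_integral[OF int] integrable_integral[OF alpha_integrand_integrable[OF j(1) y]] this]
    have "(alpha_integrand j has_integral (integral {2..y} (alpha_integrand j) + integral {y..} (alpha_integrand j))) {2..}"
    proof -
      have "{2..y} \<union> {y..} = {2..}" using y by auto
      thus "(alpha_integrand j has_integral (integral {2..y} (alpha_integrand j) + integral {y..} (alpha_integrand j))) ({2..y} \<union> {y..}) \<Longrightarrow> ?thesis"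
        by simp
    qed
    hence "integral {2..} (alpha_integrand j) - integral {2..y} (alpha_integrand j) = integral {y..} (alpha_integrand j)"
      by (simp add: integral_unique)
    also have "norm \<dots> \<le> C / ln y ^ (N + 1 - j) * (1 / ln y)"
    proof (rule integral_norm_bound_integral'[OF _ alpha_integrand_measurable])
      show "((\<lambda>t. C / ln y ^ (N + 1 - j) * (1 / (t * (ln t)\<^sup>2))) has_integral C / ln y ^ (N + 1 - j) * (1 / ln y)) {y..}"
        using y by (intro has_integral_mult_right inverse_mult_ln_squared_has_integral) auto
      show "norm (alpha_integrand j t) \<le> C / ln y ^ (N + 1 - j) * (1 / (t * (ln t)\<^sup>2))" if "t \<in> {y..}" for t
        using C(2)[of j y t] j y that by simp
    qed auto
    also have "\<dots> = C / ln y ^ (N + 2 - j)"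
    proof -
      have "N + 2 - j = Suc (N + 1 - j)" using j by simp
      thus ?thesis by simp
    qed
    finally show "\<bar>integral {2..} (alpha_integrand j) - integral {2..y} (alpha_integrand j)\<bar> \<le> C / ln y ^ (N + 2 - j)" by simp
  qed
qed

text \<open>The derivative of \<open>- ln (u - ln t)\<close>. For \<open>u = ln x\<close> this is
  minus the derivative in \<open>t\<close> of \<open>ln (ln (x / t))\<close>, the main term of the
  inner sum in the hyperbola method.\<close>

definition hyp_kernel :: "real \<Rightarrow> real \<Rightarrow> real" where
  "hyp_kernel u t = 1 / (t * (u - ln t))"

lemma hyp_kernel_has_integral:
  assumes a: "0 < a" "a \<le> y" and y: "ln y < u"
  shows "(hyp_kernel u has_integral (ln (u - ln a) - ln (u - ln y))) {a..y}"
proof -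
  have "(hyp_kernel u has_integral (- ln (u - ln y) - - ln (u - ln a))) {a..y}"
  proof (rule fundamental_theorem_of_calculus[OF a(2)])
    fix t assume t: "t \<in> {a..y}"
    hence "0 < t" "ln t \<le> ln y" using a by auto
    hence "((\<lambda>t. - ln (u - ln t)) has_real_derivative hyp_kernel u t) (at t within {a..y})"
      using y by (auto intro!: derivative_eq_intros simp: hyp_kernel_def field_simps)
    thus "((\<lambda>t. - ln (u - ln t)) has_vector_derivative hyp_kernel u t) (at t within {a..y})"
      by (simp add: has_real_derivative_iff_has_vector_derivative)
  qed
  thus ?thesis by simp
qed

text \<open>Partial summation without Stieltjes integrals: on \<open>[2, y]\<close> the function
  \<open>prime_recip\<close> is a finite sum of steps, the one at \<open>p\<close> living on
  \<open>[p, y]\<close>, and each step is integrated in closed form.\<close>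

lemma prime_recip_kernel_has_integral:
  assumes y: "2 \<le> y" "ln y < u"
  shows "((\<lambda>t. prime_recip t * hyp_kernel u t) has_integral
     (\<Sum>p | prime p \<and> real p \<le> y. (ln (u - ln (real p)) - ln (u - ln y)) / real p)) {2..y}"
proof -
  have *: "((\<lambda>t. if t \<in> {real p..y} then hyp_kernel u t / real p else 0) has_integral ((ln (u - ln (real p)) - ln (u - ln y)) / real p)) {2..y}"
    if "p \<in> {p. prime p \<and> real p \<le> y}" for p
  proof -
    have p: "real p \<ge> 2" "real p \<le> y" using that prime_ge_2_nat[of p] by auto
    have "((\<lambda>t. hyp_kernel u t / real p) has_integral ((ln (u - ln (real p)) - ln (u - ln y)) / real p)) {real p..y}"
      using p y by (intro has_integral_divide hyp_kernel_has_integral) auto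
    thus ?thesis using p by (subst has_integral_restrict) auto
  qed
  have "((\<lambda>t. \<Sum>p | prime p \<and> real p \<le> y. if t \<in> {real p..y} then hyp_kernel u t / real p else 0) has_integral
     (\<Sum>p | prime p \<and> real p \<le> y. (ln (u - ln (real p)) - ln (u - ln y)) / real p)) {2..y}"
    by (intro has_integral_sum *) auto
  moreover have "(\<Sum>p | prime p \<and> real p \<le> y. if t \<in> {real p..y} then hyp_kernel u t / real p else 0) = prime_recip t * hyp_kernel u t"
    if t: "t \<in> {2..y}" for t
  proof -
    have "(\<Sum>p | prime p \<and> real p \<le> y. if t \<in> {real p..y} then hyp_kernel u t / real p else 0)
        = (\<Sum>p | prime p \<and> real p \<le> t. hyp_kernel u t / real p)"
      by (rule sum.mono_neutral_cong_right) (use t in auto)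
    thus ?thesis unfolding prime_recip_def sum_distrib_right by simp
  qed
  ultimately show ?thesis by (rule has_integral_eq[rotated]) simp
qed

text \<open>With \<open>v = ln t\<close>, an antiderivative is \<open>- (ln v + c) ln (1 - v/u) - Li2 (v/u)\<close>.\<close>

lemma loglog_kernel_has_integral:
  assumes y: "2 \<le> y" and u: "u = 2 * ln y"
  shows "((\<lambda>t. (ln (ln t) + c) * hyp_kernel u t) has_integral
     ((ln (u / 2) + c) * ln 2 - li2 (1/2) + (ln (ln 2) + c) * ln (1 - ln 2 / u) + li2 (ln 2 / u))) {2..y}"
proof -
  define F where "F = (\<lambda>t. - (ln (ln t) + c) * ln (1 - ln t / u) - li2 (ln t / u))"
  have ly: "ln y > 0" "ln 2 \<le> ln y" using y by auto
  hence u0: "u > 0" using u by simp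
  have "((\<lambda>t. (ln (ln t) + c) * hyp_kernel u t) has_integral (F y - F 2)) {2..y}"
  proof (rule fundamental_theorem_of_calculus[OF y])
    fix t assume t: "t \<in> {2..y}"
    hence v: "0 < ln t" "ln t \<le> ln y" by auto
    have w: "0 < ln t / u" "ln t / u < 1" using v u u0 ly by auto
    have "((\<lambda>t. ln t / u) has_real_derivative (1 / t / u)) (at t)"
      using t u0 by (auto intro!: derivative_eq_intros simp: field_simps)
    from DERIV_chain2[OF li2_has_derivative[OF w] this]
    have "((\<lambda>t. li2 (ln t / u)) has_real_derivative (- ln (1 - ln t / u) / (ln t / u) * (1 / t / u))) (at t)" .
    hence "(F has_real_derivative (- (1 / ln t * (1 / t)) * ln (1 - ln t / u) + (- (ln (ln t) + c)) * (1 / (1 - ln t / u) * (- (1 / t / u)))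
        - (- ln (1 - ln t / u) / (ln t / u) * (1 / t / u)))) (at t)"
      unfolding F_def using t v w u0 by (auto intro!: derivative_eq_intros simp: divide_inverse)
    also have "(- (1 / ln t * (1 / t)) * ln (1 - ln t / u) + (- (ln (ln t) + c)) * (1 / (1 - ln t / u) * (- (1 / t / u)))
        - (- ln (1 - ln t / u) / (ln t / u) * (1 / t / u))) = (ln (ln t) + c) * hyp_kernel u t"
    proof -
      have e1: "- ln (1 - ln t / u) / (ln t / u) * (1 / t / u) = - (1 / ln t * (1 / t)) * ln (1 - ln t / u)"
        using u0 by simp
      have e2: "1 / (1 - ln t / u) * (1 / t / u) = hyp_kernel u t"
      proof -
        have "1 - ln t / u = (u - ln t) / u" using u0 by (simp add: field_simps)
        thus ?thesis using u0 by (simp add: hyp_kernel_def)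
      qed
      have e3: "(- (ln (ln t) + c)) * (1 / (1 - ln t / u) * (- (1 / t / u))) = (ln (ln t) + c) * (1 / (1 - ln t / u) * (1 / t / u))"
        by (simp only: mult_minus_left mult_minus_right minus_minus)
      show ?thesis unfolding e3 e1 e2 by simp
    qed
    finally have "(F has_real_derivative (ln (ln t) + c) * hyp_kernel u t) (at t within {2..y})"
      by (rule has_field_derivative_at_within)
    thus "(F has_vector_derivative (ln (ln t) + c) * hyp_kernel u t) (at t within {2..y})"
      by (simp add: has_real_derivative_iff_has_vector_derivative)
  qed
  moreover have "F y - F 2 = (ln (u / 2) + c) * ln 2 - li2 (1/2) + (ln (ln 2) + c) * ln (1 - ln 2 / u) + li2 (ln 2 / u)"
  proof -
    \<comment> \<open>The hyperbola point \<open>y = sqrt x\<close> puts the upper limit at the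
      argument \<open>1/2\<close>; this is where \<open>li2 (1/2)\<close> and \<open>ln 2\<close>
      come from.\<close>
    have e1: "ln y / u = 1 / 2" and e2: "ln y = u / 2" using u ly by auto
    have e3: "ln (1 - 1 / 2 :: real) = - ln 2" by (simp add: ln_div)
    have "F y = - (ln (ln y) + c) * ln (1 - 1 / 2) - li2 (1 / 2)" unfolding F_def e1 ..
    hence "F y = (ln (u / 2) + c) * ln 2 - li2 (1 / 2)" unfolding e2 e3 minus_mult_minus .
    moreover have "F 2 = - ((ln (ln 2) + c) * ln (1 - ln 2 / u)) - li2 (ln 2 / u)"
      by (simp only: F_def mult_minus_left)
    ultimately show ?thesis by simp
  qed
  ultimately show ?thesis by simp
qed

text \<open>With \<open>v = ln t\<close> the sum produces the factors \<open>ln t ^ (j - 1)\<close>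
  of \<open>alpha_integrand\<close>. The remainder is kept exact because it is still to be
  integrated against Mertens' error.\<close>

lemma geometric_remainder:
  fixes u v :: real
  assumes "u \<noteq> 0" "u \<noteq> v"
  shows "1 / (u - v) = (\<Sum>j=1..N. v ^ (j - 1) / u ^ j) + v ^ N / (u ^ N * (u - v))"
proof (induction N)
  case (Suc N)
  have "v ^ N / (u ^ N * (u - v)) = v ^ N / u ^ Suc N + v ^ Suc N / (u ^ Suc N * (u - v))"
    using assms by (simp add: field_simps)
  thus ?case using Suc by simp
qed simp

text \<open>In the integral of \<open>prime_recip\<close> against the kernel, the part
  \<open>ln (ln t) + mertens_const\<close> is integrated in closed form, and for the error part the
  kernel is expanded geometrically in \<open>1/u\<close>. The remainder is harmless since
  \<open>ln t \<le> u/2\<close> on the range; finally the integrals over \<open>[2, y]\<close> are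
  completed to infinity.\<close>

lemma kernel_sum_expansion:
  obtains C where "C \<ge> 0" "\<And>y u. 2 \<le> y \<Longrightarrow> u = 2 * ln y \<Longrightarrow>
     \<bar>(\<Sum>p | prime p \<and> real p \<le> y. (ln (u - ln (real p)) - ln (u / 2)) / real p)
        - ((ln (u / 2) + mertens_const) * ln 2 - li2 (1/2) + (ln (ln 2) + mertens_const) * ln (1 - ln 2 / u) + li2 (ln 2 / u))
        - (\<Sum>j=1..N. integral {2..} (alpha_integrand j) / u ^ j)\<bar> \<le> C / u ^ (N + 1)"
proof -
  obtain C1 where C1: "C1 \<ge> 0" "\<And>x. x \<ge> 2 \<Longrightarrow> \<bar>mertens_error x\<bar> \<le> C1 / ln x ^ (N + 2)"
    using mertens_error_bound by blast
  obtain C2 where C2: "C2 \<ge> 0" "\<And>j y. 1 \<le> j \<Longrightarrow> j \<le> N \<Longrightarrow> 2 \<le> y \<Longrightarrow>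
     \<bar>integral {2..} (alpha_integrand j) - integral {2..y} (alpha_integrand j)\<bar> \<le> C2 / ln y ^ (N + 2 - j)"
    using alpha_integral_truncation[of N] by blast
  \<comment> \<open>The first summand bounds the geometric remainder, with \<open>2\<close> from
    \<open>u - ln t \<ge> u/2\<close> and \<open>1 / ln 2\<close> from the integral of the majorant;
    the second bounds the \<open>N\<close> completed tails, with the power of \<open>2\<close> from
    \<open>ln y = u/2\<close>.\<close>
  define C where "C = 2 * C1 * (1 / ln 2) + real N * (C2 * 2 ^ (N + 2))"
  show ?thesis
  proof (rule that[of C])
    show "C \<ge> 0" using C1 C2 by (simp add: C_def)
    fix y u :: real assume y: "2 \<le> y" and u: "u = 2 * ln y"
    have ly: "ln y \<ge> ln 2" using y by simp
    have u1: "u \<ge> 1" using ly ln2_ge_two_thirds u by linarith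
    have ly_u: "ln y < u" using u u1 by linarith
    define A where "A = (\<Sum>p | prime p \<and> real p \<le> y. (ln (u - ln (real p)) - ln (u / 2)) / real p)"
    define V where "V = (ln (u / 2) + mertens_const) * ln 2 - li2 (1/2) + (ln (ln 2) + mertens_const) * ln (1 - ln 2 / u) + li2 (ln 2 / u)"
    define rem where "rem = (\<lambda>t. mertens_error t * ln t ^ N / (t * u ^ N * (u - ln t)))"
    have "((\<lambda>t. prime_recip t * hyp_kernel u t) has_integral A) {2..y}"
      using prime_recip_kernel_has_integral[OF y ly_u] u by (simp add: A_def)
    from has_integral_diff[OF this loglog_kernel_has_integral[OF y u, of mertens_const]]
    have EK: "((\<lambda>t. mertens_error t * hyp_kernel u t) has_integral (A - V)) {2..y}"
      by (simp add: V_def mertens_error_def prime_recip_def loglog_def left_diff_distrib)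
    have a_int: "((\<lambda>t. \<Sum>j=1..N. alpha_integrand j t / u ^ j) has_integral (\<Sum>j=1..N. integral {2..y} (alpha_integrand j) / u ^ j)) {2..y}"
    proof (intro has_integral_sum has_integral_divide integrable_integral)
      fix j assume "j \<in> {1..N}"
      thus "alpha_integrand j integrable_on {2..y}"
        by (intro integrable_on_subinterval[OF alpha_integrand_integrable[OF _ order_refl]]) auto
    qed auto
    have "((\<lambda>t. mertens_error t * hyp_kernel u t - (\<Sum>j=1..N. alpha_integrand j t / u ^ j)) has_integral
        (A - V - (\<Sum>j=1..N. integral {2..y} (alpha_integrand j) / u ^ j))) {2..y}"
      by (rule has_integral_diff[OF EK a_int])
    moreover have "mertens_error t * hyp_kernel u t - (\<Sum>j=1..N. alpha_integrand j t / u ^ j) = rem t" if t: "t \<in> {2..y}" for t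
    proof -
      have "ln t \<le> ln y" using t by simp
      hence ne: "u \<noteq> 0" "u \<noteq> ln t" using u1 ly_u by auto
      have "mertens_error t * hyp_kernel u t = mertens_error t / t * (1 / (u - ln t))" by (simp add: hyp_kernel_def)
      also have "\<dots> = (\<Sum>j=1..N. alpha_integrand j t / u ^ j) + rem t"
        unfolding geometric_remainder[OF ne, of N] distrib_left sum_distrib_left
        by (simp add: alpha_integrand_def rem_def mult_ac)
      finally show ?thesis by simp
    qed
    ultimately have rem_int: "(rem has_integral (A - V - (\<Sum>j=1..N. integral {2..y} (alpha_integrand j) / u ^ j))) {2..y}"
      by (rule has_integral_eq[rotated])
    define g where "g = (\<lambda>t. 2 * C1 / u ^ (N + 1) * (1 / (t * (ln t)\<^sup>2)))"
    have gI: "(g has_integral (2 * C1 / u ^ (N + 1) * (1 / ln 2))) {2..}"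
      unfolding g_def by (intro has_integral_mult_right inverse_mult_ln_squared_has_integral) simp
    have g_int: "g integrable_on {2..y}" by (rule integrable_on_subinterval[OF has_integral_integrable[OF gI]]) auto
    have "norm (integral {2..y} rem) \<le> integral {2..y} g"
    proof (rule integral_norm_bound_integral[OF has_integral_integrable[OF rem_int] g_int])
      fix t assume t: "t \<in> {2..y}"
      define v where "v = ln t"
      have v: "0 < v" "v \<le> u / 2" using t u by (auto simp: v_def)
      have "norm (rem t) = \<bar>mertens_error t\<bar> * v ^ N / (t * u ^ N * (u - v))"
        using t v u1 by (simp add: rem_def v_def[symmetric] abs_mult)
      also have "\<dots> \<le> (C1 / v ^ (N + 2)) * v ^ N / (t * u ^ N * (u / 2))"
      proof (rule frac_le)
        show "\<bar>mertens_error t\<bar> * v ^ N \<le> C1 / v ^ (N + 2) * v ^ N"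
          using C1(2)[of t] t v(1) by (intro mult_right_mono) (auto simp: v_def)
        show "0 < t * u ^ N * (u / 2)" using t u1 by simp
        show "t * u ^ N * (u / 2) \<le> t * u ^ N * (u - v)" using t u1 v by (intro mult_left_mono) auto
        show "0 \<le> C1 / v ^ (N + 2) * v ^ N" using C1(1) v by simp
      qed
      also have "\<dots> = g t" using v u1 t unfolding g_def v_def[symmetric] by (simp add: field_simps power2_eq_square)
      finally show "norm (rem t) \<le> g t" .
    qed
    also have "\<dots> \<le> integral {2..} g"
      by (rule integral_subset_le[OF _ g_int has_integral_integrable[OF gI]]) (use C1 u1 in \<open>auto simp: g_def\<close>)
    also have "\<dots> = 2 * C1 * (1 / ln 2) / u ^ (N + 1)" using gI by (simp add: integral_unique)
    finally have 1: "\<bar>A - V - (\<Sum>j=1..N. integral {2..y} (alpha_integrand j) / u ^ j)\<bar> \<le> 2 * C1 * (1 / ln 2) / u ^ (N + 1)"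
      using integral_unique[OF rem_int] by simp
    have "\<bar>(\<Sum>j=1..N. integral {2..} (alpha_integrand j) / u ^ j) - (\<Sum>j=1..N. integral {2..y} (alpha_integrand j) / u ^ j)\<bar>
       = \<bar>\<Sum>j=1..N. (integral {2..} (alpha_integrand j) - integral {2..y} (alpha_integrand j)) / u ^ j\<bar>"
      by (simp add: sum_subtractf diff_divide_distrib)
    also have "\<dots> \<le> (\<Sum>j=1..N. C2 * 2 ^ (N + 2) / u ^ (N + 1))"
    proof (rule order_trans[OF sum_abs sum_mono])
      fix j assume j: "j \<in> {1..N}"
      have "\<bar>(integral {2..} (alpha_integrand j) - integral {2..y} (alpha_integrand j)) / u ^ j\<bar> \<le> C2 / ln y ^ (N + 2 - j) / u ^ j"
        unfolding abs_divide abs_of_pos[OF zero_less_power[OF less_le_trans[OF zero_less_one u1]]]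
        using C2(2)[of j y] j y u1 by (intro divide_right_mono) auto
      also have "ln y = u / 2" using u by simp
      also have "C2 / (u / 2) ^ (N + 2 - j) / u ^ j = C2 * 2 ^ (N + 2 - j) / (u ^ (N + 2 - j) * u ^ j)"
        by (simp add: power_divide)
      also have "u ^ (N + 2 - j) * u ^ j = u ^ (N + 2)" using j by (simp flip: power_add)
      also have "C2 * 2 ^ (N + 2 - j) / u ^ (N + 2) \<le> C2 * 2 ^ (N + 2) / u ^ (N + 1)"
        using C2 u1 by (intro frac_le mult_left_mono power_increasing) auto
      finally show "\<bar>(integral {2..} (alpha_integrand j) - integral {2..y} (alpha_integrand j)) / u ^ j\<bar> \<le> C2 * 2 ^ (N + 2) / u ^ (N + 1)" .
    qed
    also have "\<dots> = real N * (C2 * 2 ^ (N + 2)) / u ^ (N + 1)" by simp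
    finally have 2: "\<bar>(\<Sum>j=1..N. integral {2..} (alpha_integrand j) / u ^ j) - (\<Sum>j=1..N. integral {2..y} (alpha_integrand j) / u ^ j)\<bar>
      \<le> real N * (C2 * 2 ^ (N + 2)) / u ^ (N + 1)" .
    have "\<bar>A - V - (\<Sum>j=1..N. integral {2..} (alpha_integrand j) / u ^ j)\<bar> \<le> 2 * C1 * (1 / ln 2) / u ^ (N + 1) + real N * (C2 * 2 ^ (N + 2)) / u ^ (N + 1)"
      using 1 2 by linarith
    also have "\<dots> = C / u ^ (N + 1)" by (simp only: C_def add_divide_distrib)
    finally show "\<bar>(\<Sum>p | prime p \<and> real p \<le> y. (ln (u - ln (real p)) - ln (u / 2)) / real p)
        - ((ln (u / 2) + mertens_const) * ln 2 - li2 (1/2) + (ln (ln 2) + mertens_const) * ln (1 - ln 2 / u) + li2 (ln 2 / u))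
        - (\<Sum>j=1..N. integral {2..} (alpha_integrand j) / u ^ j)\<bar> \<le> C / u ^ (N + 1)" unfolding A_def V_def .
  qed
qed

lemma prime_recip_eq: "x > 1 \<Longrightarrow> prime_recip x = ln (ln x) + mertens_const + mertens_error x"
  by (simp add: mertens_error_def prime_recip_def loglog_def)

text \<open>For \<open>p \<le> y\<close> the argument \<open>y^2 / p\<close> is at least
  \<open>y\<close>, so its Mertens error is of order \<open>u^(-N-2)\<close>; summing it against
  \<open>1/p\<close> costs at most a factor \<open>u\<close>, hence the extra power. The term
  \<open>ln (u / 2)\<close> is subtracted and added back because it is the boundary value
  \<open>ln (u - ln y)\<close> in the kernel integral.\<close>

lemma prime_recip_convolution:
  obtains C where "C \<ge> 0" "\<And>y u. 2 \<le> y \<Longrightarrow> u = 2 * ln y \<Longrightarrow>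
     \<bar>(\<Sum>p | prime p \<and> real p \<le> y. prime_recip (y\<^sup>2 / real p) / real p)
       - ((\<Sum>p | prime p \<and> real p \<le> y. (ln (u - ln (real p)) - ln (u / 2)) / real p)
           + (ln (u / 2) + mertens_const) * prime_recip y)\<bar> \<le> C / u ^ (N + 1)"
proof -
  obtain C0 where C0: "C0 \<ge> 0" "\<And>x. x \<ge> 2 \<Longrightarrow> \<bar>mertens_error x\<bar> \<le> C0 / ln x ^ 0"
    using mertens_error_bound by blast
  obtain C1 where C1: "C1 \<ge> 0" "\<And>x. x \<ge> 2 \<Longrightarrow> \<bar>mertens_error x\<bar> \<le> C1 / ln x ^ (N + 2)"
    using mertens_error_bound by blast
  \<comment> \<open>Gives the crude bound \<open>prime_recip y \<le> M * u\<close>, from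
    \<open>ln (ln y) \<le> u\<close> and from multiplying the constants by
    \<open>u \<ge> 1\<close>.\<close>
  define M where "M = 1 + \<bar>mertens_const\<bar> + C0"
  have M: "M \<ge> 0" using C0 by (simp add: M_def)
  show ?thesis
  proof (rule that[of "C1 * 2 ^ (N + 2) * M"])
    show "C1 * 2 ^ (N + 2) * M \<ge> 0" using C1 M by simp
    fix y u :: real assume y: "2 \<le> y" and u: "u = 2 * ln y"
    have ly: "ln y \<ge> ln 2" using y by simp
    have u1: "u \<ge> 1" using ly ln2_ge_two_thirds u by linarith
    define Y where "Y = {p::nat. prime p \<and> real p \<le> y}"
    have trm: "prime_recip (y\<^sup>2 / real p) / real p = (ln (u - ln (real p)) - ln (u / 2)) / real p + (ln (u / 2) + mertens_const) * (1 / real p)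
         + mertens_error (y\<^sup>2 / real p) / real p"
      and err: "\<bar>mertens_error (y\<^sup>2 / real p) / real p\<bar> \<le> C1 * 2 ^ (N + 2) / u ^ (N + 2) * (1 / real p)" if "p \<in> Y" for p
    proof -
      have p: "real p \<ge> 2" "real p \<le> y" using that prime_ge_2_nat[of p] by (auto simp: Y_def)
      have "y * real p \<le> y * y" using p y by (intro mult_left_mono) auto
      hence z: "y\<^sup>2 / real p \<ge> y" using p by (simp add: le_divide_eq power2_eq_square)
      have l: "ln (y\<^sup>2 / real p) = u - ln (real p)" using p y by (simp add: ln_div ln_realpow u)
      have "prime_recip (y\<^sup>2 / real p) = ln (u - ln (real p)) + mertens_const + mertens_error (y\<^sup>2 / real p)"
        using prime_recip_eq[of "y\<^sup>2 / real p"] z y unfolding l by simp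
      thus "prime_recip (y\<^sup>2 / real p) / real p = (ln (u - ln (real p)) - ln (u / 2)) / real p + (ln (u / 2) + mertens_const) * (1 / real p)
         + mertens_error (y\<^sup>2 / real p) / real p"
        by (simp add: add_divide_distrib diff_divide_distrib)
      have "ln (real p) \<le> ln y" using p by simp
      hence half: "u / 2 \<le> ln (y\<^sup>2 / real p)" unfolding l using u by linarith
      have "\<bar>mertens_error (y\<^sup>2 / real p)\<bar> \<le> C1 / ln (y\<^sup>2 / real p) ^ (N + 2)" using z y by (intro C1) auto
      also have "\<dots> \<le> C1 / (u / 2) ^ (N + 2)"
      proof (rule divide_left_mono)
        show "(u / 2) ^ (N + 2) \<le> ln (y\<^sup>2 / real p) ^ (N + 2)" using half u1 by (intro power_mono) auto
        have "0 < u / 2" "0 < ln (y\<^sup>2 / real p)" using half u1 by linarith+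
        thus "0 < ln (y\<^sup>2 / real p) ^ (N + 2) * (u / 2) ^ (N + 2)" by (intro mult_pos_pos zero_less_power)
      qed (rule C1)
      also have "\<dots> = C1 * 2 ^ (N + 2) / u ^ (N + 2)" by (simp add: power_divide)
      finally have "\<bar>mertens_error (y\<^sup>2 / real p)\<bar> / real p \<le> C1 * 2 ^ (N + 2) / u ^ (N + 2) / real p"
        by (intro divide_right_mono) auto
      thus "\<bar>mertens_error (y\<^sup>2 / real p) / real p\<bar> \<le> C1 * 2 ^ (N + 2) / u ^ (N + 2) * (1 / real p)" by simp
    qed
    have "(\<Sum>p\<in>Y. prime_recip (y\<^sup>2 / real p) / real p) = (\<Sum>p\<in>Y. (ln (u - ln (real p)) - ln (u / 2)) / real p)
        + (ln (u / 2) + mertens_const) * prime_recip y + (\<Sum>p\<in>Y. mertens_error (y\<^sup>2 / real p) / real p)"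
      unfolding prime_recip_def[of y] Y_def[symmetric] sum_distrib_left sum.distrib[symmetric]
      by (rule sum.cong[OF refl trm])
    moreover have "\<bar>\<Sum>p\<in>Y. mertens_error (y\<^sup>2 / real p) / real p\<bar> \<le> C1 * 2 ^ (N + 2) * M / u ^ (N + 1)"
    proof -
      have "\<bar>\<Sum>p\<in>Y. mertens_error (y\<^sup>2 / real p) / real p\<bar> \<le> (\<Sum>p\<in>Y. C1 * 2 ^ (N + 2) / u ^ (N + 2) * (1 / real p))"
        by (rule order_trans[OF sum_abs sum_mono[OF err]])
      also have "\<dots> = C1 * 2 ^ (N + 2) / u ^ (N + 2) * prime_recip y"
        unfolding prime_recip_def Y_def sum_distrib_left ..
      also have "\<dots> \<le> C1 * 2 ^ (N + 2) / u ^ (N + 2) * (M * u)"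
      proof (rule mult_left_mono)
        have "ln (ln y) \<le> ln y - 1" using y by (intro ln_le_minus_one) auto
        also have "\<dots> \<le> u" using u u1 by linarith
        finally have "prime_recip y \<le> u + \<bar>mertens_const\<bar> + C0"
          using prime_recip_eq[of y] C0(2)[of y] y by simp
        also have "\<dots> \<le> u + \<bar>mertens_const\<bar> * u + C0 * u"
          using u1 C0 mult_left_mono[of 1 u "\<bar>mertens_const\<bar>"] mult_left_mono[of 1 u C0] by simp
        also have "\<dots> = M * u" by (simp add: M_def algebra_simps)
        finally show "prime_recip y \<le> M * u" .
        show "0 \<le> C1 * 2 ^ (N + 2) / u ^ (N + 2)" using C1 u1 by simp
      qed
      also have "\<dots> = C1 * 2 ^ (N + 2) * M / u ^ (N + 1)" using u1 by simp
      finally show ?thesis .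
    qed
    ultimately show "\<bar>(\<Sum>p | prime p \<and> real p \<le> y. prime_recip (y\<^sup>2 / real p) / real p)
       - ((\<Sum>p | prime p \<and> real p \<le> y. (ln (u - ln (real p)) - ln (u / 2)) / real p)
           + (ln (u / 2) + mertens_const) * prime_recip y)\<bar> \<le> C1 * 2 ^ (N + 2) * M / u ^ (N + 1)"
      unfolding Y_def by simp
  qed
qed

section \<open>Assembling the expansion\<close>

definition R2_main :: "nat \<Rightarrow> real \<Rightarrow> real" where
  "R2_main N x = (loglog x + mertens_const)\<^sup>2 / 2 + (prime_zeta 2 - zeta 2) / 2 + (\<Sum>j=1..N. alpha j / ln x ^ j)"

text \<open>The explicit part of \<open>alpha j\<close> collects Taylor coefficients of the boundary
  terms at \<open>t = 2\<close>: those of \<open>li2 (ln 2 / u)\<close> and those of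
  \<open>ln (1 - ln 2 / u)\<close> multiplied by \<open>ln (ln 2) + mertens_const\<close>.\<close>

lemma alpha_sum_eq:
  assumes "u \<noteq> 0"
  shows "(\<Sum>j=1..N. alpha j / u ^ j) = (\<Sum>j=1..N. (ln 2 / u) ^ j / real j ^ 2)
     - (ln (ln 2) + mertens_const) * (\<Sum>j=1..N. (ln 2 / u) ^ j / real j)
     + (\<Sum>j=1..N. integral {2..} (alpha_integrand j) / u ^ j)"
  unfolding sum_distrib_left sum_subtractf[symmetric] sum.distrib[symmetric]
proof (rule sum.cong[OF refl])
  fix j assume "j \<in> {1..N}"
  hence "real j \<noteq> 0" by simp
  thus "alpha j / u ^ j = (ln 2 / u) ^ j / real j ^ 2 - (ln (ln 2) + mertens_const) * ((ln 2 / u) ^ j / real j)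
     + integral {2..} (alpha_integrand j) / u ^ j"
    using assms by (simp add: alpha_def loglog_def power_divide field_simps power2_eq_square)
qed

text \<open>The bound \<open>x \<ge> 4\<close> makes \<open>y = sqrt x \<ge> 2\<close>, where the
  estimates for \<open>mertens_error\<close> start. All pieces are named exactly, so that the
  difference from the main term becomes an identity between remainders before any estimate is
  made.\<close>

lemma R2_expansion_large:
  obtains C where "C \<ge> 0" "\<And>x. x \<ge> 4 \<Longrightarrow> \<bar>R2 x - R2_main N x\<bar> \<le> C / ln x ^ (N + 1)"
proof -
  obtain C0 where C0: "C0 \<ge> 0" "\<And>x. x \<ge> 2 \<Longrightarrow> \<bar>mertens_error x\<bar> \<le> C0 / ln x ^ 0"
    using mertens_error_bound by blast
  obtain C1 where C1: "C1 \<ge> 0" "\<And>x. x \<ge> 2 \<Longrightarrow> \<bar>mertens_error x\<bar> \<le> C1 / ln x ^ (N + 1)"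
    using mertens_error_bound by blast
  obtain C2 where C2: "C2 \<ge> 0" "\<And>y u. 2 \<le> y \<Longrightarrow> u = 2 * ln y \<Longrightarrow>
     \<bar>(\<Sum>p | prime p \<and> real p \<le> y. (ln (u - ln (real p)) - ln (u / 2)) / real p)
        - ((ln (u / 2) + mertens_const) * ln 2 - li2 (1/2) + (ln (ln 2) + mertens_const) * ln (1 - ln 2 / u) + li2 (ln 2 / u))
        - (\<Sum>j=1..N. integral {2..} (alpha_integrand j) / u ^ j)\<bar> \<le> C2 / u ^ (N + 1)"
    using kernel_sum_expansion[of N] by blast
  obtain C3 where C3: "C3 \<ge> 0" "\<And>y u. 2 \<le> y \<Longrightarrow> u = 2 * ln y \<Longrightarrow>
     \<bar>(\<Sum>p | prime p \<and> real p \<le> y. prime_recip (y\<^sup>2 / real p) / real p)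
       - ((\<Sum>p | prime p \<and> real p \<le> y. (ln (u - ln (real p)) - ln (u / 2)) / real p)
           + (ln (u / 2) + mertens_const) * prime_recip y)\<bar> \<le> C3 / u ^ (N + 1)"
    using prime_recip_convolution[of N] by blast
  obtain C4 where C4: "C4 \<ge> 0" "\<And>y. y \<ge> 1 \<Longrightarrow>
     \<bar>prime_zeta 2 - (\<Sum>p | prime p \<and> real p \<le> y. 1 / (real p * real p))\<bar> \<le> C4 * y powr (-1/2)"
    using prime_squares_tail by blast
  define \<kappa> where "\<kappa> = ln (ln 2) + mertens_const"
  define K4 where "K4 = C4 * (fact (N + 1) * 4 ^ (N + 1))"
  define K1 where "K1 = C0 * (C1 * 2 ^ (N + 1))"
  define C where "C = C2 + 2 + \<bar>\<kappa>\<bar> * 2 + K1 + C3 + K4"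
  show ?thesis
  proof (rule that[of C])
    show "C \<ge> 0" using C0 C1 C2 C3 C4 by (simp add: C_def K1_def K4_def)
    fix x :: real assume x: "x \<ge> 4"
    define y where "y = sqrt x"
    define u where "u = ln x"
    have y: "y \<ge> 2" unfolding y_def using x by (intro real_le_rsqrt) auto
    have y2: "y\<^sup>2 = x" using x by (simp add: y_def)
    have u: "u = 2 * ln y" unfolding u_def y2[symmetric] using y by (simp add: ln_realpow)
    have ly: "ln y \<ge> ln 2" using y by simp
    have u1: "u \<ge> 1" using ly ln2_ge_two_thirds u by linarith
    define U where "U = u ^ (N + 1)"
    have U: "U > 0" using u1 by (simp add: U_def)
    define a where "a = ln 2 / u"
    have a: "0 \<le> a" "a \<le> 1/2" using ly u u1 by (auto simp: a_def divide_le_eq)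
    define A where "A = (\<Sum>p | prime p \<and> real p \<le> y. (ln (u - ln (real p)) - ln (u / 2)) / real p)"
    define \<Lambda> where "\<Lambda> = ln (u / 2) + mertens_const"
    define S where "S = prime_recip y"
    define T where "T = (\<Sum>p | prime p \<and> real p \<le> y. prime_recip (x / real p) / real p)"
    define Q where "Q = (\<Sum>p | prime p \<and> real p \<le> y. 1 / (real p * real p))"
    define I where "I = (\<Sum>j=1..N. integral {2..} (alpha_integrand j) / u ^ j)"
    define s2 where "s2 = (\<Sum>j=1..N. a ^ j / real j ^ 2)"
    define s1 where "s1 = (\<Sum>j=1..N. a ^ j / real j)"
    define r1 where "r1 = A - (\<Lambda> * ln 2 - li2 (1/2) + \<kappa> * ln (1 - a) + li2 a) - I"
    define r2 where "r2 = li2 a - s2"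
    define r3 where "r3 = ln (1 - a) + s1"
    define e where "e = mertens_error y"
    define r4 where "r4 = T - (A + \<Lambda> * S)"
    define r5 where "r5 = Q - prime_zeta 2"
    have Q_eq: "(\<Sum>p | prime p \<and> real p * real p \<le> x. 1 / (real p * real p)) = Q"
    proof -
      have "real p * real p \<le> x \<longleftrightarrow> real p \<le> y" for p
        unfolding y2[symmetric] power2_eq_square[symmetric] using y by (intro power_mono_iff) auto
      thus ?thesis by (simp add: Q_def)
    qed
    have R2_eq: "2 * R2 x = 2 * T - S\<^sup>2 + Q"
      unfolding R2_eq_prime_pairs Q_eq using prime_pairs_hyperbola[of x] x by (simp add: T_def S_def y_def)
    have S_eq: "S = \<Lambda> + e" unfolding S_def e_def \<Lambda>_def using prime_recip_eq[of y] y u by simp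
    have alpha_eq: "(\<Sum>j=1..N. alpha j / u ^ j) = s2 - \<kappa> * s1 + I"
      using alpha_sum_eq[of u N] u1 by (simp add: s2_def s1_def I_def a_def \<kappa>_def)
    have \<Lambda>_eq: "loglog x + mertens_const = \<Lambda> + ln 2"
      unfolding loglog_def u_def[symmetric] \<Lambda>_def using u1 by (simp add: ln_div)
    have main: "R2_main N x = (\<Lambda> + ln 2)\<^sup>2 / 2 + (prime_zeta 2 - (2 * li2 (1/2) + ln 2 ^ 2)) / 2 + (s2 - \<kappa> * s1 + I)"
      unfolding R2_main_def \<Lambda>_eq li2_half u_def[symmetric] alpha_eq ..
    have "R2 x = T - S\<^sup>2 / 2 + Q / 2" using R2_eq by linarith
    also have "T = r1 + (\<Lambda> * ln 2 - li2 (1/2) + \<kappa> * (r3 - s1) + (r2 + s2)) + I + r4 + \<Lambda> * S"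
      by (simp add: r1_def r2_def r3_def r4_def)
    \<comment> \<open>Two cancellations occur. With \<open>S = \<Lambda> + e\<close> the terms
      linear in \<open>e\<close> drop out, as
      \<open>\<Lambda> S - S^2/2 = \<Lambda>^2/2 - e^2/2\<close>. And
      \<open>\<Lambda>^2/2 + \<Lambda> ln 2 - li2 (1/2)\<close> equals
      \<open>(\<Lambda> + ln 2)^2 / 2 - zeta 2 / 2\<close> by the dilogarithm identity.\<close>
    finally have "R2 x - R2_main N x = r1 + r2 + \<kappa> * r3 - e\<^sup>2 / 2 + r4 + r5 / 2"
      unfolding main S_eq by (simp add: r5_def power2_eq_square field_simps)
    moreover have "\<bar>r1\<bar> \<le> C2 / U"
      using C2(2)[OF y u] unfolding r1_def A_def \<Lambda>_def \<kappa>_def a_def I_def U_def .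
    moreover have aU: "a ^ Suc N \<le> 1 / U"
    proof -
      have "ln 2 ^ Suc N \<le> (1::real)" using ln2_le_25_over_36 by (intro power_le_one) auto
      thus ?thesis using U by (simp add: a_def U_def power_divide divide_right_mono)
    qed
    moreover have "\<bar>r2\<bar> \<le> 2 * a ^ Suc N" unfolding r2_def s2_def by (rule li2_expansion[OF a])
    moreover have "\<bar>\<kappa> * r3\<bar> \<le> \<bar>\<kappa>\<bar> * 2 / U"
    proof -
      have "\<bar>r3\<bar> \<le> 2 * a ^ Suc N" unfolding r3_def s1_def by (rule ln_expansion[OF a])
      hence "\<bar>r3\<bar> \<le> 2 / U" using aU by simp
      hence "\<bar>\<kappa>\<bar> * \<bar>r3\<bar> \<le> \<bar>\<kappa>\<bar> * (2 / U)" by (intro mult_left_mono) auto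
      thus ?thesis by (simp add: abs_mult)
    qed
    \<comment> \<open>One factor \<open>e\<close> is bounded by the constant \<open>C0\<close>, the
      other carries the whole decay.\<close>
    moreover have "e\<^sup>2 / 2 \<le> K1 / U" "0 \<le> e\<^sup>2 / 2"
    proof -
      have "\<bar>e\<bar> \<le> C0" "\<bar>e\<bar> \<le> C1 / ln y ^ (N + 1)" unfolding e_def using C0(2)[OF y] C1(2)[OF y] by simp_all
      hence "\<bar>e\<bar> * \<bar>e\<bar> \<le> C0 * (C1 / ln y ^ (N + 1))" using C0 by (intro mult_mono) auto
      also have "ln y = u / 2" using u by simp
      also have "C0 * (C1 / (u / 2) ^ (N + 1)) = K1 / U" by (simp add: K1_def U_def power_divide)
      finally have "e\<^sup>2 \<le> K1 / U" by (simp add: power2_eq_square abs_mult[symmetric])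
      thus "e\<^sup>2 / 2 \<le> K1 / U" using zero_le_power2[of e] by linarith
    qed simp
    moreover have "\<bar>r4\<bar> \<le> C3 / U"
      using C3(2)[OF y u] unfolding r4_def T_def A_def \<Lambda>_def S_def U_def y2 .
    moreover have "\<bar>r5\<bar> \<le> K4 / U"
    proof -
      have "\<bar>r5\<bar> \<le> C4 * y powr (-1/2)" using C4(2)[of y] y by (simp add: r5_def Q_def abs_minus_commute)
      also have "y powr (-1/2) = exp (- (u / 4))" using y u by (simp add: powr_def)
      also have "C4 * exp (- (u / 4)) \<le> C4 * (fact (N + 1) * 4 ^ (N + 1) / U)"
      proof (rule mult_left_mono[OF _ C4(1)])
        have "(u / 4) ^ (N + 1) \<le> fact (N + 1) * exp (u / 4)" using u1 by (intro power_le_exp) simp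
        hence "u ^ (N + 1) \<le> fact (N + 1) * exp (u / 4) * 4 ^ (N + 1)" by (simp only: power_divide pos_divide_le_eq zero_less_power zero_less_numeral)
        hence "U * exp (- (u / 4)) \<le> (fact (N + 1) * exp (u / 4) * 4 ^ (N + 1)) * exp (- (u / 4))"
          unfolding U_def by (intro mult_right_mono) auto
        also have "\<dots> = fact (N + 1) * 4 ^ (N + 1) * (exp (u / 4) * exp (- (u / 4)))" by (simp only: mult_ac)
        also have "exp (u / 4) * exp (- (u / 4)) = 1" by (simp flip: exp_add)
        finally show "exp (- (u / 4)) \<le> fact (N + 1) * 4 ^ (N + 1) / U" using U by (simp add: le_divide_eq mult.commute)
      qed
      finally show ?thesis by (simp add: K4_def)
    qed
    ultimately have "\<bar>R2 x - R2_main N x\<bar> \<le> C2 / U + 2 * (1 / U) + \<bar>\<kappa>\<bar> * 2 / U + K1 / U + C3 / U + K4 / U"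
      by linarith
    also have "\<dots> = C / U" by (simp add: C_def add_divide_distrib)
    finally show "\<bar>R2 x - R2_main N x\<bar> \<le> C / ln x ^ (N + 1)" by (simp add: U_def u_def)
  qed
qed

text \<open>For \<open>x < 4\<close> the square root of \<open>x\<close> is below the first prime
  and the asymptotic estimates do not reach, but everything is bounded. The lower end
  \<open>3\<close> exceeds \<open>exp 1\<close>, so \<open>ln x \<ge> 1\<close>, which makes
  \<open>loglog x\<close> nonnegative and the powers of \<open>ln x\<close> at least
  \<open>1\<close>.\<close>

lemma R2_bounded_small:
  obtains K where "K \<ge> 0" "\<And>x. 3 \<le> x \<Longrightarrow> x \<le> 4 \<Longrightarrow> \<bar>R2 x - R2_main N x\<bar> \<le> K"
proof -
  define K where "K = R2 4 + ((ln 4 + \<bar>mertens_const\<bar>)\<^sup>2 / 2 + \<bar>prime_zeta 2 - zeta 2\<bar> / 2 + (\<Sum>j=1..N. \<bar>alpha j\<bar>))"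
  have R2_nonneg: "R2 x \<ge> 0" for x unfolding R2_def by (rule sum_nonneg) auto
  show ?thesis
  proof (rule that[of K])
    show "K \<ge> 0" unfolding K_def by (intro add_nonneg_nonneg R2_nonneg sum_nonneg) auto
    fix x :: real assume x: "3 \<le> x" "x \<le> 4"
    have "finite {n. real n \<le> 4}"
      by (rule finite_subset[of _ "{..4}"]) auto
    hence "R2 x \<le> R2 4" unfolding R2_def using x
      by (intro sum_mono2) (auto elim: finite_subset[rotated])
    moreover have "\<bar>R2_main N x\<bar> \<le> (ln 4 + \<bar>mertens_const\<bar>)\<^sup>2 / 2 + \<bar>prime_zeta 2 - zeta 2\<bar> / 2 + (\<Sum>j=1..N. \<bar>alpha j\<bar>)"
    proof -
      have "exp 1 \<le> x" using exp_le x by linarith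
      hence lx: "ln x \<ge> 1" using x by (simp add: ln_ge_iff)
      have "0 \<le> loglog x" unfolding loglog_def using lx by simp
      moreover have "loglog x \<le> ln 4"
      proof -
        have "ln (ln x) \<le> ln x" using lx ln_le_minus_one[of "ln x"] by linarith
        also have "\<dots> \<le> ln 4" using x by simp
        finally show ?thesis by (simp add: loglog_def)
      qed
      ultimately have "\<bar>loglog x + mertens_const\<bar> \<le> ln 4 + \<bar>mertens_const\<bar>" by linarith
      hence 1: "(loglog x + mertens_const)\<^sup>2 \<le> (ln 4 + \<bar>mertens_const\<bar>)\<^sup>2"
        by (metis abs_ge_zero power2_abs power_mono)
      have 2: "\<bar>\<Sum>j=1..N. alpha j / ln x ^ j\<bar> \<le> (\<Sum>j=1..N. \<bar>alpha j\<bar>)"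
      proof (rule order_trans[OF sum_abs sum_mono])
        fix j
        have "1 \<le> ln x ^ j" using lx by (rule one_le_power)
        hence "\<bar>alpha j\<bar> / ln x ^ j \<le> \<bar>alpha j\<bar> / 1" by (intro divide_left_mono) auto
        thus "\<bar>alpha j / ln x ^ j\<bar> \<le> \<bar>alpha j\<bar>" using lx by simp
      qed
      have "\<bar>R2_main N x\<bar> \<le> \<bar>(loglog x + mertens_const)\<^sup>2 / 2\<bar> + \<bar>(prime_zeta 2 - zeta 2) / 2\<bar> + \<bar>\<Sum>j=1..N. alpha j / ln x ^ j\<bar>"
        unfolding R2_main_def by linarith
      thus ?thesis using 1 2 by simp
    qed
    ultimately show "\<bar>R2 x - R2_main N x\<bar> \<le> K" using R2_nonneg[of x] unfolding K_def by linarith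
  qed
qed

theorem theorem1p4:
  fixes N :: nat
  shows "(\<forall>j\<in>{1..N}. alpha_integrand j integrable_on {2..}) \<and>
    (\<exists>C. \<forall>x::real. x \<ge> 3 \<longrightarrow>
      \<bar>R2 x - ((loglog x + mertens_const)\<^sup>2 / 2 + (prime_zeta 2 - zeta 2) / 2
         + (\<Sum>j=1..N. alpha j / ln x ^ j))\<bar> \<le> C / ln x ^ (N + 1))"
proof (intro conjI ballI)
  \<comment> \<open>This part guarantees that the integral in \<open>alpha j\<close> is a genuine
    one and not the default value \<open>0\<close>.\<close>
  fix j assume "j \<in> {1..N}"
  thus "alpha_integrand j integrable_on {2..}" by (intro alpha_integrand_integrable) auto
next
  obtain C where C: "C \<ge> 0" "\<And>x. x \<ge> 4 \<Longrightarrow> \<bar>R2 x - R2_main N x\<bar> \<le> C / ln x ^ (N + 1)"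
    using R2_expansion_large[of N] by blast
  obtain K where K: "K \<ge> 0" "\<And>x. 3 \<le> x \<Longrightarrow> x \<le> 4 \<Longrightarrow> \<bar>R2 x - R2_main N x\<bar> \<le> K"
    using R2_bounded_small[of N] by blast
  \<comment> \<open>On \<open>[3, 4]\<close> the factor \<open>ln 4 ^ (N + 1)\<close> compensates
    the division by \<open>ln x ^ (N + 1)\<close>.\<close>
  have "\<bar>R2 x - R2_main N x\<bar> \<le> max C (K * ln 4 ^ (N + 1)) / ln x ^ (N + 1)" if x: "x \<ge> 3" for x
  proof -
    have lx: "ln x > 0" using x by simp
    show ?thesis
    proof (cases "x \<ge> 4")
      case True
      have "C / ln x ^ (N + 1) \<le> max C (K * ln 4 ^ (N + 1)) / ln x ^ (N + 1)"
        using lx by (intro divide_right_mono) auto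
      thus ?thesis using C(2)[OF True] by linarith
    next
      case False
      have "\<bar>R2 x - R2_main N x\<bar> * ln x ^ (N + 1) \<le> K * ln 4 ^ (N + 1)"
        using K x False lx by (intro mult_mono power_mono) auto
      also have "\<dots> \<le> max C (K * ln 4 ^ (N + 1))" by simp
      finally show ?thesis using lx by (simp only: pos_le_divide_eq zero_less_power)
    qed
  qed
  thus "\<exists>C. \<forall>x::real. x \<ge> 3 \<longrightarrow>
      \<bar>R2 x - ((loglog x + mertens_const)\<^sup>2 / 2 + (prime_zeta 2 - zeta 2) / 2
         + (\<Sum>j=1..N. alpha j / ln x ^ j))\<bar> \<le> C / ln x ^ (N + 1)"
    unfolding R2_main_def by blast
qed

end
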